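(* Let $k$ be a field of characteristic zero, let $G$ be a (discrete) group, and let $A=k[G]$ be its group ring. Then the homomorphism $$(\pi\circ\mathrm{tr}\circ\varphi)_*:HL_{*+1}(gl(A))\to H_*(BG;\,k)$$ is surjective, and the homomorphism $$(\pi\circ\mathrm{tr}\circ\varphi)^*:H^*(BG;\,k)\to HL^{*+1}(gl(A))$$ is injective.
   Context: Tensor products are over $k$; $(x_0,\ldots,x_n)$ denotes $x_0\otimes\cdots\otimes x_n$; $S_n$ is the symmetric group on $\{1,\ldots,n\}$. $gl(A)=\varinjlim_n gl_n(A)$ is the algebra of infinite matrices over $A$ with finitely many nonzero entries, regarded as an associative (non-unital) algebra and as a Lie algebra via $[x,y]=xy-yx$. For an associative $k$-algebra $R$ (not necessarily unital): Leibniz homology $HL_*(R)$ is the homology of $CL_*(R)$: $CL_0(R)=k$, $CL_{n}(R)=R^{\otimes n}$ for $n\ge1$, with differential $0$ from $CL_1(R)=R$ to $k$ and, for $n\ge 1$, $d:R^{\otimes(n+1)}\to R^{\otimes n}$, $$d(x_0\otimes\cdots\otimes x_n)=\sum_{0\le i<j\le n}(-1)^{j+1}(x_0,\ldots,x_{i-1},[x_i,x_j],x_{i+1},\ldots,\widehat{x}_j,\ldots,x_n).$$ Leibniz cohomology $HL^*(R)$ is the cohomology of the dual complex $\mathrm{Hom}_k(CL_*(R),k)$. The Hochschild complex is $CHH_n(R)=R^{\otimes(n+1)}$, $n\ge0$, with $b=\sum_{i=0}^n(-1)^id_i$, $d_i(x_0,\ldots,x_n)=(x_0,\ldots,x_ix_{i+1},\ldots,x_n)$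 for $0\le i<n$, $d_n(x_0,\ldots,x_n)=(x_nx_0,x_1,\ldots,x_{n-1})$. The three chain maps composed are: (1) $\varphi:CL_{*+1}(gl(A))\to CHH_*(gl(A))$, $\varphi_n(x_0,\ldots,x_n)=\sum_{\sigma\in S_n}(\mathrm{sgn}\,\sigma)(x_0,x_{\sigma^{-1}(1)},\ldots,x_{\sigma^{-1}(n)})$. (2) $\mathrm{tr}:CHH_*(gl(A))\to CHH_*(A)$; for matrices ${}_pM=[{}_pm_{ij}]$, $\mathrm{tr}({}_0M\otimes\cdots\otimes{}_nM)=\sum_{i_1,\ldots,i_{n+1}}{}_0m_{i_1i_2}\otimes{}_1m_{i_2i_3}\otimes\cdots\otimes{}_nm_{i_{n+1}i_1}$. (3) $\pi:CHH_*(k[G])\to B_*(G)$, $\pi(g_0,g_1,\ldots,g_n)=(g_1,\ldots,g_n)$ for $g_i\in G$, where $B_n(G)=k[G^n]$, $n\ge0$, is the bar complex with differential $\sum_{i=0}^n(-1)^id_i$, $d_0(g_1,\ldots,g_n)=(g_2,\ldots,g_n)$, $d_i(g_1,\ldots,g_n)=(g_1,\ldots,g_ig_{i+1},\ldots,g_n)$ for $1\le i\le n-1$, $d_n(g_1,\ldots,g_n)=(g_1,\ldots,g_{n-1})$. $H_*(BG;k)$ is the homology of $B_*(G)$ and $H^*(BG;k)$ the cohomology of $\mathrm{Hom}_k(B_*(G),k)$. *)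

theory Defs
  imports Complex_Main "HOL-Algebra.Module" "HOL-Algebra.AbelCoset" "HOL-Library.Poly_Mapping"
    "HOL-Combinatorics.Permutations"
begin

text \<open>
  Vector spaces over a field \<open>'k\<close> and associative, not necessarily unital, \<open>'k\<close>-algebras are
  both records of type \<open>('k, 'v) module\<close>.  The fields \<open>mult\<close> and \<open>one\<close> carry no information
  for vector spaces, and \<open>one\<close> carries none for non-unital algebras; these are left undefined.
\<close>

section \<open>Linear algebra\<close>

definition linear_maps ::
    "('k, 'v, 'x) module_scheme \<Rightarrow> ('k, 'w, 'y) module_scheme \<Rightarrow> ('v \<Rightarrow> 'w) set" where
  "linear_maps M N = {f \<in> hom (add_monoid M) (add_monoid N).
     \<forall>c. \<forall>x\<in>carrier M. f (c \<odot>\<^bsub>M\<^esub> x) = c \<odot>\<^bsub>N\<^esub> f x}"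

definition ground_field :: "('k::field, 'k) module" where
  "ground_field = \<lparr>carrier = UNIV, monoid.mult = (*), one = 1, zero = 0, add = (+), smult = (*)\<rparr>"

definition dual :: "('k::field, 'v) module \<Rightarrow> ('k, 'v \<Rightarrow> 'k) module" where
  "dual M = \<lparr>carrier = linear_maps M ground_field \<inter> extensional (carrier M),
     monoid.mult = undefined, one = undefined,
     zero = (\<lambda>x\<in>carrier M. 0),
     add = (\<lambda>u v. \<lambda>x\<in>carrier M. u x + v x),
     smult = (\<lambda>c u. \<lambda>x\<in>carrier M. c * u x)\<rparr>"

text \<open>The transpose of \<open>f : M \<rightarrow> N\<close>, from the dual of \<open>N\<close> to the dual of \<open>M\<close>.\<close>

definition dual_map :: "('k, 'v) module \<Rightarrow> ('v \<Rightarrow> 'w) \<Rightarrow> ('w \<Rightarrow> 'k) \<Rightarrow> ('v \<Rightarrow> 'k)" where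
  "dual_map M f u = (\<lambda>x\<in>carrier M. u (f x))"

definition quotient_module :: "('k, 'v) module \<Rightarrow> 'v set \<Rightarrow> ('k, 'v set) module" where
  "quotient_module M N = \<lparr>carrier = a_rcosets\<^bsub>M\<^esub> N,
     monoid.mult = undefined, one = undefined,
     zero = N,
     add = (\<lambda>X Y. X <+>\<^bsub>M\<^esub> Y),
     smult = (\<lambda>c X. \<Union>x\<in>X. N +>\<^bsub>M\<^esub> (c \<odot>\<^bsub>M\<^esub> x))\<rparr>"

text \<open>The map on a quotient induced by a map that is constant on cosets.\<close>

definition descend :: "('v \<Rightarrow> 'w) \<Rightarrow> 'v set \<Rightarrow> 'w" where
  "descend f X = the_elem (f ` X)"

definition scale_pm :: "'k::field \<Rightarrow> ('b \<Rightarrow>\<^sub>0 'k) \<Rightarrow> ('b \<Rightarrow>\<^sub>0 'k)" where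
  "scale_pm c = Poly_Mapping.map (\<lambda>a. c * a)"

definition free_module :: "'b set \<Rightarrow> ('k::field, 'b \<Rightarrow>\<^sub>0 'k) module" where
  "free_module B = \<lparr>carrier = {x. Poly_Mapping.keys x \<subseteq> B},
     monoid.mult = undefined, one = undefined,
     zero = 0, add = (+), smult = scale_pm\<rparr>"

definition linear_extension ::
    "('k::field, 'v) module \<Rightarrow> ('b \<Rightarrow> 'v) \<Rightarrow> ('b \<Rightarrow>\<^sub>0 'k) \<Rightarrow> 'v" where
  "linear_extension M f x =
     (\<Oplus>\<^bsub>M\<^esub> b \<in> Poly_Mapping.keys x. Poly_Mapping.lookup x b \<odot>\<^bsub>M\<^esub> f b)"


section \<open>Tensor powers\<close>

text \<open>
  The \<open>n\<close>-th tensor power of \<open>R\<close> is the free vector space on the lists of length \<open>n\<close> over \<open>R\<close>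
  modulo the subspace of multilinearity relations.  For \<open>n = 0\<close> there are no relations and the
  result is the free vector space on the empty list, i.e. the ground field.
\<close>

definition multilinear_relators :: "('k::field, 'r) module \<Rightarrow> nat \<Rightarrow> ('r list \<Rightarrow>\<^sub>0 'k) set" where
  "multilinear_relators R n =
     {Poly_Mapping.single (xs @ [x \<oplus>\<^bsub>R\<^esub> y] @ ys) 1
        - Poly_Mapping.single (xs @ [x] @ ys) 1 - Poly_Mapping.single (xs @ [y] @ ys) 1 | xs x y ys.
        set xs \<subseteq> carrier R \<and> x \<in> carrier R \<and> y \<in> carrier R \<and> set ys \<subseteq> carrier R \<and>
        length xs + length ys + 1 = n} \<union>
     {Poly_Mapping.single (xs @ [c \<odot>\<^bsub>R\<^esub> x] @ ys) 1
        - scale_pm c (Poly_Mapping.single (xs @ [x] @ ys) 1) | xs c x ys.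
        set xs \<subseteq> carrier R \<and> x \<in> carrier R \<and> set ys \<subseteq> carrier R \<and>
        length xs + length ys + 1 = n}"

definition multilinear_relations :: "('k::field, 'r) module \<Rightarrow> nat \<Rightarrow> ('r list \<Rightarrow>\<^sub>0 'k) set" where
  "multilinear_relations R n = module.span scale_pm (multilinear_relators R n)"

definition tensor_power ::
    "('k::field, 'r) module \<Rightarrow> nat \<Rightarrow> ('k, ('r list \<Rightarrow>\<^sub>0 'k) set) module" where
  "tensor_power R n = quotient_module
     (free_module {xs. length xs = n \<and> set xs \<subseteq> carrier R}) (multilinear_relations R n)"

definition tensor :: "('k::field, 'r) module \<Rightarrow> 'r list \<Rightarrow> ('r list \<Rightarrow>\<^sub>0 'k) set" where
  "tensor R xs = multilinear_relations R (length xs)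
     +>\<^bsub>free_module {ys. length ys = length xs \<and> set ys \<subseteq> carrier R}\<^esub> Poly_Mapping.single xs 1"

text \<open>The linear map to \<open>M\<close> that sends \<open>tensor R xs\<close> to \<open>f xs\<close>, for multilinear \<open>f\<close>.\<close>

definition tensor_lift ::
    "('k::field, 'v) module \<Rightarrow> ('r list \<Rightarrow> 'v) \<Rightarrow> ('r list \<Rightarrow>\<^sub>0 'k) set \<Rightarrow> 'v" where
  "tensor_lift M f = descend (linear_extension M f)"


section \<open>Homology and cohomology\<close>

text \<open>
  In a chain complex, \<open>d n\<close> goes from \<open>C n\<close> to \<open>C (n - 1)\<close> for \<open>n \<ge> 1\<close>; the map \<open>d 0\<close> is
  ignored.  In a cochain complex, \<open>\<delta> n\<close> goes from \<open>D n\<close> to \<open>D (Suc n)\<close>.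
\<close>

definition cycles :: "(nat \<Rightarrow> ('k, 'v) module) \<Rightarrow> (nat \<Rightarrow> 'v \<Rightarrow> 'v) \<Rightarrow> nat \<Rightarrow> 'v set" where
  "cycles C d n = {x \<in> carrier (C n). n \<noteq> 0 \<longrightarrow> d n x = \<zero>\<^bsub>C (n - 1)\<^esub>}"

definition boundaries :: "(nat \<Rightarrow> ('k, 'v) module) \<Rightarrow> (nat \<Rightarrow> 'v \<Rightarrow> 'v) \<Rightarrow> nat \<Rightarrow> 'v set" where
  "boundaries C d n = d (Suc n) ` carrier (C (Suc n))"

definition homology ::
    "(nat \<Rightarrow> ('k, 'v) module) \<Rightarrow> (nat \<Rightarrow> 'v \<Rightarrow> 'v) \<Rightarrow> nat \<Rightarrow> ('k, 'v set) module" where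
  "homology C d n = quotient_module ((C n)\<lparr>carrier := cycles C d n\<rparr>) (boundaries C d n)"

text \<open>The map on homology induced by a chain map with component \<open>f\<close> into degree \<open>n\<close> of \<open>(C, d)\<close>.\<close>

definition homology_map ::
    "(nat \<Rightarrow> ('k, 'w) module) \<Rightarrow> (nat \<Rightarrow> 'w \<Rightarrow> 'w) \<Rightarrow> nat \<Rightarrow> ('v \<Rightarrow> 'w) \<Rightarrow> 'v set \<Rightarrow> 'w set" where
  "homology_map C d n f = descend (\<lambda>x. boundaries C d n +>\<^bsub>C n\<^esub> f x)"

definition cocycles :: "(nat \<Rightarrow> ('k, 'v) module) \<Rightarrow> (nat \<Rightarrow> 'v \<Rightarrow> 'v) \<Rightarrow> nat \<Rightarrow> 'v set" where
  "cocycles D \<delta> n = {u \<in> carrier (D n). \<delta> n u = \<zero>\<^bsub>D (Suc n)\<^esub>}"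

definition coboundaries :: "(nat \<Rightarrow> ('k, 'v) module) \<Rightarrow> (nat \<Rightarrow> 'v \<Rightarrow> 'v) \<Rightarrow> nat \<Rightarrow> 'v set" where
  "coboundaries D \<delta> n =
     (case n of 0 \<Rightarrow> {\<zero>\<^bsub>D 0\<^esub>} | Suc m \<Rightarrow> \<delta> m ` carrier (D m))"

definition cohomology ::
    "(nat \<Rightarrow> ('k, 'v) module) \<Rightarrow> (nat \<Rightarrow> 'v \<Rightarrow> 'v) \<Rightarrow> nat \<Rightarrow> ('k, 'v set) module" where
  "cohomology D \<delta> n = quotient_module ((D n)\<lparr>carrier := cocycles D \<delta> n\<rparr>) (coboundaries D \<delta> n)"

definition cohomology_map ::
    "(nat \<Rightarrow> ('k, 'w) module) \<Rightarrow> (nat \<Rightarrow> 'w \<Rightarrow> 'w) \<Rightarrow> nat \<Rightarrow> ('v \<Rightarrow> 'w) \<Rightarrow> 'v set \<Rightarrow> 'w set" where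
  "cohomology_map D \<delta> n f = descend (\<lambda>u. coboundaries D \<delta> n +>\<^bsub>D n\<^esub> f u)"

definition dual_complex :: "(nat \<Rightarrow> ('k::field, 'v) module) \<Rightarrow> nat \<Rightarrow> ('k, 'v \<Rightarrow> 'k) module" where
  "dual_complex C n = dual (C n)"

definition dual_diff ::
    "(nat \<Rightarrow> ('k, 'v) module) \<Rightarrow> (nat \<Rightarrow> 'v \<Rightarrow> 'v) \<Rightarrow> nat \<Rightarrow> ('v \<Rightarrow> 'k) \<Rightarrow> ('v \<Rightarrow> 'k)" where
  "dual_diff C d n = dual_map (C (Suc n)) (d (Suc n))"


section \<open>Leibniz homology and cohomology\<close>

definition commutator :: "('k, 'r) module \<Rightarrow> 'r \<Rightarrow> 'r \<Rightarrow> 'r" where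
  "commutator R x y = x \<otimes>\<^bsub>R\<^esub> y \<ominus>\<^bsub>R\<^esub> y \<otimes>\<^bsub>R\<^esub> x"

definition remove_nth :: "nat \<Rightarrow> 'a list \<Rightarrow> 'a list" where
  "remove_nth j xs = take j xs @ drop (Suc j) xs"

definition CL :: "('k::field, 'r) module \<Rightarrow> nat \<Rightarrow> ('k, ('r list \<Rightarrow>\<^sub>0 'k) set) module" where
  "CL R n = tensor_power R n"

text \<open>On \<open>CL R 1\<close> the sum is empty, so the differential to \<open>CL R 0\<close> is zero.\<close>

definition leibniz_diff ::
    "('k::field, 'r) module \<Rightarrow> nat \<Rightarrow> ('r list \<Rightarrow>\<^sub>0 'k) set \<Rightarrow> ('r list \<Rightarrow>\<^sub>0 'k) set" where
  "leibniz_diff R n = tensor_lift (CL R (n - 1))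
     (\<lambda>xs. \<Oplus>\<^bsub>CL R (n - 1)\<^esub> j \<in> {0..<n}. \<Oplus>\<^bsub>CL R (n - 1)\<^esub> i \<in> {0..<j}.
        (- 1) ^ (j + 1) \<odot>\<^bsub>CL R (n - 1)\<^esub>
          tensor R (remove_nth j (xs[i := commutator R (xs ! i) (xs ! j)])))"

definition HL :: "('k::field, 'r) module \<Rightarrow> nat \<Rightarrow> ('k, ('r list \<Rightarrow>\<^sub>0 'k) set set) module" where
  "HL R = homology (CL R) (leibniz_diff R)"

definition HL_cohomology ::
    "('k::field, 'r) module \<Rightarrow> nat \<Rightarrow> ('k, (('r list \<Rightarrow>\<^sub>0 'k) set \<Rightarrow> 'k) set) module" where
  "HL_cohomology R = cohomology (dual_complex (CL R)) (dual_diff (CL R) (leibniz_diff R))"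


section \<open>The bar complex\<close>

definition bar :: "('g, 'm) monoid_scheme \<Rightarrow> nat \<Rightarrow> ('k::field, 'g list \<Rightarrow>\<^sub>0 'k) module" where
  "bar G n = free_module {gs. length gs = n \<and> set gs \<subseteq> carrier G}"

text \<open>Lists are indexed from \<open>0\<close>, so \<open>g\<^sub>i\<close> is \<open>gs ! (i - 1)\<close>.\<close>

definition bar_face :: "('g, 'm) monoid_scheme \<Rightarrow> nat \<Rightarrow> nat \<Rightarrow> 'g list \<Rightarrow> 'g list" where
  "bar_face G n i gs =
     (if i = 0 then tl gs
      else if i = n then butlast gs
      else take (i - 1) gs @ [gs ! (i - 1) \<otimes>\<^bsub>G\<^esub> gs ! i] @ drop (i + 1) gs)"

definition bar_diff ::
    "('g, 'm) monoid_scheme \<Rightarrow> nat \<Rightarrow> ('g list \<Rightarrow>\<^sub>0 'k::field) \<Rightarrow> ('g list \<Rightarrow>\<^sub>0 'k)" where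
  "bar_diff G n = linear_extension (bar G (n - 1))
     (\<lambda>gs. \<Oplus>\<^bsub>bar G (n - 1)\<^esub> i \<in> {0..n}.
        (- 1) ^ i \<odot>\<^bsub>bar G (n - 1)\<^esub> Poly_Mapping.single (bar_face G n i gs) 1)"

definition BG_homology ::
    "('g, 'm) monoid_scheme \<Rightarrow> nat \<Rightarrow> ('k::field, ('g list \<Rightarrow>\<^sub>0 'k) set) module" where
  "BG_homology G = homology (bar G) (bar_diff G)"

definition BG_cohomology ::
    "('g, 'm) monoid_scheme \<Rightarrow> nat \<Rightarrow> ('k::field, (('g list \<Rightarrow>\<^sub>0 'k) \<Rightarrow> 'k) set) module" where
  "BG_cohomology G = cohomology (dual_complex (bar G)) (dual_diff (bar G) (bar_diff G))"


section \<open>Group rings and infinite matrices\<close>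

definition group_ring :: "('g, 'm) monoid_scheme \<Rightarrow> ('k::field, 'g \<Rightarrow>\<^sub>0 'k) module" where
  "group_ring G = \<lparr>carrier = {x. Poly_Mapping.keys x \<subseteq> carrier G},
     monoid.mult = (\<lambda>x y. \<Sum>g\<in>Poly_Mapping.keys x. \<Sum>h\<in>Poly_Mapping.keys y.
       Poly_Mapping.single (g \<otimes>\<^bsub>G\<^esub> h) (Poly_Mapping.lookup x g * Poly_Mapping.lookup y h)),
     one = Poly_Mapping.single \<one>\<^bsub>G\<^esub> 1,
     zero = 0, add = (+), smult = scale_pm\<rparr>"

text \<open>Rows and columns are indexed from \<open>0\<close>; the product sums over a finite set containing all nonzero terms.\<close>

definition gl :: "('k, 'a) module \<Rightarrow> ('k, nat \<Rightarrow> nat \<Rightarrow> 'a) module" where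
  "gl A = \<lparr>carrier =
       {X. (\<forall>i j. X i j \<in> carrier A) \<and> finite {(i, j). X i j \<noteq> \<zero>\<^bsub>A\<^esub>}},
     monoid.mult = (\<lambda>X Y i j. \<Oplus>\<^bsub>A\<^esub> l \<in> {l. X i l \<noteq> \<zero>\<^bsub>A\<^esub>}. X i l \<otimes>\<^bsub>A\<^esub> Y l j),
     one = undefined,
     zero = (\<lambda>i j. \<zero>\<^bsub>A\<^esub>),
     add = (\<lambda>X Y i j. X i j \<oplus>\<^bsub>A\<^esub> Y i j),
     smult = (\<lambda>c X i j. c \<odot>\<^bsub>A\<^esub> X i j)\<rparr>"


section \<open>The three chain maps\<close>

definition CHH :: "('k::field, 'r) module \<Rightarrow> nat \<Rightarrow> ('k, ('r list \<Rightarrow>\<^sub>0 'k) set) module" where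
  "CHH R n = tensor_power R (n + 1)"

text \<open>A permutation of \<open>{1..n}\<close> fixes \<open>0\<close>, so \<open>x\<^sub>0\<close> stays in place.\<close>

definition antisymmetrize ::
    "('k::field, 'r) module \<Rightarrow> nat \<Rightarrow> ('r list \<Rightarrow>\<^sub>0 'k) set \<Rightarrow> ('r list \<Rightarrow>\<^sub>0 'k) set" where
  "antisymmetrize R n = tensor_lift (CHH R n)
     (\<lambda>xs. \<Oplus>\<^bsub>CHH R n\<^esub> \<sigma> \<in> {\<sigma>. \<sigma> permutes {1..n}}.
        of_int (sign \<sigma>) \<odot>\<^bsub>CHH R n\<^esub> tensor R (map (\<lambda>p. xs ! (inv_into UNIV \<sigma> p)) [0..<n + 1]))"

text \<open>
  The trace sums over all index tuples; only the finitely many tuples for which every matrix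
  entry is nonzero contribute, and the sum is restricted to these because \<^const>\<open>finsum\<close>
  requires a finite index set.
\<close>

definition trace_map ::
    "('k::field, 'a) module \<Rightarrow> nat \<Rightarrow> ((nat \<Rightarrow> nat \<Rightarrow> 'a) list \<Rightarrow>\<^sub>0 'k) set \<Rightarrow> ('a list \<Rightarrow>\<^sub>0 'k) set" where
  "trace_map A n = tensor_lift (CHH A n)
     (\<lambda>Xs. let entries = (\<lambda>is. map (\<lambda>p. (Xs ! p) (is ! p) (is ! ((p + 1) mod (n + 1)))) [0..<n + 1])
       in \<Oplus>\<^bsub>CHH A n\<^esub> is \<in> {is. length is = n + 1 \<and> \<zero>\<^bsub>A\<^esub> \<notin> set (entries is)}.
         tensor A (entries is))"

text \<open>The multilinear extension of \<open>(g\<^sub>0, g\<^sub>1, \<dots>, g\<^sub>n) \<mapsto> (g\<^sub>1, \<dots>, g\<^sub>n)\<close>.\<close>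

definition bar_projection ::
    "('g, 'm) monoid_scheme \<Rightarrow> nat \<Rightarrow> (('g \<Rightarrow>\<^sub>0 'k::field) list \<Rightarrow>\<^sub>0 'k) set \<Rightarrow> ('g list \<Rightarrow>\<^sub>0 'k)" where
  "bar_projection G n = tensor_lift (bar G n)
     (\<lambda>as. \<Oplus>\<^bsub>bar G n\<^esub> gs \<in> {gs. length gs = n + 1 \<and> (\<forall>p\<le>n. gs ! p \<in> Poly_Mapping.keys (as ! p))}.
        (\<Prod>p\<le>n. Poly_Mapping.lookup (as ! p) (gs ! p)) \<odot>\<^bsub>bar G n\<^esub> Poly_Mapping.single (tl gs) 1)"

definition gl_to_bar ::
    "('g, 'm) monoid_scheme \<Rightarrow> nat \<Rightarrow>
     ((nat \<Rightarrow> nat \<Rightarrow> 'g \<Rightarrow>\<^sub>0 'k::field) list \<Rightarrow>\<^sub>0 'k) set \<Rightarrow> ('g list \<Rightarrow>\<^sub>0 'k)" where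
  "gl_to_bar G n =
     bar_projection G n \<circ> trace_map (group_ring G) n \<circ> antisymmetrize (gl (group_ring G)) n"

definition gl_to_bar_homology ::
    "('g, 'm) monoid_scheme \<Rightarrow> nat \<Rightarrow>
     ((nat \<Rightarrow> nat \<Rightarrow> 'g \<Rightarrow>\<^sub>0 'k::field) list \<Rightarrow>\<^sub>0 'k) set set \<Rightarrow> ('g list \<Rightarrow>\<^sub>0 'k) set" where
  "gl_to_bar_homology G n = homology_map (bar G) (bar_diff G) n (gl_to_bar G n)"

definition gl_to_bar_cohomology ::
    "('g, 'm) monoid_scheme \<Rightarrow> nat \<Rightarrow> (('g list \<Rightarrow>\<^sub>0 'k::field) \<Rightarrow> 'k) set \<Rightarrow>
     (((nat \<Rightarrow> nat \<Rightarrow> 'g \<Rightarrow>\<^sub>0 'k) list \<Rightarrow>\<^sub>0 'k) set \<Rightarrow> 'k) set" where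
  "gl_to_bar_cohomology G n =
     cohomology_map (dual_complex (CL (gl (group_ring G))))
       (dual_diff (CL (gl (group_ring G))) (leibniz_diff (gl (group_ring G)))) (Suc n)
       (dual_map (CL (gl (group_ring G)) (Suc n)) (gl_to_bar G n))"

end

theory Submission
  imports Defs
begin

text \<open>
  Let \<open>f = \<pi> \<circ> tr \<circ> \<phi>\<close>.  The theorem holds because \<open>f\<close> is a chain map that is split in each degree by
  an explicit map in the other direction.

  Why \<open>f\<close> is a chain map.  On tensors, \<open>f\<close> is the signed sum of \<open>\<pi> \<circ> tr\<close> over all rearrangements that
  keep the first letter in place.  Such a sum is built by inserting the letters one after the other.  If
  \<open>y\<close> is inserted into a word and two neighbours are multiplied, the two operations commute unless \<open>y\<close> is
  one of the two factors; the products \<open>w\<^sub>q y\<close> and \<open>y w\<^sub>q\<close> that remain come with opposite signs and add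
  up, up to a sign, to the commutators \<open>[w\<^sub>q, y]\<close>.  This is the recursion of the Leibniz differential in its last letter
  (\<open>insertions_hochschild\<close>, \<open>alternation_hochschild\<close>).  That \<open>\<pi> \<circ> tr\<close> respects the faces is checked on
  elementary matrices with a group element as entry, which span \<open>gl (k[G])\<close> (\<open>hochschild_trace_bar\<close>).

  Why \<open>f\<close> splits.  Put \<open>g\<^sub>0 = (g\<^sub>1 \<dots> g\<^sub>n)\<^sup>-\<^sup>1\<close> and send \<open>(g\<^sub>1, \<dots>, g\<^sub>n)\<close> to the tensor of the elementary
  matrices with entries \<open>g\<^sub>0, \<dots>, g\<^sub>n\<close> at the places \<open>(i\<^sub>n, i\<^sub>0), (i\<^sub>0, i\<^sub>1), \<dots>, (i\<^sub>n\<^sub>-\<^sub>1, i\<^sub>n)\<close>, where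
  \<open>i\<^sub>0, \<dots>, i\<^sub>n\<close> are distinct.  The only rearrangement with nonzero trace is the identity, so that \<open>f\<close>
  maps this tensor back to \<open>(g\<^sub>1, \<dots>, g\<^sub>n)\<close> (\<open>alternation_cyclic_word\<close>).  Only cyclically adjacent letters
  have a nonzero commutator, so that its Leibniz differential is the alternating sum of its Hochschild
  faces, and face \<open>k\<close> acts on the indices by removing \<open>i\<^sub>k\<close> (\<open>leibniz_diff_cyclic_word_faces\<close>).  A
  single list of indices does not give a chain map, as its faces differ.  But a linear combination \<open>c\<close> of
  lists of \<open>n + 1\<close> distinct indices, with coefficients of sum \<open>1\<close>, can be chosen such that all its faces
  are the same combination \<open>c'\<close> of lists of \<open>n\<close> distinct indices.  Starting from \<open>0\<close>, the faces are
  corrected one at a time by inserting a fresh index (\<open>fill_faces\<close>, \<open>equal_faces_exist\<close>); for \<open>n = 1\<close>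
  this leads to \<open>(a, x) + (x, b) - (a, b)\<close>.  Let \<open>s\<close> be the map above with the indices summed over \<open>c\<close>,
  and \<open>t\<close> its analogue for \<open>c'\<close> one degree lower.  Then \<open>f \<circ> s = id\<close> and \<open>d \<circ> s = t \<circ> \<partial>\<close>.

  Conclusion.  A cycle \<open>z\<close> of the bar complex is the image of the cycle \<open>s z\<close>.  If the pullback of a
  cocycle \<open>u\<close> along \<open>f\<close> is a coboundary \<open>v \<circ> d\<close>, then \<open>u = u \<circ> f \<circ> s = v \<circ> d \<circ> s = (v \<circ> t) \<circ> \<partial>\<close>
  (locale \<open>split_chain_map\<close>).
\<close>

section \<open>Vector spaces and linear maps\<close>

lemma cring_ground_field: "cring (ground_field :: ('k::field, 'k) module)"
proof (rule cringI)
  show "abelian_group (ground_field :: ('k, 'k) module)"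
  proof (rule abelian_groupI)
    fix x :: 'k
    show "\<exists>y\<in>carrier ground_field. y \<oplus>\<^bsub>ground_field\<^esub> x = \<zero>\<^bsub>ground_field\<^esub>"
      by (rule bexI[of _ "- x"]) (auto simp: ground_field_def)
  qed (auto simp: ground_field_def)
  show "comm_monoid (ground_field :: ('k, 'k) module)"
    by (rule comm_monoidI) (auto simp: ground_field_def)
qed (auto simp: ground_field_def algebra_simps)

locale vect = module ground_field M for M :: "('k::field, 'v) module" (structure)
begin

lemma smult_mem [simp, intro]: "x \<in> carrier M \<Longrightarrow> c \<odot> x \<in> carrier M"
  using smult_closed[of c x] by (simp add: ground_field_def)

lemma smult_add: "x \<in> carrier M \<Longrightarrow> y \<in> carrier M \<Longrightarrow> c \<odot> (x \<oplus> y) = c \<odot> x \<oplus> c \<odot> y"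
  using smult_r_distr[of c x y] by (simp add: ground_field_def)

lemma add_smult: "x \<in> carrier M \<Longrightarrow> (a + b) \<odot> x = a \<odot> x \<oplus> b \<odot> x"
  using smult_l_distr[of a b x] by (simp add: ground_field_def)

lemma mult_smult: "x \<in> carrier M \<Longrightarrow> (a * b) \<odot> x = a \<odot> (b \<odot> x)"
  using smult_assoc1[of a b x] by (simp add: ground_field_def)

lemma one_smult [simp]: "x \<in> carrier M \<Longrightarrow> 1 \<odot> x = x"
  using smult_one[of x] by (simp add: ground_field_def)

lemma zero_smult [simp]: "x \<in> carrier M \<Longrightarrow> 0 \<odot> x = \<zero>"
  using smult_l_null[of x] by (simp add: ground_field_def)

lemma smult_zero [simp]: "c \<odot> \<zero> = \<zero>"
  using smult_r_null[of c] by (simp add: ground_field_def)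

lemma minus_one_smult: "x \<in> carrier M \<Longrightarrow> (- 1) \<odot> x = \<ominus> x"
proof -
  assume x: "x \<in> carrier M"
  have "(- 1) \<odot> x \<oplus> x = \<zero>" using add_smult[of x "- 1" 1] x by simp
  then show ?thesis using x by (metis minus_equality smult_mem)
qed

lemma smult_finsum:
  "f \<in> A \<rightarrow> carrier M \<Longrightarrow> c \<odot> (\<Oplus>a\<in>A. f a) = (\<Oplus>a\<in>A. c \<odot> f a)"
  by (induction A rule: infinite_finite_induct) (simp_all add: Pi_def smult_add)

lemma finsum_single: "f a \<in> carrier M \<Longrightarrow> (\<Oplus>i\<in>{a}. f i) = f a"
  by (subst finsum_insert) auto

end

lemma vectI:
  fixes M :: "('k::field, 'v) module" (structure)
  assumes "abelian_group M"
    and "\<And>c x. x \<in> carrier M \<Longrightarrow> c \<odot> x \<in> carrier M"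
    and "\<And>a b x. x \<in> carrier M \<Longrightarrow> (a + b) \<odot> x = a \<odot> x \<oplus> b \<odot> x"
    and "\<And>c x y. x \<in> carrier M \<Longrightarrow> y \<in> carrier M \<Longrightarrow> c \<odot> (x \<oplus> y) = c \<odot> x \<oplus> c \<odot> y"
    and "\<And>a b x. x \<in> carrier M \<Longrightarrow> (a * b) \<odot> x = a \<odot> (b \<odot> x)"
    and "\<And>x. x \<in> carrier M \<Longrightarrow> 1 \<odot> x = x"
  shows "vect M"
  unfolding vect_def
  by (rule moduleI[OF cring_ground_field assms(1)]) (simp_all add: ground_field_def assms)

lemma linear_mapsI:
  assumes "\<And>x. x \<in> carrier M \<Longrightarrow> f x \<in> carrier N"
    and "\<And>x y. x \<in> carrier M \<Longrightarrow> y \<in> carrier M \<Longrightarrow> f (x \<oplus>\<^bsub>M\<^esub> y) = f x \<oplus>\<^bsub>N\<^esub> f y"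
    and "\<And>c x. x \<in> carrier M \<Longrightarrow> f (c \<odot>\<^bsub>M\<^esub> x) = c \<odot>\<^bsub>N\<^esub> f x"
  shows "f \<in> linear_maps M N"
  using assms by (auto simp: linear_maps_def hom_def)

lemma linear_maps_closed: "f \<in> linear_maps M N \<Longrightarrow> x \<in> carrier M \<Longrightarrow> f x \<in> carrier N"
  by (auto simp: linear_maps_def hom_def)

lemma linear_maps_add:
  "f \<in> linear_maps M N \<Longrightarrow> x \<in> carrier M \<Longrightarrow> y \<in> carrier M \<Longrightarrow> f (x \<oplus>\<^bsub>M\<^esub> y) = f x \<oplus>\<^bsub>N\<^esub> f y"
  by (auto simp: linear_maps_def hom_def)

lemma linear_maps_smult:
  "f \<in> linear_maps M N \<Longrightarrow> x \<in> carrier M \<Longrightarrow> f (c \<odot>\<^bsub>M\<^esub> x) = c \<odot>\<^bsub>N\<^esub> f x"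
  by (auto simp: linear_maps_def)

lemma linear_maps_comp:
  "f \<in> linear_maps M N \<Longrightarrow> g \<in> linear_maps N P \<Longrightarrow> (\<lambda>x. g (f x)) \<in> linear_maps M P"
  by (intro linear_mapsI) (auto simp: linear_maps_closed linear_maps_add linear_maps_smult)

lemma linear_maps_zero:
  assumes "vect M" "vect N" "f \<in> linear_maps M N"
  shows "f \<zero>\<^bsub>M\<^esub> = \<zero>\<^bsub>N\<^esub>"
proof -
  interpret M: vect M by fact
  interpret N: vect N by fact
  have "f (0 \<odot>\<^bsub>M\<^esub> \<zero>\<^bsub>M\<^esub>) = 0 \<odot>\<^bsub>N\<^esub> f \<zero>\<^bsub>M\<^esub>"
    using assms(3) by (rule linear_maps_smult) simp
  then show ?thesis using linear_maps_closed[OF assms(3)] by simp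
qed

lemma linear_maps_minus:
  assumes "vect M" "vect N" "f \<in> linear_maps M N" "x \<in> carrier M" "y \<in> carrier M"
  shows "f (x \<ominus>\<^bsub>M\<^esub> y) = f x \<ominus>\<^bsub>N\<^esub> f y"
proof -
  interpret M: vect M by fact
  interpret N: vect N by fact
  show ?thesis using assms(3-5) linear_maps_closed[OF assms(3)]
    by (simp add: M.minus_eq N.minus_eq linear_maps_add linear_maps_smult
        flip: M.minus_one_smult N.minus_one_smult)
qed

lemma linear_maps_finsum:
  assumes "vect M" "vect N" "f \<in> linear_maps M N" "h \<in> A \<rightarrow> carrier M"
  shows "f (\<Oplus>\<^bsub>M\<^esub>a\<in>A. h a) = (\<Oplus>\<^bsub>N\<^esub>a\<in>A. f (h a))"
proof -
  interpret M: vect M by fact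
  interpret N: vect N by fact
  show ?thesis using assms(4)
    by (induction A rule: infinite_finite_induct)
      (simp_all add: linear_maps_zero[OF assms(1-3)] Pi_def linear_maps_closed[OF assms(3)]
         linear_maps_add[OF assms(3)])
qed

lemma linear_maps_combination:
  assumes "vect N" "f \<in> linear_maps M N" "g \<in> linear_maps M N"
  shows "(\<lambda>x. f x \<oplus>\<^bsub>N\<^esub> g x) \<in> linear_maps M N" "(\<lambda>x. c \<odot>\<^bsub>N\<^esub> f x) \<in> linear_maps M N"
proof -
  interpret N: vect N by fact
  have cl: "f x \<in> carrier N" "g x \<in> carrier N" if "x \<in> carrier M" for x
    using that assms by (auto simp: linear_maps_closed)
  show "(\<lambda>x. f x \<oplus>\<^bsub>N\<^esub> g x) \<in> linear_maps M N"
    by (rule linear_mapsI)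
      (simp_all add: cl linear_maps_add[OF assms(2)] linear_maps_add[OF assms(3)]
        linear_maps_smult[OF assms(2)] linear_maps_smult[OF assms(3)] N.smult_add N.a_ac)
  show "(\<lambda>x. c \<odot>\<^bsub>N\<^esub> f x) \<in> linear_maps M N"
    by (rule linear_mapsI)
      (simp_all add: cl linear_maps_add[OF assms(2)] N.smult_add
        linear_maps_smult[OF assms(2)] mult.commute flip: N.mult_smult)
qed

lemma linear_maps_sum:
  assumes M: "vect M" and f: "\<And>a. a \<in> I \<Longrightarrow> f a \<in> linear_maps N M"
  shows "(\<lambda>x. \<Oplus>\<^bsub>M\<^esub>a\<in>I. f a x) \<in> linear_maps N M"
proof (rule linear_mapsI)
  interpret M: vect M by (rule M)
  fix x assume x: "x \<in> carrier N"
  show "(\<Oplus>\<^bsub>M\<^esub>a\<in>I. f a x) \<in> carrier M"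
    using linear_maps_closed[OF f] x by (intro M.finsum_closed) auto
  show "(\<Oplus>\<^bsub>M\<^esub>a\<in>I. f a (c \<odot>\<^bsub>N\<^esub> x)) = c \<odot>\<^bsub>M\<^esub> (\<Oplus>\<^bsub>M\<^esub>a\<in>I. f a x)" for c
    using linear_maps_closed[OF f] linear_maps_smult[OF f] x
    by (subst M.smult_finsum) (auto intro!: M.finsum_cong simp: simp_implies_def)
  fix y assume y: "y \<in> carrier N"
  show "(\<Oplus>\<^bsub>M\<^esub>a\<in>I. f a (x \<oplus>\<^bsub>N\<^esub> y)) = (\<Oplus>\<^bsub>M\<^esub>a\<in>I. f a x) \<oplus>\<^bsub>M\<^esub> (\<Oplus>\<^bsub>M\<^esub>a\<in>I. f a y)"
    using linear_maps_closed[OF f] linear_maps_add[OF f] x y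
    by (subst M.finsum_addf[symmetric]) (auto intro!: M.finsum_cong simp: simp_implies_def simp del: M.finsum_addf)
qed

lemma (in vect) minus_combination: "x \<in> carrier M \<Longrightarrow> y \<in> carrier M \<Longrightarrow> x \<ominus> y = x \<oplus> (- 1) \<odot> y"
  by (simp add: minus_eq minus_one_smult)


section \<open>Free modules\<close>

lemma lookup_scale_pm [simp]: "Poly_Mapping.lookup (scale_pm c x) b = c * Poly_Mapping.lookup x b"
  by (simp add: scale_pm_def Poly_Mapping.map.rep_eq when_def)

interpretation pm: vector_space "scale_pm :: 'k::field \<Rightarrow> ('b \<Rightarrow>\<^sub>0 'k) \<Rightarrow> ('b \<Rightarrow>\<^sub>0 'k)"
  by unfold_locales (auto intro!: poly_mapping_eqI simp: lookup_add algebra_simps)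

lemma scale_pm_single [simp]: "scale_pm c (Poly_Mapping.single b a) = Poly_Mapping.single b (c * a)"
  by (rule poly_mapping_eqI) (simp add: lookup_single when_def)

lemma free_module_simps [simp]:
  "carrier (free_module B) = {x. Poly_Mapping.keys x \<subseteq> B}"
  "zero (free_module B) = 0" "add (free_module B) = (+)" "smult (free_module B) = scale_pm"
  by (simp_all add: free_module_def)

lemma keys_scale_pm: "Poly_Mapping.keys (scale_pm c x) \<subseteq> Poly_Mapping.keys x"
  by (auto simp: in_keys_iff)

lemma vect_free_module: "vect (free_module B)"
proof (rule vectI)
  show "abelian_group (free_module B)"
  proof (rule abelian_groupI)
    fix x assume "x \<in> carrier (free_module B)"
    then show "\<exists>y\<in>carrier (free_module B). y \<oplus>\<^bsub>free_module B\<^esub> x = \<zero>\<^bsub>free_module B\<^esub>"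
      by (intro bexI[of _ "- x"]) auto
  qed (auto simp: algebra_simps dest!: subsetD[OF Poly_Mapping.keys_add])
qed (auto simp: pm.scale_left_distrib pm.scale_right_distrib dest!: subsetD[OF keys_scale_pm])

lemma finsum_free_module:
  assumes "\<And>a. a \<in> A \<Longrightarrow> Poly_Mapping.keys (h a) \<subseteq> B"
  shows "(\<Oplus>\<^bsub>free_module B\<^esub>a\<in>A. h a) = (\<Sum>a\<in>A. h a)"
proof -
  interpret vect "free_module B" by (rule vect_free_module)
  show ?thesis using assms
    by (induction A rule: infinite_finite_induct) (simp_all add: Pi_def)
qed

lemma single_sum_expansion:
  "x = (\<Sum>b\<in>Poly_Mapping.keys x. scale_pm (Poly_Mapping.lookup x b) (Poly_Mapping.single b 1))"
  by (rule poly_mapping_eqI)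
    (simp add: lookup_sum lookup_single when_def in_keys_iff)

text \<open>Linear combinations with different supports are compared over the union of the supports.\<close>

lemma (in vect) linear_extension_superset:
  assumes "finite S" "Poly_Mapping.keys x \<subseteq> S" "\<And>b. b \<in> S \<Longrightarrow> f b \<in> carrier M"
  shows "linear_extension M f x = (\<Oplus>b\<in>S. Poly_Mapping.lookup x b \<odot> f b)"
  unfolding linear_extension_def
  using assms by (intro add.finprod_mono_neutral_cong_left) (auto simp: in_keys_iff)

lemma linear_extension_linear:
  fixes M :: "('k::field, 'v) module" (structure) and f :: "'b \<Rightarrow> 'v"
  assumes "vect M" "\<And>b. b \<in> B \<Longrightarrow> f b \<in> carrier M"
  shows "linear_extension M f \<in> linear_maps (free_module B) M"
proof -
  interpret vect M by fact
  show ?thesis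
  proof (rule linear_mapsI)
    fix x :: "'b \<Rightarrow>\<^sub>0 'k" assume x: "x \<in> carrier (free_module B)"
    have fx: "f b \<in> carrier M" if "b \<in> Poly_Mapping.keys x" for b
      using that x assms(2) by auto
    then show "linear_extension M f x \<in> carrier M"
      unfolding linear_extension_def by (intro finsum_closed) auto
    have "linear_extension M f (scale_pm c x)
        = (\<Oplus>b\<in>Poly_Mapping.keys x. (c * Poly_Mapping.lookup x b) \<odot> f b)" for c
      by (subst linear_extension_superset[of "Poly_Mapping.keys x"]) (auto simp: fx keys_scale_pm)
    also have "\<dots> c = (\<Oplus>b\<in>Poly_Mapping.keys x. c \<odot> (Poly_Mapping.lookup x b \<odot> f b))" for c
      by (intro finsum_cong) (auto simp: fx mult_smult simp_implies_def)
    finally show "linear_extension M f (c \<odot>\<^bsub>free_module B\<^esub> x) = c \<odot> linear_extension M f x" for c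
      unfolding linear_extension_def by (subst smult_finsum) (auto simp: fx linear_extension_def)
    fix y :: "'b \<Rightarrow>\<^sub>0 'k" assume y: "y \<in> carrier (free_module B)"
    let ?S = "Poly_Mapping.keys x \<union> Poly_Mapping.keys y"
    have f: "f b \<in> carrier M" if "b \<in> ?S" for b using that x y assms(2) by auto
    have "linear_extension M f (x + y)
        = (\<Oplus>b\<in>?S. Poly_Mapping.lookup x b \<odot> f b \<oplus> Poly_Mapping.lookup y b \<odot> f b)"
      using Poly_Mapping.keys_add[of x y] f
      by (subst linear_extension_superset[of ?S])
        (auto simp: lookup_add add_smult simp_implies_def simp del: finsum_addf intro!: finsum_cong)
    also have "\<dots> = linear_extension M f x \<oplus> linear_extension M f y"
      using linear_extension_superset[of ?S x f] linear_extension_superset[of ?S y f] f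
      by (subst finsum_addf) auto
    finally show "linear_extension M f (x \<oplus>\<^bsub>free_module B\<^esub> y)
        = linear_extension M f x \<oplus> linear_extension M f y" by simp
  qed
qed

lemma linear_extension_single:
  assumes "vect M" "f b \<in> carrier M"
  shows "linear_extension M f (Poly_Mapping.single b 1) = f b"
proof -
  interpret vect M by fact
  show ?thesis using assms(2) unfolding linear_extension_def by simp
qed

lemma free_module_linear_expansion:
  fixes M :: "('k::field, 'v) module" (structure) and x :: "'b \<Rightarrow>\<^sub>0 'k"
  assumes "vect M" "f \<in> linear_maps (free_module B) M" "Poly_Mapping.keys x \<subseteq> B"
  shows "f x = (\<Oplus>b\<in>Poly_Mapping.keys x. Poly_Mapping.lookup x b \<odot> f (Poly_Mapping.single b 1))"
proof -
  interpret vect M by fact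
  let ?F = "free_module B"
  let ?h = "\<lambda>b. Poly_Mapping.lookup x b \<odot>\<^bsub>?F\<^esub> Poly_Mapping.single b 1"
  have mem: "?h \<in> Poly_Mapping.keys x \<rightarrow> carrier ?F"
    using assms(3) by (auto split: if_splits)
  have s: "Poly_Mapping.single b (1::'k) \<in> carrier ?F" if "b \<in> Poly_Mapping.keys x" for b
    using that assms(3) by auto
  have "x = (\<Sum>b\<in>Poly_Mapping.keys x. ?h b)"
    unfolding free_module_simps by (rule single_sum_expansion)
  also have "\<dots> = (\<Oplus>\<^bsub>?F\<^esub>b\<in>Poly_Mapping.keys x. ?h b)"
    using mem by (intro finsum_free_module[symmetric]) (auto simp: Pi_iff simp del: scale_pm_single)
  finally have "f x = f (\<Oplus>\<^bsub>?F\<^esub>b\<in>Poly_Mapping.keys x. ?h b)" by simp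
  also have "\<dots> = (\<Oplus>b\<in>Poly_Mapping.keys x. f (?h b))"
    by (rule linear_maps_finsum[OF vect_free_module assms(1,2) mem])
  also have "\<dots> = (\<Oplus>b\<in>Poly_Mapping.keys x. Poly_Mapping.lookup x b \<odot> f (Poly_Mapping.single b 1))"
    using linear_maps_closed[OF assms(2) s]
    by (intro finsum_cong) (auto simp: simp_implies_def linear_maps_smult[OF assms(2) s] simp del: free_module_simps)
  finally show ?thesis .
qed

lemma free_module_linear_eqI:
  assumes "vect M" "f \<in> linear_maps (free_module B) M" "g \<in> linear_maps (free_module B) M"
    and "\<And>b. b \<in> B \<Longrightarrow> f (Poly_Mapping.single b 1) = g (Poly_Mapping.single b 1)"
    and "Poly_Mapping.keys x \<subseteq> B"
  shows "f x = g x"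
proof -
  interpret vect M by fact
  have "f (Poly_Mapping.single b 1) \<in> carrier M" if "b \<in> Poly_Mapping.keys x" for b
    using that assms(5) by (intro linear_maps_closed[OF assms(2)]) auto
  then show ?thesis
    unfolding free_module_linear_expansion[OF assms(1,2,5)] free_module_linear_expansion[OF assms(1,3,5)]
    using assms(4,5) by (intro finsum_cong) (auto simp: simp_implies_def subset_iff)
qed


section \<open>Quotients and subquotients\<close>

lemma coset_carrier_update [simp]:
  "N +>\<^bsub>M\<lparr>carrier := K\<rparr>\<^esub> x = N +>\<^bsub>M\<^esub> x" "X <+>\<^bsub>M\<lparr>carrier := K\<rparr>\<^esub> Y = X <+>\<^bsub>M\<^esub> Y"
  by (simp_all add: a_r_coset_def' set_add_def')

lemma quotient_module_simps [simp]:
  "carrier (quotient_module M N) = (\<lambda>x. N +>\<^bsub>M\<^esub> x) ` carrier M"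
  "zero (quotient_module M N) = N"
  "add (quotient_module M N) = (\<lambda>X Y. X <+>\<^bsub>M\<^esub> Y)"
  "smult (quotient_module M N) = (\<lambda>c X. \<Union>x\<in>X. N +>\<^bsub>M\<^esub> (c \<odot>\<^bsub>M\<^esub> x))"
  by (auto simp: quotient_module_def A_RCOSETS_def' a_r_coset_def' image_def)

context vect
begin

lemma subspaceI:
  assumes "N \<subseteq> carrier M" "\<zero> \<in> N" "\<And>x y. x \<in> N \<Longrightarrow> y \<in> N \<Longrightarrow> x \<oplus> y \<in> N"
    and "\<And>c x. x \<in> N \<Longrightarrow> c \<odot> x \<in> N"
  shows "submodule N ground_field M"
proof (rule submoduleI[OF assms(1,2) _ assms(3)])
  fix x assume "x \<in> N"
  then show "\<ominus> x \<in> N" using assms(4)[of x "- 1"] subsetD[OF assms(1)] by (simp only: minus_one_smult)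
qed (use assms in blast)+

lemma subspaceD:
  assumes "submodule N ground_field M"
  shows "N \<subseteq> carrier M" "\<zero> \<in> N" "x \<in> N \<Longrightarrow> y \<in> N \<Longrightarrow> x \<oplus> y \<in> N" "x \<in> N \<Longrightarrow> c \<odot> x \<in> N"
    "x \<in> N \<Longrightarrow> y \<in> N \<Longrightarrow> x \<ominus> y \<in> N"
proof -
  interpret N: submodule N ground_field M by fact
  show sub: "N \<subseteq> carrier M" using N.subset by simp
  show "\<zero> \<in> N" using N.one_closed by simp
  show add: "x \<oplus> y \<in> N" if "x \<in> N" "y \<in> N" for x y using N.m_closed that by simp
  show sm: "c \<odot> x \<in> N" if "x \<in> N" for c x using N.smult_closed[of c x] that by (simp add: ground_field_def)
  show "x \<ominus> y \<in> N" if "x \<in> N" "y \<in> N"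
    using that add[of x "\<ominus> y"] sm[of y "- 1"] minus_one_smult[OF subsetD[OF sub that(2)]]
    by (simp only: minus_eq)
qed

lemma add_minus_cancel: "x \<in> carrier M \<Longrightarrow> y \<in> carrier M \<Longrightarrow> x \<oplus> y \<ominus> x \<ominus> y = \<zero>"
  by (simp add: minus_eq a_assoc r_neg a_comm[of x y])

lemma minus_eq_zeroD:
  assumes "x \<in> carrier M" "y \<in> carrier M" "x \<ominus> y = \<zero>"
  shows "x = y"
proof -
  have "x = (x \<ominus> y) \<oplus> y" using assms(1,2) by (simp add: minus_eq a_assoc l_neg)
  then show ?thesis using assms by simp
qed

context
  fixes N assumes N: "submodule N ground_field M"
begin

lemma mem_coset_iff:
  assumes "x \<in> carrier M"
  shows "y \<in> N +> x \<longleftrightarrow> y \<in> carrier M \<and> y \<ominus> x \<in> N"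
proof
  assume "y \<in> N +> x"
  then obtain h where "h \<in> N" "y = h \<oplus> x" by (auto simp: a_r_coset_def')
  with assms subspaceD(1)[OF N] show "y \<in> carrier M \<and> y \<ominus> x \<in> N"
    by (auto simp: minus_eq a_assoc r_neg)
next
  assume y: "y \<in> carrier M \<and> y \<ominus> x \<in> N"
  then have "y = (y \<ominus> x) \<oplus> x" using assms by (simp add: minus_eq a_assoc l_neg)
  with y show "y \<in> N +> x" by (auto simp: a_r_coset_def')
qed

lemma self_mem_coset: "x \<in> carrier M \<Longrightarrow> x \<in> N +> x"
  using subspaceD(2)[OF N] by (simp add: mem_coset_iff minus_eq r_neg)

lemma coset_eq_iff:
  assumes "x \<in> carrier M" "y \<in> carrier M"
  shows "N +> x = N +> y \<longleftrightarrow> x \<ominus> y \<in> N"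
proof
  assume "N +> x = N +> y"
  then have "x \<in> N +> y" using self_mem_coset[OF assms(1)] by simp
  then show "x \<ominus> y \<in> N" using assms by (simp add: mem_coset_iff)
next
  assume d: "x \<ominus> y \<in> N"
  have e: "z \<ominus> y = (z \<ominus> x) \<oplus> (x \<ominus> y)" if "z \<in> carrier M" for z
  proof -
    have "(z \<ominus> x) \<oplus> (x \<ominus> y) = z \<oplus> ((\<ominus> x \<oplus> x) \<oplus> \<ominus> y)"
      using that assms by (simp only: minus_eq a_assoc a_inv_closed a_closed)
    then show ?thesis using that assms by (simp add: l_neg minus_eq)
  qed
  have f: "z \<ominus> x = (z \<ominus> y) \<ominus> (x \<ominus> y)" if "z \<in> carrier M" for z
  proof -
    have "(z \<ominus> y) \<ominus> (x \<ominus> y) = z \<oplus> ((\<ominus> y \<oplus> y) \<oplus> \<ominus> x)"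
      using that assms by (simp add: minus_eq minus_add a_ac del: l_neg)
    then show ?thesis using that assms by (simp add: l_neg minus_eq)
  qed
  show "N +> x = N +> y"
  proof (rule Set.set_eqI)
    fix z show "z \<in> N +> x \<longleftrightarrow> z \<in> N +> y"
      using assms d subspaceD(3,5)[OF N] e f by (metis mem_coset_iff)
  qed
qed

lemma coset_add: "x \<in> carrier M \<Longrightarrow> y \<in> carrier M \<Longrightarrow> (N +> x) <+> (N +> y) = N +> (x \<oplus> y)"
  using N unfolding submodule_def
  by (intro abelian_subgroup.a_rcos_sum[OF abelian_subgroupI3] additive_subgroup.intro M.abelian_group_axioms)
    simp_all

lemma coset_zero: "N +> \<zero> = N"
  using subspaceD(1)[OF N] by (rule a_coset_add_zero)

lemma coset_smult:
  assumes "x \<in> carrier M"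
  shows "(\<Union>y\<in>N +> x. N +> (c \<odot> y)) = N +> (c \<odot> x)"
proof -
  have eq: "N +> (c \<odot> y) = N +> (c \<odot> x)" if "y \<in> N +> x" for y
  proof -
    have y: "y \<in> carrier M" "y \<ominus> x \<in> N" using that assms by (auto simp: mem_coset_iff)
    have "c \<odot> y \<ominus> c \<odot> x = c \<odot> (y \<ominus> x)"
      using y assms by (simp add: minus_combination smult_add mult.commute flip: mult_smult)
    then show ?thesis using y assms subspaceD(4)[OF N] by (simp add: coset_eq_iff)
  qed
  have "(\<Union>y\<in>N +> x. N +> (c \<odot> y)) = (\<Union>y\<in>N +> x. N +> (c \<odot> x))"
    by (intro SUP_cong refl eq)
  also have "\<dots> = N +> (c \<odot> x)" using self_mem_coset[OF assms] by blast
  finally show ?thesis .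
qed

lemma descend_coset:
  assumes "x \<in> carrier M" "\<And>y. y \<in> carrier M \<Longrightarrow> y \<ominus> x \<in> N \<Longrightarrow> f y = f x"
  shows "descend f (N +> x) = f x"
proof -
  have eq: "f y = f x" if "y \<in> N +> x" for y
    using that assms by (simp only: mem_coset_iff)
  have "f ` (N +> x) = {f x}"
  proof (intro equalityI subsetI)
    fix z assume "z \<in> f ` (N +> x)"
    then show "z \<in> {f x}" using eq by (elim imageE) simp
  next
    fix z assume "z \<in> {f x}"
    then show "z \<in> f ` (N +> x)" using self_mem_coset[OF assms(1)] by (intro image_eqI[of _ _ x]) simp
  qed
  then show ?thesis by (simp only: descend_def the_elem_eq)
qed

lemma coset_map_linear: "(\<lambda>x. N +> x) \<in> linear_maps M (quotient_module M N)"
  by (rule linear_mapsI) (auto simp: coset_add coset_smult)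

lemma vect_quotient: "vect (quotient_module M N)"
proof -
  let ?Q = "quotient_module M N"
  have add: "(N +> x) \<oplus>\<^bsub>?Q\<^esub> (N +> y) = N +> (x \<oplus> y)" if "x \<in> carrier M" "y \<in> carrier M" for x y
    using coset_add[OF that] by (simp only: quotient_module_simps)
  have smult: "c \<odot>\<^bsub>?Q\<^esub> (N +> x) = N +> (c \<odot> x)" if "x \<in> carrier M" for c x
    using coset_smult[OF that] by (simp only: quotient_module_simps)
  have zero: "\<zero>\<^bsub>?Q\<^esub> = N +> \<zero>"
    using coset_zero by (simp only: quotient_module_simps)
  have mem: "N +> x \<in> carrier ?Q" if "x \<in> carrier M" for x
    using that by (simp only: quotient_module_simps imageI)
  have ex: "\<exists>x\<in>carrier M. X = N +> x" if "X \<in> carrier ?Q" for X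
    using that unfolding quotient_module_simps by blast
  have neg: "\<exists>Y\<in>carrier ?Q. Y \<oplus>\<^bsub>?Q\<^esub> (N +> x) = \<zero>\<^bsub>?Q\<^esub>" if "x \<in> carrier M" for x
    by (rule bexI[of _ "N +> (\<ominus> x)"]) (simp_all only: that a_inv_closed add zero l_neg mem)
  note ops = add smult zero mem neg[unfolded zero] a_closed zero_closed smult_mem a_assoc l_zero
    smult_add add_smult mult_smult one_smult
  show ?thesis
  proof (rule vectI)
    show "abelian_group ?Q"
    proof (rule abelian_groupI)
      fix X Y assume "X \<in> carrier ?Q" "Y \<in> carrier ?Q"
      then show "X \<oplus>\<^bsub>?Q\<^esub> Y = Y \<oplus>\<^bsub>?Q\<^esub> X"
        by (metis ex add a_comm)
    qed ((drule ex)+, elim bexE, hypsubst, simp only: ops | simp only: ops)+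
  qed ((drule ex)+, elim bexE, hypsubst, simp only: ops)+
qed

end

end

text \<open>
  Homology and cohomology are quotients of a subspace \<open>K\<close> of a vector space; a linear map that
  respects the numerators and the denominators induces a linear map of such subquotients.
\<close>

lemma subquotient_map:
  assumes "vect M" "vect M'" "f \<in> linear_maps M M'"
    and "submodule N ground_field M" "submodule N' ground_field M'"
    and K: "K \<subseteq> carrier M" and "f ` K \<subseteq> K'" and N: "f ` N \<subseteq> N'"
  shows "x \<in> carrier M \<Longrightarrow> descend (\<lambda>x. N' +>\<^bsub>M'\<^esub> f x) (N +>\<^bsub>M\<^esub> x) = N' +>\<^bsub>M'\<^esub> f x"
    and "submodule K ground_field M \<Longrightarrow> descend (\<lambda>x. N' +>\<^bsub>M'\<^esub> f x) \<in>
      linear_maps (quotient_module (M\<lparr>carrier := K\<rparr>) N) (quotient_module (M'\<lparr>carrier := K'\<rparr>) N')"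
proof -
  interpret M: vect M by fact
  interpret M': vect M' by fact
  have fc: "f x \<in> carrier M'" if "x \<in> carrier M" for x
    using assms(3) that by (rule linear_maps_closed)
  show d: "descend (\<lambda>x. N' +>\<^bsub>M'\<^esub> f x) (N +>\<^bsub>M\<^esub> x) = N' +>\<^bsub>M'\<^esub> f x" if "x \<in> carrier M" for x
  proof (rule M.descend_coset[OF assms(4) that])
    fix y assume y: "y \<in> carrier M" "y \<ominus>\<^bsub>M\<^esub> x \<in> N"
    then have "f y \<ominus>\<^bsub>M'\<^esub> f x \<in> N'"
      using linear_maps_minus[OF assms(1-3) y(1) that] N by (metis image_subset_iff)
    then show "N' +>\<^bsub>M'\<^esub> f y = N' +>\<^bsub>M'\<^esub> f x"
      using fc y that by (simp add: M'.coset_eq_iff[OF assms(5)])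
  qed
  assume Ks: "submodule K ground_field M"
  have mem: "x \<in> carrier M" "f x \<in> carrier M'" "f x \<in> K'" if "x \<in> K" for x
    using that K fc assms(7) by auto
  show "descend (\<lambda>x. N' +>\<^bsub>M'\<^esub> f x) \<in>
      linear_maps (quotient_module (M\<lparr>carrier := K\<rparr>) N) (quotient_module (M'\<lparr>carrier := K'\<rparr>) N')"
    by (rule linear_mapsI; clarsimp simp: d mem M.coset_add[OF assms(4)] M'.coset_add[OF assms(5)]
        M.coset_smult[OF assms(4)] M'.coset_smult[OF assms(5)]
        linear_maps_add[OF assms(3)] linear_maps_smult[OF assms(3)] intro!: imageI)
qed


section \<open>Tensor powers\<close>

abbreviation words :: "('k, 'r) module \<Rightarrow> nat \<Rightarrow> 'r list set" where
  "words R n \<equiv> {xs. length xs = n \<and> set xs \<subseteq> carrier R}"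

definition tensor_class ::
    "('k::field, 'r) module \<Rightarrow> nat \<Rightarrow> ('r list \<Rightarrow>\<^sub>0 'k) \<Rightarrow> ('r list \<Rightarrow>\<^sub>0 'k) set" where
  "tensor_class R n x = multilinear_relations R n +>\<^bsub>free_module (words R n)\<^esub> x"

text \<open>For \<open>n = 0\<close> there is no slot, and the first clause is all that is asked.\<close>

definition multilinear ::
    "('k, 'r) module \<Rightarrow> ('k, 'v) module \<Rightarrow> nat \<Rightarrow> ('r list \<Rightarrow> 'v) \<Rightarrow> bool" where
  "multilinear R M n f \<longleftrightarrow> (\<forall>xs\<in>words R n. f xs \<in> carrier M) \<and>
     (\<forall>xs\<in>words R n. \<forall>p<n. (\<lambda>x. f (xs[p := x])) \<in> linear_maps R M)"

lemma multilinearI: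
  assumes "\<And>xs. xs \<in> words R n \<Longrightarrow> f xs \<in> carrier M"
    and "\<And>xs p. xs \<in> words R n \<Longrightarrow> p < n \<Longrightarrow> (\<lambda>x. f (xs[p := x])) \<in> linear_maps R M"
  shows "multilinear R M n f"
  using assms by (auto simp: multilinear_def)

lemma multilinearD:
  assumes "multilinear R M n f" "xs \<in> words R n"
  shows "f xs \<in> carrier M" "p < n \<Longrightarrow> (\<lambda>x. f (xs[p := x])) \<in> linear_maps R M"
  using assms by (auto simp: multilinear_def)

lemma words_update: "xs \<in> words R n \<Longrightarrow> x \<in> carrier R \<Longrightarrow> xs[p := x] \<in> words R n"
  by (auto dest: set_update_subset_insert[THEN subsetD])

lemma words_nth: "xs \<in> words R n \<Longrightarrow> p < n \<Longrightarrow> xs ! p \<in> carrier R"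
  by (auto simp: set_conv_nth)

lemma tensor_eq_class: "tensor R xs = tensor_class R (length xs) (Poly_Mapping.single xs 1)"
  by (simp add: tensor_def tensor_class_def)

lemma kernel_subspace:
  assumes "vect M" "vect M'" "f \<in> linear_maps M M'"
  shows "submodule {x \<in> carrier M. f x = \<zero>\<^bsub>M'\<^esub>} ground_field M"
proof -
  interpret M: vect M by fact
  interpret M': vect M' by fact
  show ?thesis
    by (rule M.subspaceI)
      (auto simp: linear_maps_zero[OF assms] linear_maps_add[OF assms(3)] linear_maps_smult[OF assms(3)])
qed

text \<open>The span is taken in the space of all finitely supported functions, but stays inside any
  subspace of the free module on words that contains the relators.\<close>

lemma multilinear_relations_least:
  assumes "submodule N ground_field (free_module (words R n))" "multilinear_relators R n \<subseteq> N"
  shows "multilinear_relations R n \<subseteq> N"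
proof -
  interpret vect "free_module (words R n)" by (rule vect_free_module)
  have "pm.subspace N"
    using subspaceD[OF assms(1)] by (auto simp: pm.subspace_def)
  then show ?thesis
    unfolding multilinear_relations_def using assms(2) by (rule pm.span_minimal[rotated])
qed

context
  fixes R :: "('k::field, 'r) module"
  assumes R: "vect R"
begin

interpretation R: vect R by (rule R)
interpretation F: vect "free_module B" for B by (rule vect_free_module)

lemma relations_subspace: "submodule (multilinear_relations R n) ground_field (free_module (words R n))"
proof (rule F.subspaceI)
  have "multilinear_relators R n \<subseteq> carrier (free_module (words R n))"
    unfolding multilinear_relators_def
    by (auto dest!: subsetD[OF Poly_Mapping.keys_diff] subsetD[OF keys_scale_pm] split: if_splits) 
  then show "multilinear_relations R n \<subseteq> carrier (free_module (words R n))"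
    by (intro multilinear_relations_least F.subspaceI)
      (auto dest!: subsetD[OF Poly_Mapping.keys_add] subsetD[OF keys_scale_pm])
qed (auto simp: multilinear_relations_def pm.span_zero pm.span_add pm.span_scale)

lemma vect_tensor_power: "vect (tensor_power R n)"
  unfolding tensor_power_def by (rule F.vect_quotient[OF relations_subspace])

lemma tensor_class_linear:
  "tensor_class R n \<in> linear_maps (free_module (words R n)) (tensor_power R n)"
  using F.coset_map_linear[OF relations_subspace]
  unfolding tensor_power_def tensor_class_def[abs_def] .

lemma tensor_power_cases:
  assumes "X \<in> carrier (tensor_power R n)"
  obtains x where "Poly_Mapping.keys x \<subseteq> words R n" "X = tensor_class R n x"
  using assms by (auto simp: tensor_power_def tensor_class_def)

lemma tensor_class_closed:
  "Poly_Mapping.keys x \<subseteq> words R n \<Longrightarrow> tensor_class R n x \<in> carrier (tensor_power R n)"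
  using linear_maps_closed[OF tensor_class_linear] by simp

lemma tensor_closed: "xs \<in> words R n \<Longrightarrow> tensor R xs \<in> carrier (tensor_power R n)"
  by (auto simp: tensor_eq_class intro!: tensor_class_closed)

lemma tensor_class_eqI:
  assumes "Poly_Mapping.keys x \<subseteq> words R n" "Poly_Mapping.keys y \<subseteq> words R n"
    and "x - y \<in> multilinear_relations R n"
  shows "tensor_class R n x = tensor_class R n y"
proof -
  have "x \<ominus>\<^bsub>free_module (words R n)\<^esub> y = x - y"
    using assms by (subst F.minus_combination) auto
  then show ?thesis
    using assms by (simp add: tensor_class_def F.coset_eq_iff[OF relations_subspace])
qed

lemma tensor_multilinear: "multilinear R (tensor_power R n) n (tensor R)"
proof (rule multilinearI)
  fix xs p assume xs: "xs \<in> words R n" and p: "p < n"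
  define us vs where "us = take p xs" and "vs = drop (Suc p) xs"
  have up: "xs[p := x] = us @ [x] @ vs" for x
    using xs p by (auto simp: us_def vs_def upd_conv_take_nth_drop)
  have len: "length us + length vs + 1 = n" and uv: "set us \<subseteq> carrier R" "set vs \<subseteq> carrier R"
    using xs p by (auto simp: us_def vs_def dest!: in_set_takeD in_set_dropD)
  have kw: "Poly_Mapping.keys (Poly_Mapping.single (us @ [x] @ vs) (c::'k)) \<subseteq> words R n"
    if "x \<in> carrier R" for x c using that uv len by auto
  have len': "length (us @ [x] @ vs) = n" for x using len by simp
  show "(\<lambda>x. tensor R (xs[p := x])) \<in> linear_maps R (tensor_power R n)"
  proof (rule linear_mapsI)
    fix x assume x: "x \<in> carrier R"
    then show "tensor R (xs[p := x]) \<in> carrier (tensor_power R n)"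
      using xs by (intro tensor_closed words_update)
    show "tensor R (xs[p := c \<odot>\<^bsub>R\<^esub> x]) = c \<odot>\<^bsub>tensor_power R n\<^esub> tensor R (xs[p := x])" for c
    proof -
      have "Poly_Mapping.single (us @ [c \<odot>\<^bsub>R\<^esub> x] @ vs) 1
          - scale_pm c (Poly_Mapping.single (us @ [x] @ vs) 1) \<in> multilinear_relations R n"
        unfolding multilinear_relations_def multilinear_relators_def using x uv len
        by (intro pm.span_base UnI2) blast
      then have "tensor_class R n (Poly_Mapping.single (us @ [c \<odot>\<^bsub>R\<^esub> x] @ vs) 1)
          = tensor_class R n (scale_pm c (Poly_Mapping.single (us @ [x] @ vs) 1))"
        using kw x by (intro tensor_class_eqI) (simp_all only: scale_pm_single mult_1_right R.smult_mem)
      then show ?thesis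
        using linear_maps_smult[OF tensor_class_linear, of "Poly_Mapping.single (us @ [x] @ vs) 1" n c]
          kw[OF x, of 1] len' unfolding up tensor_eq_class by simp
    qed
    fix y assume y: "y \<in> carrier R"
    have "Poly_Mapping.single (us @ [x \<oplus>\<^bsub>R\<^esub> y] @ vs) 1
        - Poly_Mapping.single (us @ [x] @ vs) 1 - Poly_Mapping.single (us @ [y] @ vs) 1
        \<in> multilinear_relations R n"
      unfolding multilinear_relations_def multilinear_relators_def using x y uv len
      by (intro pm.span_base UnI1) blast
    then have "tensor_class R n (Poly_Mapping.single (us @ [x \<oplus>\<^bsub>R\<^esub> y] @ vs) 1)
        = tensor_class R n (Poly_Mapping.single (us @ [x] @ vs) 1 + Poly_Mapping.single (us @ [y] @ vs) 1)"
      using kw x y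
      by (intro tensor_class_eqI order.trans[OF Poly_Mapping.keys_add] Un_least)
        (simp_all only: diff_diff_eq R.a_closed)
    then show "tensor R (xs[p := x \<oplus>\<^bsub>R\<^esub> y])
        = tensor R (xs[p := x]) \<oplus>\<^bsub>tensor_power R n\<^esub> tensor R (xs[p := y])"
      using linear_maps_add[OF tensor_class_linear, of "Poly_Mapping.single (us @ [x] @ vs) 1" n
          "Poly_Mapping.single (us @ [y] @ vs) 1"] kw[OF x, of 1] kw[OF y, of 1] len'
      unfolding up tensor_eq_class by simp
  qed
qed (rule tensor_closed)

text \<open>The linear extension of a multilinear map kills the relators; this is why \<open>tensor_lift\<close> of such a
  map is well defined.\<close>

lemma relations_kernel:
  assumes M: "vect M" and f: "multilinear R M n f" and x: "x \<in> multilinear_relations R n"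
  shows "linear_extension M f x = \<zero>\<^bsub>M\<^esub>"
proof -
  interpret M: vect M by (rule M)
  let ?F = "free_module (words R n)" and ?s = "\<lambda>xs. Poly_Mapping.single xs (1::'k)"
  have lin: "linear_extension M f \<in> linear_maps ?F M"
    using f by (intro linear_extension_linear[OF M]) (auto simp: multilinear_def)
  note single = linear_extension_single[OF M]
  have slot: "f (us @ [x] @ vs) \<in> carrier M"
      "f (us @ [c \<odot>\<^bsub>R\<^esub> x] @ vs) = c \<odot>\<^bsub>M\<^esub> f (us @ [x] @ vs)"
      "f (us @ [x \<oplus>\<^bsub>R\<^esub> y] @ vs) = f (us @ [x] @ vs) \<oplus>\<^bsub>M\<^esub> f (us @ [y] @ vs)"
    if "set us \<subseteq> carrier R" "set vs \<subseteq> carrier R" "length us + length vs + 1 = n"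
      "x \<in> carrier R" "y \<in> carrier R" for us vs x y c
  proof -
    have w: "us @ [x] @ vs \<in> words R n" using that by auto
    show "f (us @ [x] @ vs) \<in> carrier M" by (rule multilinearD(1)[OF f w])
    have "(\<lambda>z. f ((us @ [x] @ vs)[length us := z])) \<in> linear_maps R M"
      using that by (intro multilinearD(2)[OF f w]) simp
    then have l: "(\<lambda>z. f (us @ [z] @ vs)) \<in> linear_maps R M" by simp
    show "f (us @ [c \<odot>\<^bsub>R\<^esub> x] @ vs) = c \<odot>\<^bsub>M\<^esub> f (us @ [x] @ vs)"
      by (rule linear_maps_smult[OF l that(4)])
    show "f (us @ [x \<oplus>\<^bsub>R\<^esub> y] @ vs) = f (us @ [x] @ vs) \<oplus>\<^bsub>M\<^esub> f (us @ [y] @ vs)"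
      by (rule linear_maps_add[OF l that(4,5)])
  qed
  have mem: "?s (us @ [x] @ vs) \<in> carrier ?F"
    if "set us \<subseteq> carrier R" "set vs \<subseteq> carrier R" "length us + length vs + 1 = n"
      "x \<in> carrier R" for us vs x using that by auto
  have minus: "a - b = a \<ominus>\<^bsub>?F\<^esub> b" if "a \<in> carrier ?F" "b \<in> carrier ?F" for a b
    using that by (subst F.minus_combination) auto
  have scl: "scale_pm c a = c \<odot>\<^bsub>?F\<^esub> a" for c a by simp
  have "multilinear_relators R n \<subseteq> {x \<in> carrier ?F. linear_extension M f x = \<zero>\<^bsub>M\<^esub>}"
  proof
    fix z assume "z \<in> multilinear_relators R n"
    then consider us x y vs where "z = ?s (us @ [x \<oplus>\<^bsub>R\<^esub> y] @ vs) - ?s (us @ [x] @ vs) - ?s (us @ [y] @ vs)"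
        "set us \<subseteq> carrier R" "set vs \<subseteq> carrier R" "length us + length vs + 1 = n"
        "x \<in> carrier R" "y \<in> carrier R"
      | us c x vs where "z = ?s (us @ [c \<odot>\<^bsub>R\<^esub> x] @ vs) - scale_pm c (?s (us @ [x] @ vs))"
        "set us \<subseteq> carrier R" "set vs \<subseteq> carrier R" "length us + length vs + 1 = n" "x \<in> carrier R"
      unfolding multilinear_relators_def by blast
    then show "z \<in> {x \<in> carrier ?F. linear_extension M f x = \<zero>\<^bsub>M\<^esub>}"
    proof cases
      case 1
      note s = slot[OF 1(2-4)] and m = mem[OF 1(2-4)]
      have xy: "x \<oplus>\<^bsub>R\<^esub> y \<in> carrier R" using 1 by simp
      note ms = m[OF xy] m[OF 1(5)] m[OF 1(6)]
      have z: "z = ?s (us @ [x \<oplus>\<^bsub>R\<^esub> y] @ vs) \<ominus>\<^bsub>?F\<^esub> ?s (us @ [x] @ vs) \<ominus>\<^bsub>?F\<^esub> ?s (us @ [y] @ vs)"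
        using ms by (simp only: 1(1) minus F.minus_closed)
      have c: "f (us @ [x] @ vs) \<in> carrier M" "f (us @ [y] @ vs) \<in> carrier M" 
        using s(1) 1 by blast+
      have "linear_extension M f z = f (us @ [x] @ vs) \<oplus>\<^bsub>M\<^esub> f (us @ [y] @ vs)
          \<ominus>\<^bsub>M\<^esub> f (us @ [x] @ vs) \<ominus>\<^bsub>M\<^esub> f (us @ [y] @ vs)"
        unfolding z using s(1)[OF xy xy] c
        by (simp only: linear_maps_minus[OF F.vect_axioms M lin] ms F.minus_closed single s(3)[OF 1(5,6)])
      also have "\<dots> = \<zero>\<^bsub>M\<^esub>"
        using c by (intro M.add_minus_cancel)
      finally show ?thesis unfolding z using ms F.minus_closed by blast
    next
      case 2
      note s = slot[OF 2(2-4)] and m = mem[OF 2(2-4)]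
      have cx: "c \<odot>\<^bsub>R\<^esub> x \<in> carrier R" using 2 by simp
      note ms = m[OF cx] m[OF 2(5)]
      have z: "z = ?s (us @ [c \<odot>\<^bsub>R\<^esub> x] @ vs) \<ominus>\<^bsub>?F\<^esub> c \<odot>\<^bsub>?F\<^esub> ?s (us @ [x] @ vs)"
        using ms by (simp only: 2(1) scl minus F.smult_mem)
      have c: "f (us @ [x] @ vs) \<in> carrier M" using s(1) 2 by blast
      have "linear_extension M f z = c \<odot>\<^bsub>M\<^esub> f (us @ [x] @ vs) \<ominus>\<^bsub>M\<^esub> c \<odot>\<^bsub>M\<^esub> f (us @ [x] @ vs)"
        unfolding z using s(1)[OF cx cx] c
        by (simp only: linear_maps_minus[OF F.vect_axioms M lin] linear_maps_smult[OF lin]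
            ms F.smult_mem single s(2)[OF 2(5,5)])
      also have "\<dots> = \<zero>\<^bsub>M\<^esub>" using c by (simp add: M.minus_eq M.r_neg)
      finally show ?thesis unfolding z using ms F.minus_closed F.smult_mem by blast
    qed
  qed
  then show ?thesis
    using multilinear_relations_least[OF kernel_subspace[OF F.vect_axioms M lin]] x by blast
qed

lemma tensor_lift_class:
  assumes M: "vect M" and f: "multilinear R M n f" and x: "Poly_Mapping.keys x \<subseteq> words R n"
  shows "tensor_lift M f (tensor_class R n x) = linear_extension M f x"
proof -
  interpret M: vect M by (rule M)
  let ?F = "free_module (words R n)"
  have lin: "linear_extension M f \<in> linear_maps ?F M"
    using f by (intro linear_extension_linear[OF M]) (auto simp: multilinear_def)
  show ?thesis unfolding tensor_lift_def tensor_class_def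
  proof (rule F.descend_coset[OF relations_subspace])
    show xF: "x \<in> carrier ?F" using x by simp
    fix y assume y: "y \<in> carrier ?F" "y \<ominus>\<^bsub>?F\<^esub> x \<in> multilinear_relations R n"
    have "linear_extension M f y \<ominus>\<^bsub>M\<^esub> linear_extension M f x = \<zero>\<^bsub>M\<^esub>"
      using relations_kernel[OF M f y(2)] linear_maps_minus[OF F.vect_axioms M lin y(1) xF] by simp
    then show "linear_extension M f y = linear_extension M f x"
      by (rule M.minus_eq_zeroD[OF linear_maps_closed[OF lin y(1)] linear_maps_closed[OF lin xF]])
  qed
qed

lemma tensor_lift_linear:
  assumes M: "vect M" and f: "multilinear R M n f"
  shows "tensor_lift M f \<in> linear_maps (tensor_power R n) M"
proof -
  interpret T: vect "tensor_power R n" by (rule vect_tensor_power)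
  let ?F = "free_module (words R n)"
  have lin: "linear_extension M f \<in> linear_maps ?F M"
    using f by (intro linear_extension_linear[OF M]) (auto simp: multilinear_def)
  note lift = tensor_lift_class[OF M f]
  show ?thesis
  proof (rule linear_mapsI)
    fix X assume "X \<in> carrier (tensor_power R n)"
    then obtain x where x: "Poly_Mapping.keys x \<subseteq> words R n" "X = tensor_class R n x"
      by (rule tensor_power_cases)
    then have xF: "x \<in> carrier ?F" by simp
    show "tensor_lift M f X \<in> carrier M"
      using x linear_maps_closed[OF lin] by (simp add: lift)
    show "tensor_lift M f (c \<odot>\<^bsub>tensor_power R n\<^esub> X) = c \<odot>\<^bsub>M\<^esub> tensor_lift M f X" for c
    proof -
      have "tensor_lift M f (tensor_class R n (c \<odot>\<^bsub>?F\<^esub> x)) = c \<odot>\<^bsub>M\<^esub> tensor_lift M f X"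
        using x F.smult_mem[OF xF, of c] linear_maps_smult[OF lin xF, of c] by (simp add: lift)
      then show ?thesis unfolding x(2) linear_maps_smult[OF tensor_class_linear xF] .
    qed
    fix Y assume "Y \<in> carrier (tensor_power R n)"
    then obtain y where y: "Poly_Mapping.keys y \<subseteq> words R n" "Y = tensor_class R n y"
      by (rule tensor_power_cases)
    then have yF: "y \<in> carrier ?F" by simp
    have "tensor_lift M f (tensor_class R n (x \<oplus>\<^bsub>?F\<^esub> y)) = tensor_lift M f X \<oplus>\<^bsub>M\<^esub> tensor_lift M f Y"
      using x y F.a_closed[OF xF yF] linear_maps_add[OF lin xF yF] by (simp add: lift)
    then show "tensor_lift M f (X \<oplus>\<^bsub>tensor_power R n\<^esub> Y) = tensor_lift M f X \<oplus>\<^bsub>M\<^esub> tensor_lift M f Y"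
      unfolding x(2) y(2) linear_maps_add[OF tensor_class_linear xF yF] .
  qed
qed

lemma tensor_lift_tensor:
  assumes "vect M" "multilinear R M n f" "xs \<in> words R n"
  shows "tensor_lift M f (tensor R xs) = f xs"
proof -
  have "tensor R xs = tensor_class R n (Poly_Mapping.single xs 1)"
    using assms(3) by (simp add: tensor_eq_class)
  then show ?thesis
    using assms by (simp add: tensor_lift_class linear_extension_single multilinearD(1))
qed

lemma tensor_power_linear_eqI:
  assumes M: "vect M" and P: "P \<in> linear_maps (tensor_power R n) M" "Q \<in> linear_maps (tensor_power R n) M"
    and eq: "\<And>xs. xs \<in> words R n \<Longrightarrow> P (tensor R xs) = Q (tensor R xs)"
    and X: "X \<in> carrier (tensor_power R n)"
  shows "P X = Q X"
proof -
  obtain x where x: "Poly_Mapping.keys x \<subseteq> words R n" "X = tensor_class R n x"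
    using X by (rule tensor_power_cases)
  have "P (tensor_class R n x) = Q (tensor_class R n x)"
    using eq
    by (intro free_module_linear_eqI[OF M linear_maps_comp[OF tensor_class_linear P(1)]
          linear_maps_comp[OF tensor_class_linear P(2)] _ x(1)])
      (auto simp: tensor_eq_class)
  then show ?thesis by (simp add: x)
qed

end

text \<open>A multilinear map is determined by its values on words over a spanning set: the letters are
  replaced by spanning vectors one after the other.\<close>

inductive_set lin_span :: "('k, 'r) module \<Rightarrow> 'r set \<Rightarrow> 'r set" for R S where
  lin_span_base: "x \<in> S \<Longrightarrow> x \<in> lin_span R S"
| lin_span_zero: "\<zero>\<^bsub>R\<^esub> \<in> lin_span R S"
| lin_span_add: "x \<in> lin_span R S \<Longrightarrow> y \<in> lin_span R S \<Longrightarrow> x \<oplus>\<^bsub>R\<^esub> y \<in> lin_span R S"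
| lin_span_smult: "x \<in> lin_span R S \<Longrightarrow> c \<odot>\<^bsub>R\<^esub> x \<in> lin_span R S"

lemma linear_eq_on_lin_span:
  assumes "vect R" "vect M" "P \<in> linear_maps R M" "Q \<in> linear_maps R M" "S \<subseteq> carrier R"
    and "\<And>x. x \<in> S \<Longrightarrow> P x = Q x" and "x \<in> lin_span R S"
  shows "x \<in> carrier R \<and> P x = Q x"
proof -
  interpret R: vect R by fact
  show ?thesis using assms(7)
    by induction
      (use assms in \<open>auto simp: linear_maps_zero[OF assms(1,2)] linear_maps_add linear_maps_smult\<close>)
qed

lemma multilinear_eq_on_lin_span:
  assumes R: "vect R" and M: "vect M" and P: "multilinear R M n P" "multilinear R M n Q"
    and S: "S \<subseteq> carrier R" and span: "carrier R \<subseteq> lin_span R S"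
    and eq: "\<And>xs. length xs = n \<Longrightarrow> set xs \<subseteq> S \<Longrightarrow> P xs = Q xs"
    and xs: "xs \<in> words R n"
  shows "P xs = Q xs"
proof -
  have "P (us @ vs) = Q (us @ vs)"
    if "set us \<subseteq> carrier R" "set vs \<subseteq> S" "length us + length vs = n" for us vs
    using that
  proof (induction us arbitrary: vs rule: rev_induct)
    case (snoc u us)
    have w: "us @ [u] @ vs \<in> words R n" using snoc.prems S by auto
    have l: "(\<lambda>x. P (us @ x # vs)) \<in> linear_maps R M" "(\<lambda>x. Q (us @ x # vs)) \<in> linear_maps R M"
      using multilinearD(2)[OF P(1) w, of "length us"] multilinearD(2)[OF P(2) w, of "length us"]
        snoc.prems by simp_all
    have "u \<in> lin_span R S" using span snoc.prems by auto
    moreover have "P (us @ x # vs) = Q (us @ x # vs)" if "x \<in> S" for x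
      using snoc.IH[of "x # vs"] snoc.prems that by simp
    ultimately show ?case
      using linear_eq_on_lin_span[OF R M l S] by auto
  qed (use eq in auto)
  from this[of xs "[]"] xs show ?thesis by auto
qed

lemma multilinear_linear_comp:
  assumes "multilinear R M n f" "P \<in> linear_maps M N"
  shows "multilinear R N n (\<lambda>xs. P (f xs))"
proof (rule multilinearI)
  fix xs p assume "xs \<in> words R n" "p < n"
  then show "(\<lambda>x. P (f (xs[p := x]))) \<in> linear_maps R N"
    using assms by (intro linear_maps_comp[OF _ assms(2)]) (rule multilinearD)
qed (auto intro!: linear_maps_closed[OF assms(2)] multilinearD(1)[OF assms(1)])

text \<open>Changing one letter of a word changes one letter of its image, and does so linearly.\<close>

lemma multilinear_substitute:
  assumes f: "multilinear R' M m f"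
    and T: "\<And>xs. xs \<in> words R n \<Longrightarrow> T xs \<in> words R' m"
    and slot: "\<And>xs p. xs \<in> words R n \<Longrightarrow> p < n \<Longrightarrow>
      \<exists>q<m. \<exists>ws\<in>words R' m. \<exists>L\<in>linear_maps R R'. \<forall>x\<in>carrier R. T (xs[p := x]) = ws[q := L x]"
    and R: "vect R"
  shows "multilinear R M n (\<lambda>xs. f (T xs))"
proof (rule multilinearI)
  interpret R: vect R by (rule R)
  fix xs p assume xs: "xs \<in> words R n" "p < n"
  then obtain q ws L where "q < m" "ws \<in> words R' m" and L: "L \<in> linear_maps R R'"
    and eq: "\<forall>x\<in>carrier R. T (xs[p := x]) = ws[q := L x]"
    using slot by meson
  then have "(\<lambda>x. f (ws[q := L x])) \<in> linear_maps R M"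
    by (intro linear_maps_comp[OF L] multilinearD(2)[OF f])
  moreover have "f (T (xs[p := x])) = f (ws[q := L x])" if "x \<in> carrier R" for x
    using eq that by simp
  ultimately show "(\<lambda>x. f (T (xs[p := x]))) \<in> linear_maps R M"
    by (simp add: linear_maps_def hom_def Pi_def)
qed (use f T in \<open>auto simp: multilinear_def\<close>)

lemma multilinear_finsum:
  assumes M: "vect M" and R: "vect R" and f: "\<And>a. a \<in> A \<Longrightarrow> multilinear R M n (f a)"
  shows "multilinear R M n (\<lambda>xs. \<Oplus>\<^bsub>M\<^esub>a\<in>A. f a xs)"
proof (rule multilinearI)
  interpret M: vect M by (rule M)
  have cl: "f a xs \<in> carrier M" if "a \<in> A" "xs \<in> words R n" for a xs
    using f that by (blast intro: multilinearD(1))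
  show "(\<Oplus>\<^bsub>M\<^esub>a\<in>A. f a xs) \<in> carrier M" if "xs \<in> words R n" for xs
    using cl that by (intro M.finsum_closed) auto
  fix xs p assume xs: "xs \<in> words R n" "p < n"
  show "(\<lambda>x. \<Oplus>\<^bsub>M\<^esub>a\<in>A. f a (xs[p := x])) \<in> linear_maps R M"
    using multilinearD(2)[OF f xs] by (rule linear_maps_sum[OF M])
qed

lemma multilinear_smult:
  assumes "vect M" "multilinear R M n f"
  shows "multilinear R M n (\<lambda>xs. c \<odot>\<^bsub>M\<^esub> f xs)"
proof -
  interpret M: vect M by fact
  have "(\<lambda>x. c \<odot>\<^bsub>M\<^esub> x) \<in> linear_maps M M"
    by (rule linear_mapsI) (simp_all add: M.smult_add mult.commute flip: M.mult_smult)
  then show ?thesis by (rule multilinear_linear_comp[OF assms(2)])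
qed


section \<open>Duals and split chain maps\<close>

lemma vect_ground_field: "vect (ground_field :: ('k::field, 'k) module)"
  using cring.axioms(1)[OF cring_ground_field]
  by (intro vectI) (auto simp: ground_field_def algebra_simps ring_def)

lemma ground_field_simps [simp]:
  "carrier ground_field = UNIV" "zero ground_field = 0" "add ground_field = (+)"
  "smult ground_field = (*)"
  by (simp_all add: ground_field_def)

lemma dual_simps [simp]:
  "carrier (dual M) = linear_maps M ground_field \<inter> extensional (carrier M)"
  "zero (dual M) = (\<lambda>x\<in>carrier M. 0)"
  "add (dual M) = (\<lambda>u v. \<lambda>x\<in>carrier M. u x + v x)"
  "smult (dual M) = (\<lambda>c u. \<lambda>x\<in>carrier M. c * u x)"
  by (simp_all add: dual_def)

lemma linear_maps_cong:
  assumes "vect M" "\<And>x. x \<in> carrier M \<Longrightarrow> f x = g x"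
  shows "f \<in> linear_maps M N \<longleftrightarrow> g \<in> linear_maps M N"
proof -
  interpret vect M by fact
  have "(\<forall>x\<in>carrier M. f (c \<odot>\<^bsub>M\<^esub> x) = c \<odot>\<^bsub>N\<^esub> f x) \<longleftrightarrow> (\<forall>x\<in>carrier M. g (c \<odot>\<^bsub>M\<^esub> x) = c \<odot>\<^bsub>N\<^esub> g x)" for c
    using assms(2) by simp
  moreover have "f \<in> hom (add_monoid M) (add_monoid N) \<longleftrightarrow> g \<in> hom (add_monoid M) (add_monoid N)"
    using assms(2) by (simp add: hom_def Pi_def)
  ultimately show ?thesis by (auto simp: linear_maps_def)
qed

lemma functional_mem_dual:
  assumes "vect M" "u \<in> linear_maps M ground_field"
  shows "(\<lambda>x\<in>carrier M. u x) \<in> carrier (dual M)"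
  using assms(2) linear_maps_cong[OF assms(1), of "\<lambda>x\<in>carrier M. u x" u ground_field] by simp

lemma vect_dual:
  assumes "vect M"
  shows "vect (dual M)"
proof (rule vectI)
  have add: "(\<lambda>x\<in>carrier M. u x + v x) \<in> carrier (dual M)"
    if "u \<in> carrier (dual M)" "v \<in> carrier (dual M)" for u v
    using that linear_maps_combination(1)[OF vect_ground_field, of u M v]
    by (intro functional_mem_dual[OF assms]) simp
  have smult: "(\<lambda>x\<in>carrier M. c * u x) \<in> carrier (dual M)" if "u \<in> carrier (dual M)" for u c
    using that linear_maps_combination(2)[OF vect_ground_field, of u M u c]
    by (intro functional_mem_dual[OF assms]) simp
  have zero: "(\<lambda>x\<in>carrier M. 0) \<in> carrier (dual M)"
    by (intro functional_mem_dual[OF assms] linear_mapsI) auto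
  have ext: "(\<lambda>x\<in>carrier M. u x) = u" if "u \<in> carrier (dual M)" for u
    using that by (auto intro: extensional_restrict)
  show "abelian_group (dual M)"
  proof (rule abelian_groupI)
    fix u assume u: "u \<in> carrier (dual M)"
    then show "\<exists>v\<in>carrier (dual M). v \<oplus>\<^bsub>dual M\<^esub> u = \<zero>\<^bsub>dual M\<^esub>"
      using smult[OF u, of "- 1"] by (intro bexI[of _ "\<lambda>x\<in>carrier M. - 1 * u x"]) (auto simp: fun_eq_iff)
    show "\<zero>\<^bsub>dual M\<^esub> \<oplus>\<^bsub>dual M\<^esub> u = u"
      using ext[OF u] by (simp cong: restrict_cong)
  qed (use add zero in \<open>auto simp: add.assoc add.commute restrict_def fun_eq_iff\<close>)
  show "1 \<odot>\<^bsub>dual M\<^esub> u = u" if "u \<in> carrier (dual M)" for u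
    using ext[OF that] by simp
  show "c \<odot>\<^bsub>dual M\<^esub> u \<in> carrier (dual M)" if "u \<in> carrier (dual M)" for c u
    using smult[OF that] by simp
qed (auto simp: algebra_simps restrict_def fun_eq_iff)

lemma dual_map_linear:
  assumes M: "vect M" and f: "f \<in> linear_maps M N"
  shows "dual_map M f \<in> linear_maps (dual N) (dual M)"
proof (rule linear_mapsI)
  fix u assume u: "u \<in> carrier (dual N)"
  then show "dual_map M f u \<in> carrier (dual M)"
    unfolding dual_map_def
    by (intro functional_mem_dual[OF M] linear_maps_comp[OF f]) simp
qed (use f in \<open>auto simp: dual_map_def restrict_def fun_eq_iff linear_maps_closed\<close>)

lemma linear_image_subspace:
  assumes "vect M" "vect N" "f \<in> linear_maps M N"
  shows "submodule (f ` carrier M) ground_field N"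
proof -
  interpret M: vect M by fact
  interpret N: vect N by fact
  show ?thesis
  proof (rule N.subspaceI)
    show "f ` carrier M \<subseteq> carrier N" using linear_maps_closed[OF assms(3)] by auto
    show "\<zero>\<^bsub>N\<^esub> \<in> f ` carrier M"
      using linear_maps_zero[OF assms] by (metis M.zero_closed imageI)
    show "x \<oplus>\<^bsub>N\<^esub> y \<in> f ` carrier M" if "x \<in> f ` carrier M" "y \<in> f ` carrier M" for x y
      using that by (auto simp flip: linear_maps_add[OF assms(3)])
    show "c \<odot>\<^bsub>N\<^esub> x \<in> f ` carrier M" if "x \<in> f ` carrier M" for c x
      using that by (auto simp flip: linear_maps_smult[OF assms(3)])
  qed
qed

text \<open>
  A chain map \<open>f\<close> that lowers degrees by one, together with maps \<open>s\<close> and \<open>t\<close> in degrees \<open>n\<close> and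
  \<open>n - 1\<close> that commute with the differentials and of which \<open>s\<close> is a section of \<open>f n\<close>.  The map \<open>t\<close>
  need not be the section that is used in degree \<open>n - 1\<close>; a separate pair \<open>s, t\<close> for each \<open>n\<close> is
  enough to split \<open>f\<close> on homology in degree \<open>n\<close> and on cohomology in degree \<open>n\<close>.
\<close>

locale split_chain_map =
  fixes C :: "nat \<Rightarrow> ('k::field, 'v) module" and d :: "nat \<Rightarrow> 'v \<Rightarrow> 'v"
    and D :: "nat \<Rightarrow> ('k, 'w) module" and e :: "nat \<Rightarrow> 'w \<Rightarrow> 'w"
    and f :: "nat \<Rightarrow> 'v \<Rightarrow> 'w" and n :: nat and s t :: "'w \<Rightarrow> 'v"
  assumes vect_C: "vect (C m)" and vect_D: "vect (D m)"
    and d_linear: "d (Suc m) \<in> linear_maps (C (Suc m)) (C m)"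
    and e_linear: "e (Suc m) \<in> linear_maps (D (Suc m)) (D m)"
    and f_linear: "f m \<in> linear_maps (C (Suc m)) (D m)"
    and chain_map: "x \<in> carrier (C (Suc (Suc m))) \<Longrightarrow> f m (d (Suc (Suc m)) x) = e (Suc m) (f (Suc m) x)"
    and d_one: "x \<in> carrier (C 1) \<Longrightarrow> d 1 x = \<zero>\<^bsub>C 0\<^esub>"
    and s_closed: "z \<in> carrier (D n) \<Longrightarrow> s z \<in> carrier (C (Suc n))"
    and section_of: "z \<in> carrier (D n) \<Longrightarrow> f n (s z) = z"
    and t_linear: "n \<noteq> 0 \<Longrightarrow> t \<in> linear_maps (D (n - 1)) (C n)"
    and section_chain: "n \<noteq> 0 \<Longrightarrow> z \<in> carrier (D n) \<Longrightarrow> d (Suc n) (s z) = t (e n z)"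
begin

lemma boundaries_subspace:
  "submodule (boundaries C d m) ground_field (C m)" "submodule (boundaries D e m) ground_field (D m)"
  unfolding boundaries_def
  by (rule linear_image_subspace[OF vect_C vect_C d_linear] linear_image_subspace[OF vect_D vect_D e_linear])+

lemma f_boundaries: "f n ` boundaries C d (Suc n) \<subseteq> boundaries D e n"
  using chain_map linear_maps_closed[OF f_linear] by (force simp: boundaries_def)

lemma f_cycles: "f n ` cycles C d (Suc n) \<subseteq> cycles D e n"
proof
  fix y assume "y \<in> f n ` cycles C d (Suc n)"
  then obtain x where x: "x \<in> carrier (C (Suc n))" "d (Suc n) x = \<zero>\<^bsub>C n\<^esub>" "y = f n x"
    by (auto simp: cycles_def)
  have "e (Suc m) y = \<zero>\<^bsub>D m\<^esub>" if "n = Suc m" for m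
    using chain_map[of x m] x that linear_maps_zero[OF vect_C vect_D f_linear] by metis
  then show "y \<in> cycles D e n"
    using x linear_maps_closed[OF f_linear] by (cases n) (auto simp: cycles_def)
qed

lemma section_cycles: "z \<in> cycles D e n \<Longrightarrow> s z \<in> cycles C d (Suc n)"
proof -
  assume z: "z \<in> cycles D e n"
  have "d (Suc n) (s z) = \<zero>\<^bsub>C n\<^esub>"
  proof (cases "n = 0")
    case True
    then show ?thesis using d_one[of "s z"] s_closed z by (simp add: cycles_def)
  next
    case False
    then have "d (Suc n) (s z) = t \<zero>\<^bsub>D (n - 1)\<^esub>"
      using z section_chain by (simp add: cycles_def)
    then show ?thesis using linear_maps_zero[OF vect_D vect_C t_linear[OF False]] by simp
  qed
  then show ?thesis using z s_closed by (simp add: cycles_def)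
qed

text \<open>If \<open>z\<close> is a cycle, then \<open>d (s z) = t (e z) = 0\<close>; so \<open>s z\<close> is a cycle, and \<open>f\<close> maps it to \<open>z\<close>.\<close>

theorem homology_map_surjective:
  "homology_map D e n (f n) \<in> linear_maps (homology C d (Suc n)) (homology D e n)"
  "homology_map D e n (f n) ` carrier (homology C d (Suc n)) = carrier (homology D e n)"
proof -
  let ?K = "cycles C d (Suc n)"
  have K: "submodule ?K ground_field (C (Suc n))"
    using kernel_subspace[OF vect_C vect_C d_linear] by (simp add: cycles_def)
  have sub: "?K \<subseteq> carrier (C (Suc n))" by (auto simp: cycles_def)
  note map = subquotient_map[OF vect_C vect_D f_linear boundaries_subspace sub f_cycles f_boundaries]
  show "homology_map D e n (f n) \<in> linear_maps (homology C d (Suc n)) (homology D e n)"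
    unfolding homology_map_def homology_def by (rule map(2)[OF K])
  have img: "homology_map D e n (f n) (boundaries C d (Suc n) +>\<^bsub>C (Suc n)\<^esub> x)
      = boundaries D e n +>\<^bsub>D n\<^esub> f n x" if "x \<in> ?K" for x
    unfolding homology_map_def using sub that by (intro map(1)) auto
  have "f n ` ?K = cycles D e n"
  proof
    show "cycles D e n \<subseteq> f n ` ?K"
      using section_cycles section_of by (force simp: cycles_def intro: image_eqI)
  qed (rule f_cycles)
  then have "carrier (homology D e n) = (\<lambda>x. boundaries D e n +>\<^bsub>D n\<^esub> f n x) ` ?K"
    unfolding homology_def by (simp flip: \<open>f n ` ?K = _\<close> add: image_image)
  also have "\<dots> = (\<lambda>x. homology_map D e n (f n) (boundaries C d (Suc n) +>\<^bsub>C (Suc n)\<^esub> x)) ` ?K"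
    by (intro image_cong) (simp_all add: img)
  finally show "homology_map D e n (f n) ` carrier (homology C d (Suc n)) = carrier (homology D e n)"
    by (simp add: homology_def image_image)
qed

abbreviation "\<delta>C \<equiv> dual_diff C d"
abbreviation "\<delta>D \<equiv> dual_diff D e"
abbreviation "f_dual m \<equiv> dual_map (C (Suc m)) (f m)"

lemma dual_diff_linear:
  "\<delta>C m \<in> linear_maps (dual_complex C m) (dual_complex C (Suc m))"
  "\<delta>D m \<in> linear_maps (dual_complex D m) (dual_complex D (Suc m))"
  unfolding dual_diff_def dual_complex_def
  by (rule dual_map_linear[OF vect_C d_linear] dual_map_linear[OF vect_D e_linear])+

lemma vect_dual_complex: "vect (dual_complex C m)" "vect (dual_complex D m)"
  unfolding dual_complex_def by (rule vect_dual[OF vect_C] vect_dual[OF vect_D])+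

lemma f_dual_linear: "f_dual m \<in> linear_maps (dual_complex D m) (dual_complex C (Suc m))"
  unfolding dual_complex_def by (rule dual_map_linear[OF vect_C f_linear])

lemma coboundaries_subspace:
  "submodule (coboundaries (dual_complex D) \<delta>D m) ground_field (dual_complex D m)"
  "submodule (coboundaries (dual_complex C) \<delta>C m) ground_field (dual_complex C m)"
proof -
  have zero: "submodule {\<zero>\<^bsub>M\<^esub>} ground_field M" if "vect M" for M :: "('k, 'x) module"
  proof -
    interpret vect M by fact
    show ?thesis by (rule subspaceI) auto
  qed
  show "submodule (coboundaries (dual_complex D) \<delta>D m) ground_field (dual_complex D m)"
    using zero[OF vect_dual_complex(2)]
      linear_image_subspace[OF vect_dual_complex(2) vect_dual_complex(2) dual_diff_linear(2)]
    by (cases m) (simp_all add: coboundaries_def)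
  show "submodule (coboundaries (dual_complex C) \<delta>C m) ground_field (dual_complex C m)"
    using zero[OF vect_dual_complex(1)]
      linear_image_subspace[OF vect_dual_complex(1) vect_dual_complex(1) dual_diff_linear(1)]
    by (cases m) (simp_all add: coboundaries_def)
qed

lemma f_dual_diff:
  assumes "u \<in> carrier (dual_complex D m)"
  shows "f_dual (Suc m) (\<delta>D m u) = \<delta>C (Suc m) (f_dual m u)"
  using linear_maps_closed[OF f_linear] linear_maps_closed[OF d_linear]
  by (auto simp: dual_map_def dual_diff_def restrict_def fun_eq_iff chain_map)

lemma f_dual_cocycles:
  "f_dual n ` cocycles (dual_complex D) \<delta>D n \<subseteq> cocycles (dual_complex C) \<delta>C (Suc n)"
proof
  fix v assume "v \<in> f_dual n ` cocycles (dual_complex D) \<delta>D n"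
  then obtain u where u: "u \<in> carrier (dual_complex D n)" "\<delta>D n u = \<zero>\<^bsub>dual_complex D (Suc n)\<^esub>"
    and v: "v = f_dual n u" by (auto simp: cocycles_def)
  have "\<delta>C (Suc n) v = \<zero>\<^bsub>dual_complex C (Suc (Suc n))\<^esub>"
    using f_dual_diff[OF u(1)] u(2) linear_maps_zero[OF vect_dual_complex(2,1) f_dual_linear] v by metis
  then show "v \<in> cocycles (dual_complex C) \<delta>C (Suc n)"
    using linear_maps_closed[OF f_dual_linear u(1)] v by (simp add: cocycles_def)
qed

lemma f_dual_coboundaries:
  "f_dual n ` coboundaries (dual_complex D) \<delta>D n \<subseteq> coboundaries (dual_complex C) \<delta>C (Suc n)"
proof (cases n)
  case 0
  have "f_dual 0 \<zero>\<^bsub>dual_complex D 0\<^esub> = \<zero>\<^bsub>dual_complex C (Suc 0)\<^esub>"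
    by (rule linear_maps_zero[OF vect_dual_complex(2,1) f_dual_linear])
  then show ?thesis
    using vect.subspaceD(2)[OF vect_dual_complex(1) coboundaries_subspace(2), of "Suc 0"] 0
    by (simp add: coboundaries_def[of "dual_complex D"])
next
  case (Suc m)
  then show ?thesis
    using f_dual_diff linear_maps_closed[OF f_dual_linear] by (force simp: coboundaries_def)
qed

text \<open>
  If \<open>u \<circ> f = v \<circ> d\<close>, then \<open>u = u \<circ> f \<circ> s = v \<circ> d \<circ> s = (v \<circ> t) \<circ> e\<close>.  In degree \<open>0\<close> there is no
  \<open>t\<close>, but there \<open>d = 0\<close> and hence \<open>u = 0\<close>.
\<close>

lemma f_dual_reflects_coboundaries:
  assumes u: "u \<in> carrier (dual_complex D n)"
    and cob: "f_dual n u \<in> coboundaries (dual_complex C) \<delta>C (Suc n)"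
  shows "u \<in> coboundaries (dual_complex D) \<delta>D n"
proof -
  obtain v where v: "v \<in> carrier (dual_complex C n)" "f_dual n u = \<delta>C n v"
    using cob by (auto simp: coboundaries_def)
  have uv: "u x = v (d (Suc n) (s x))" if x: "x \<in> carrier (D n)" for x
  proof -
    have "u x = f_dual n u (s x)" using s_closed[OF x] section_of[OF x] by (simp add: dual_map_def)
    also have "\<dots> = v (d (Suc n) (s x))"
      unfolding v(2) using s_closed[OF x] by (simp add: dual_diff_def dual_map_def)
    finally show ?thesis .
  qed
  have ext: "u \<in> extensional (carrier (D n))" using u by (simp add: dual_complex_def)
  show ?thesis
  proof (cases n)
    case 0
    have "v \<zero>\<^bsub>C 0\<^esub> = 0"
      using linear_maps_zero[OF vect_C vect_ground_field, of v 0] v 0 by (simp add: dual_complex_def)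
    then have "u x = 0" if "x \<in> carrier (D 0)" for x
      using that uv[of x] 0 d_one[of "s x"] s_closed[of x] by simp
    then have "u = (\<lambda>x\<in>carrier (D 0). 0)"
      using ext 0 by (auto simp: extensional_def)
    then show ?thesis by (simp add: coboundaries_def 0 dual_complex_def)
  next
    case (Suc m)
    define w where "w = dual_map (D m) t v"
    have "w \<in> carrier (dual_complex D m)"
      using linear_maps_closed[OF dual_map_linear[OF vect_D t_linear]] v Suc
      by (simp only: w_def dual_complex_def) simp
    moreover have "u = \<delta>D m w"
    proof
      fix x show "u x = \<delta>D m w x"
      proof (cases "x \<in> carrier (D n)")
        case True
        then have "u x = v (t (e n x))" using uv section_chain Suc by simp
        then show ?thesis
          using True linear_maps_closed[OF e_linear] Suc by (simp add: dual_diff_def dual_map_def w_def)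
      next
        case False
        then show ?thesis using ext Suc by (simp add: dual_diff_def dual_map_def extensional_def)
      qed
    qed
    ultimately show ?thesis by (simp add: coboundaries_def Suc)
  qed
qed

theorem cohomology_map_injective:
  "cohomology_map (dual_complex C) \<delta>C (Suc n) (f_dual n) \<in>
     linear_maps (cohomology (dual_complex D) \<delta>D n) (cohomology (dual_complex C) \<delta>C (Suc n))"
  "inj_on (cohomology_map (dual_complex C) \<delta>C (Suc n) (f_dual n))
     (carrier (cohomology (dual_complex D) \<delta>D n))"
proof -
  interpret M: vect "dual_complex D n" by (rule vect_dual_complex)
  interpret M': vect "dual_complex C (Suc n)" by (rule vect_dual_complex)
  let ?K = "cocycles (dual_complex D) \<delta>D n"
  let ?N = "coboundaries (dual_complex D) \<delta>D n" and ?N' = "coboundaries (dual_complex C) \<delta>C (Suc n)"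
  have K: "submodule ?K ground_field (dual_complex D n)"
    using kernel_subspace[OF vect_dual_complex(2) vect_dual_complex(2) dual_diff_linear(2)]
    by (simp add: cocycles_def)
  have sub: "?K \<subseteq> carrier (dual_complex D n)" by (auto simp: cocycles_def)
  note map = subquotient_map[OF vect_dual_complex(2) vect_dual_complex(1) f_dual_linear
      coboundaries_subspace(1,2) sub f_dual_cocycles f_dual_coboundaries]
  show "cohomology_map (dual_complex C) \<delta>C (Suc n) (f_dual n) \<in>
     linear_maps (cohomology (dual_complex D) \<delta>D n) (cohomology (dual_complex C) \<delta>C (Suc n))"
    unfolding cohomology_map_def cohomology_def by (rule map(2)[OF K])
  show "inj_on (cohomology_map (dual_complex C) \<delta>C (Suc n) (f_dual n))
     (carrier (cohomology (dual_complex D) \<delta>D n))"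
  proof (rule inj_onI)
    fix X Y assume "X \<in> carrier (cohomology (dual_complex D) \<delta>D n)" "Y \<in> carrier (cohomology (dual_complex D) \<delta>D n)"
      and eq: "cohomology_map (dual_complex C) \<delta>C (Suc n) (f_dual n) X
        = cohomology_map (dual_complex C) \<delta>C (Suc n) (f_dual n) Y"
    then obtain u v where uv: "u \<in> ?K" "v \<in> ?K"
      and X: "X = ?N +>\<^bsub>dual_complex D n\<^esub> u" and Y: "Y = ?N +>\<^bsub>dual_complex D n\<^esub> v"
      by (auto simp: cohomology_def)
    have u: "u \<in> carrier (dual_complex D n)" and v: "v \<in> carrier (dual_complex D n)" using uv sub by blast+
    have fu: "f_dual n u \<in> carrier (dual_complex C (Suc n))" and fv: "f_dual n v \<in> carrier (dual_complex C (Suc n))"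
      by (rule linear_maps_closed[OF f_dual_linear u] linear_maps_closed[OF f_dual_linear v])+
    have "?N' +>\<^bsub>dual_complex C (Suc n)\<^esub> f_dual n u = ?N' +>\<^bsub>dual_complex C (Suc n)\<^esub> f_dual n v"
      using eq unfolding X Y cohomology_map_def map(1)[OF u] map(1)[OF v] .
    then have "f_dual n (u \<ominus>\<^bsub>dual_complex D n\<^esub> v) \<in> ?N'"
      unfolding M'.coset_eq_iff[OF coboundaries_subspace(2) fu fv]
        linear_maps_minus[OF vect_dual_complex(2,1) f_dual_linear u v] .
    then have "u \<ominus>\<^bsub>dual_complex D n\<^esub> v \<in> ?N"
      by (intro f_dual_reflects_coboundaries M.minus_closed u v)
    then show "X = Y" unfolding X Y M.coset_eq_iff[OF coboundaries_subspace(1) u v] .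
  qed
qed

end


section \<open>Antisymmetrization and the Leibniz differential\<close>

abbreviation signed :: "nat \<Rightarrow> ('b \<Rightarrow>\<^sub>0 'k::field) \<Rightarrow> ('b \<Rightarrow>\<^sub>0 'k)" where
  "signed k v \<equiv> scale_pm ((- 1) ^ k) v"

definition insert_letter :: "nat \<Rightarrow> 'r \<Rightarrow> 'r list \<Rightarrow> 'r list" where
  "insert_letter p y w = take p w @ y # drop p w"

text \<open>The sign counts the letters that \<open>y\<close> passes on its way from the end of the word to place \<open>p\<close>; their
  number \<open>length w - p\<close> has the parity of \<open>length w + p\<close>.  The place \<open>0\<close> is left out because the first
  letter never moves.\<close>

definition insertions ::
    "'r \<Rightarrow> ('r list \<Rightarrow> 'b \<Rightarrow>\<^sub>0 'k::field) \<Rightarrow> 'r list \<Rightarrow> ('b \<Rightarrow>\<^sub>0 'k)" where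
  "insertions y F w = (\<Sum>p=1..length w. signed (length w + p) (F (insert_letter p y w)))"

text \<open>
  The signed sum of \<open>F\<close> over the rearrangements of a word that keep its first letter in place; the
  other letters are inserted one after the other.
\<close>

definition alternation ::
    "('r list \<Rightarrow> 'b \<Rightarrow>\<^sub>0 'k::field) \<Rightarrow> 'r list \<Rightarrow> ('b \<Rightarrow>\<^sub>0 'k)" where
  "alternation F xs = foldr insertions (tl xs) F [hd xs]"

text \<open>
  The operators \<open>hochschild\<close>, \<open>adjoint\<close> and \<open>leibniz\<close> are transposes: they act on functions of words
  rather than on formal sums of words.  The Hochschild boundary of a word of length one is \<open>0\<close>, which
  the general formula does not give.
\<close>

definition hochschild_face :: "('r \<Rightarrow> 'r \<Rightarrow> 'r) \<Rightarrow> nat \<Rightarrow> 'r list \<Rightarrow> 'r list" where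
  "hochschild_face \<mu> i w = (if Suc i < length w then take i w @ \<mu> (w ! i) (w ! Suc i) # drop (i + 2) w
     else \<mu> (last w) (hd w) # butlast (tl w))"

definition hochschild ::
    "('r \<Rightarrow> 'r \<Rightarrow> 'r) \<Rightarrow> ('r list \<Rightarrow> 'b \<Rightarrow>\<^sub>0 'k::field) \<Rightarrow> 'r list \<Rightarrow> ('b \<Rightarrow>\<^sub>0 'k)" where
  "hochschild \<mu> F w = (if length w \<le> 1 then 0
     else \<Sum>i<length w. signed i (F (hochschild_face \<mu> i w)))"

definition adjoint ::
    "('r \<Rightarrow> 'r \<Rightarrow> 'r) \<Rightarrow> 'r \<Rightarrow> ('r list \<Rightarrow> 'b \<Rightarrow>\<^sub>0 'k::field) \<Rightarrow> 'r list \<Rightarrow> ('b \<Rightarrow>\<^sub>0 'k)" where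
  "adjoint \<beta> y F w = (\<Sum>q<length w. F (w[q := \<beta> (w ! q) y]))"

definition leibniz ::
    "('r \<Rightarrow> 'r \<Rightarrow> 'r) \<Rightarrow> ('r list \<Rightarrow> 'b \<Rightarrow>\<^sub>0 'k::field) \<Rightarrow> 'r list \<Rightarrow> ('b \<Rightarrow>\<^sub>0 'k)" where
  "leibniz \<beta> F xs = (\<Sum>j<length xs. \<Sum>i<j.
     signed (j + 1) (F (remove_nth j (xs[i := \<beta> (xs ! i) (xs ! j)]))))"

lemma signed_signed [simp]: "signed j (signed k v) = signed (j + k) v"
  by (simp add: power_add)

lemma signed_cong: "even j = even k \<Longrightarrow> signed j v = signed k v"
  by (simp add: minus_one_power_iff)

lemma length_remove_nth: "k < length w \<Longrightarrow> length (remove_nth k w) = length w - 1"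
  by (simp add: remove_nth_def)

lemma nth_remove_nth:
  "k < length w \<Longrightarrow> q < length w - 1 \<Longrightarrow> remove_nth k w ! q = (if q < k then w ! q else w ! Suc q)"
  by (auto simp: remove_nth_def nth_append)

lemma set_remove_nth: "set (remove_nth k w) \<subseteq> set w"
  by (auto simp: remove_nth_def dest: in_set_takeD in_set_dropD)

lemma length_insert_letter [simp]: "p \<le> length w \<Longrightarrow> length (insert_letter p y w) = Suc (length w)"
  by (simp add: insert_letter_def)

lemma set_insert_letter [simp]: "set (insert_letter p y w) = insert y (set w)"
proof -
  have "set (take p w) \<union> set (drop p w) = set w" by (simp flip: set_append)
  then show ?thesis by (auto simp: insert_letter_def)
qed

lemma nth_insert_letter:
  "p \<le> length w \<Longrightarrow> q \<le> length w \<Longrightarrow>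
    insert_letter p y w ! q = (if q < p then w ! q else if q = p then y else w ! (q - 1))"
  by (auto simp: insert_letter_def nth_append nth_Cons')

lemma insert_letter_update:
  "p \<le> length w \<Longrightarrow> q < length w \<Longrightarrow>
    insert_letter p y (w[q := z]) = (insert_letter p y w)[(if q < p then q else Suc q) := z]"
  by (rule nth_equalityI) (auto simp: nth_insert_letter nth_list_update)

lemma insert_letter_update_same:
  "p \<le> length w \<Longrightarrow> (insert_letter p y w)[p := z] = insert_letter p z w"
  by (rule nth_equalityI) (auto simp: nth_insert_letter nth_list_update)

lemma foldr_insertions_cong:
  assumes "\<And>w. length w = length v + length ys \<Longrightarrow> set w \<subseteq> set v \<union> set ys \<Longrightarrow> F w = G w"
  shows "foldr insertions ys F v = foldr insertions ys G v"
  using assms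
proof (induction ys arbitrary: F G rule: rev_induct)
  case (snoc y ys)
  have "foldr insertions ys (insertions y F) v = foldr insertions ys (insertions y G) v"
    by (rule snoc.IH) (auto simp: insertions_def intro!: sum.cong arg_cong[where f = "scale_pm _"] snoc.prems)
  then show ?case by simp
qed auto

lemma alternation_cong:
  assumes "xs \<noteq> []" "\<And>w. length w = length xs \<Longrightarrow> set w \<subseteq> set xs \<Longrightarrow> F w = G w"
  shows "alternation F xs = alternation G xs"
  unfolding alternation_def using assms(1)
  by (intro foldr_insertions_cong assms(2)) (cases xs; auto)+

lemma alternation_single [simp]: "alternation F [x] = F [x]"
  by (simp add: alternation_def)

lemma alternation_snoc: "xs \<noteq> [] \<Longrightarrow> alternation F (xs @ [y]) = alternation (insertions y F) xs"
  by (simp add: alternation_def)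

lemma insertions_linear:
  "insertions y (\<lambda>w. F w + scale_pm c (G w)) w = insertions y F w + scale_pm c (insertions y G w)"
  by (simp add: insertions_def pm.scale_right_distrib sum.distrib pm.scale_sum_right mult.commute)

lemma foldr_insertions_linear:
  "foldr insertions ys (\<lambda>w. F w + scale_pm c (G w)) v
    = foldr insertions ys F v + scale_pm c (foldr insertions ys G v)"
proof (induction ys arbitrary: F G rule: rev_induct)
  case (snoc y ys)
  have "insertions y (\<lambda>w. F w + scale_pm c (G w)) = (\<lambda>w. insertions y F w + scale_pm c (insertions y G w))"
    by (rule ext) (rule insertions_linear)
  then show ?case using snoc by simp
qed simp

lemma alternation_linear:
  "alternation (\<lambda>w. F w + scale_pm c (G w)) xs = alternation F xs + scale_pm c (alternation G xs)"
  by (simp add: alternation_def foldr_insertions_linear)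

lemma insertions_adjoint:
  "insertions z (adjoint \<beta> y F) w = adjoint \<beta> y (insertions z F) w + insertions (\<beta> z y) F w"
proof -
  let ?n = "length w"
  have "adjoint \<beta> y F (insert_letter p z w)
      = (\<Sum>q<?n. F (insert_letter p z (w[q := \<beta> (w ! q) y]))) + F (insert_letter p (\<beta> z y) w)"
    if p: "p \<in> {1..?n}" for p
  proof -
    let ?w = "insert_letter p z w"
    have "adjoint \<beta> y F ?w = F (?w[p := \<beta> (?w ! p) y]) + (\<Sum>q\<in>{..<Suc ?n} - {p}. F (?w[q := \<beta> (?w ! q) y]))"
      using p sum.remove[of "{..<Suc ?n}" p] by (simp add: adjoint_def del: sum.lessThan_Suc)
    also have "(\<Sum>q\<in>{..<Suc ?n} - {p}. F (?w[q := \<beta> (?w ! q) y]))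
        = (\<Sum>q<?n. F (insert_letter p z (w[q := \<beta> (w ! q) y])))"
      using p
      by (intro sum.reindex_bij_witness[of _ "\<lambda>q. if q < p then q else Suc q" "\<lambda>q. if q < p then q else q - 1"])
        (auto simp: insert_letter_update nth_insert_letter)
    also have "F (?w[p := \<beta> (?w ! p) y]) = F (insert_letter p (\<beta> z y) w)"
      using p by (simp add: insert_letter_update_same nth_insert_letter)
    finally show ?thesis by (simp add: add.commute)
  qed
  then have "insertions z (adjoint \<beta> y F) w = (\<Sum>p=1..?n. signed (?n + p)
      ((\<Sum>q<?n. F (insert_letter p z (w[q := \<beta> (w ! q) y]))) + F (insert_letter p (\<beta> z y) w)))"
    unfolding insertions_def by (intro sum.cong) auto
  also have "\<dots> = (\<Sum>p=1..?n. \<Sum>q<?n. signed (?n + p) (F (insert_letter p z (w[q := \<beta> (w ! q) y]))))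
      + insertions (\<beta> z y) F w"
    by (simp add: insertions_def pm.scale_right_distrib sum.distrib pm.scale_sum_right)
  also have "(\<Sum>p=1..?n. \<Sum>q<?n. signed (?n + p) (F (insert_letter p z (w[q := \<beta> (w ! q) y]))))
      = adjoint \<beta> y (insertions z F) w"
    by (subst sum.swap) (simp add: adjoint_def insertions_def)
  finally show ?thesis .
qed

text \<open>Alternation is symmetric in the letters, hence commutes with the derivation \<open>[_, y]\<close>.\<close>

lemma alternation_adjoint:
  assumes "xs \<noteq> []"
  shows "alternation (adjoint \<beta> y F) xs = (\<Sum>i<length xs. alternation F (xs[i := \<beta> (xs ! i) y]))"
  using assms
proof (induction xs arbitrary: F rule: rev_nonempty_induct)
  case (single x)
  then show ?case by (simp add: adjoint_def)
next
  case (snoc z xs)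
  have "alternation (adjoint \<beta> y F) (xs @ [z]) = alternation (\<lambda>w. adjoint \<beta> y (insertions z F) w
      + scale_pm 1 (insertions (\<beta> z y) F w)) xs"
    using snoc(1) by (simp add: alternation_snoc insertions_adjoint[abs_def])
  also have "\<dots> = (\<Sum>i<length xs. alternation (insertions z F) (xs[i := \<beta> (xs ! i) y]))
      + alternation (insertions (\<beta> z y) F) xs"
    unfolding alternation_linear by (simp add: snoc.IH)
  also have "\<dots> = (\<Sum>i<length xs. alternation F ((xs @ [z])[i := \<beta> ((xs @ [z]) ! i) y]))
      + alternation F ((xs @ [z])[length xs := \<beta> z y])"
    using snoc(1) by (simp add: alternation_snoc[symmetric] nth_append list_update_append)
  finally show ?case by simp
qed

text \<open>In each slot, \<open>F\<close> sees the bracket as the difference of the two products.\<close>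

definition bracket_additive ::
    "'r set \<Rightarrow> ('r \<Rightarrow> 'r \<Rightarrow> 'r) \<Rightarrow> ('r \<Rightarrow> 'r \<Rightarrow> 'r) \<Rightarrow> ('r list \<Rightarrow> 'b \<Rightarrow>\<^sub>0 'k::field) \<Rightarrow> bool" where
  "bracket_additive K \<mu> \<beta> F \<longleftrightarrow> (\<forall>w q x y. set w \<subseteq> K \<longrightarrow> q < length w \<longrightarrow> x \<in> K \<longrightarrow> y \<in> K \<longrightarrow>
     F (w[q := \<beta> x y]) = F (w[q := \<mu> x y]) - F (w[q := \<mu> y x]))"

lemma bracket_additive_insertions:
  assumes "bracket_additive K \<mu> \<beta> F" "y \<in> K"
  shows "bracket_additive K \<mu> \<beta> (insertions y F)"
  unfolding bracket_additive_def
proof (intro allI impI)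
  fix w q u v assume w: "set w \<subseteq> K" "q < length w" "u \<in> K" "v \<in> K"
  have "F (insert_letter p y (w[q := \<beta> u v]))
      = F (insert_letter p y (w[q := \<mu> u v])) - F (insert_letter p y (w[q := \<mu> v u]))"
    if "p \<in> {1..length w}" for p
  proof -
    have p: "p \<le> length w" using that by simp
    have "(if q < p then q else Suc q) < length (insert_letter p y w)" using w p by simp
    then show ?thesis
      using assms w unfolding insert_letter_update[OF p w(2)] bracket_additive_def by simp
  qed
  then show "insertions y F (w[q := \<beta> u v]) = insertions y F (w[q := \<mu> u v]) - insertions y F (w[q := \<mu> v u])"
    by (simp add: insertions_def pm.scale_right_diff_distrib sum_subtractf)
qed

lemma length_hochschild_face [simp]:
  "2 \<le> length w \<Longrightarrow> i < length w \<Longrightarrow> length (hochschild_face \<mu> i w) = length w - 1"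
  by (auto simp: hochschild_face_def)

lemma nth_hochschild_face:
  assumes "2 \<le> length w" "i < length w" "q < length w - 1"
  shows "hochschild_face \<mu> i w ! q = (if Suc i < length w then
      (if q < i then w ! q else if q = i then \<mu> (w ! i) (w ! Suc i) else w ! Suc q)
    else if q = 0 then \<mu> (w ! i) (w ! 0) else w ! q)"
proof -
  obtain a v where w: "w = a # v" "v \<noteq> []" using assms(1) by (cases w; cases "tl w") auto
  show ?thesis
  proof (cases "Suc i < length w")
    case True
    then show ?thesis using assms by (auto simp: hochschild_face_def nth_append nth_Cons')
  next
    case False
    then have "i = length v" using assms w by simp
    then show ?thesis
      using assms w by (auto simp: hochschild_face_def nth_Cons' nth_butlast last_conv_nth)
  qed
qed

lemma hochschild_face_insert:
  assumes n: "length w = n" and p: "1 \<le> p" "p \<le> n"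
  shows "hochschild_face \<mu> (p - 1) (insert_letter p y w) = w[p - 1 := \<mu> (w ! (p - 1)) y]"
    and "hochschild_face \<mu> p (insert_letter p y w) = w[p mod n := \<mu> y (w ! (p mod n))]"
    and "i < p - 1 \<Longrightarrow> hochschild_face \<mu> i (insert_letter p y w) = insert_letter (p - 1) y (hochschild_face \<mu> i w)"
    and "p < i \<Longrightarrow> i \<le> n \<Longrightarrow> hochschild_face \<mu> i (insert_letter p y w) = insert_letter p y (hochschild_face \<mu> (i - 1) w)"
proof -
  show "hochschild_face \<mu> (p - 1) (insert_letter p y w) = w[p - 1 := \<mu> (w ! (p - 1)) y]"
    using n p by (intro nth_equalityI) (auto simp: nth_hochschild_face nth_insert_letter nth_list_update)
  show "hochschild_face \<mu> p (insert_letter p y w) = w[p mod n := \<mu> y (w ! (p mod n))]"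
    using n p by (cases "p = n"; intro nth_equalityI)
      (auto simp: nth_hochschild_face nth_insert_letter nth_list_update)
  show "hochschild_face \<mu> i (insert_letter p y w) = insert_letter (p - 1) y (hochschild_face \<mu> i w)"
    if "i < p - 1"
    using n p that by (intro nth_equalityI) (auto simp: nth_hochschild_face nth_insert_letter)
  show "hochschild_face \<mu> i (insert_letter p y w) = insert_letter p y (hochschild_face \<mu> (i - 1) w)"
    if "p < i" "i \<le> n"
    using n p that by (cases "i = n"; intro nth_equalityI) (auto simp: nth_hochschild_face nth_insert_letter)
qed

text \<open>
  Inserting \<open>y\<close> and then multiplying two adjacent letters: if \<open>y\<close> is not involved, the two operations
  commute.  The products in which \<open>y\<close> is involved pair up to the commutators with \<open>y\<close>.
\<close>

lemma insertions_hochschild: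
  assumes F: "bracket_additive K \<mu> \<beta> F" and w: "set w \<subseteq> K" "w \<noteq> []" and y: "y \<in> K"
  shows "insertions y (hochschild \<mu> F) w
    = hochschild \<mu> (insertions y F) w + signed (Suc (length w)) (adjoint \<beta> y F w)"
proof -
  define n where "n = length w"
  have n: "0 < n" using w by (simp add: n_def)
  let ?T = "\<lambda>p i. signed (n + p + i) (F (hochschild_face \<mu> i (insert_letter p y w)))"
  have "insertions y (hochschild \<mu> F) w = (\<Sum>p=1..n. \<Sum>i<Suc n. ?T p i)"
    using n by (simp add: insertions_def hochschild_def n_def[symmetric] pm.scale_sum_right power_add
        del: sum.lessThan_Suc cong: sum.cong_simp)
  also have "\<dots> = (\<Sum>p=1..n. ?T p (p - 1) + ?T p p + (\<Sum>i\<in>{..<Suc n} - {p - 1, p}. ?T p i))"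
  proof (rule sum.cong[OF refl])
    fix p assume p: "p \<in> {1..n}"
    have "(\<Sum>i<Suc n. ?T p i) = (\<Sum>i\<in>{p - 1, p}. ?T p i) + (\<Sum>i\<in>{..<Suc n} - {p - 1, p}. ?T p i)"
      using p by (subst sum.subset_diff[of "{p - 1, p}"]) (auto simp: add.commute)
    moreover have "p - 1 \<noteq> p" using p by auto
    ultimately show "(\<Sum>i<Suc n. ?T p i) = ?T p (p - 1) + ?T p p + (\<Sum>i\<in>{..<Suc n} - {p - 1, p}. ?T p i)"
      by simp
  qed
  also have "\<dots> = (\<Sum>p=1..n. ?T p (p - 1)) + (\<Sum>p=1..n. ?T p p)
      + (\<Sum>p=1..n. \<Sum>i\<in>{..<Suc n} - {p - 1, p}. ?T p i)"
    by (simp only: sum.distrib)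
  also have "(\<Sum>p=1..n. ?T p (p - 1)) = (\<Sum>q<n. signed (Suc n) (F (w[q := \<mu> (w ! q) y])))"
  proof (rule sum.reindex_bij_witness[of _ Suc "\<lambda>p. p - 1"])
    fix p assume p: "p \<in> {1..n}"
    then have p': "1 \<le> p" "p \<le> n" by auto
    show "signed (Suc n) (F (w[p - 1 := \<mu> (w ! (p - 1)) y])) = ?T p (p - 1)"
      unfolding hochschild_face_insert(1)[OF n_def[symmetric] p'] by (rule signed_cong) (use p' in auto)
  qed auto
  also have "(\<Sum>p=1..n. ?T p p) = (\<Sum>q<n. signed n (F (w[q := \<mu> y (w ! q)])))"
  proof (rule sum.reindex_bij_witness[of _ "\<lambda>q. if q = 0 then n else q" "\<lambda>p. p mod n"])
    fix p assume p: "p \<in> {1..n}"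
    then have p': "1 \<le> p" "p \<le> n" by auto
    show "signed n (F (w[p mod n := \<mu> y (w ! (p mod n))])) = ?T p p"
      unfolding hochschild_face_insert(2)[OF n_def[symmetric] p'] by (rule signed_cong) auto
    show "(if p mod n = 0 then n else p mod n) = p" using p by (cases "p = n") auto
  qed (use n in auto)
  also have "(\<Sum>q<n. signed (Suc n) (F (w[q := \<mu> (w ! q) y]))) + (\<Sum>q<n. signed n (F (w[q := \<mu> y (w ! q)])))
      = signed (Suc n) (adjoint \<beta> y F w)"
  proof -
    have "F (w[q := \<beta> (w ! q) y]) = F (w[q := \<mu> (w ! q) y]) - F (w[q := \<mu> y (w ! q)])" if "q < n" for q
      using F w y that nth_mem[of q w] unfolding bracket_additive_def n_def by blast
    then show ?thesis
      by (simp add: adjoint_def n_def[symmetric] sum_subtractf pm.scale_right_diff_distrib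
          pm.scale_sum_right sum_negf)
  qed
  also have "(\<Sum>p=1..n. \<Sum>i\<in>{..<Suc n} - {p - 1, p}. ?T p i) = hochschild \<mu> (insertions y F) w"
  proof (cases "n = 1")
    case True
    moreover have "{..<Suc (Suc 0)} = {0, Suc 0}" by auto
    ultimately show ?thesis by (simp add: hochschild_def n_def)
  next
    case False
    then have n2: "2 \<le> n" using n by simp
    let ?j = "\<lambda>(p, i). if i < p - 1 then (i, p - 1) else (i - 1, p)"
    let ?U = "\<lambda>i p. signed (i + (n - 1 + p)) (F (insert_letter p y (hochschild_face \<mu> i w)))"
    have "(\<Sum>p=1..n. \<Sum>i\<in>{..<Suc n} - {p - 1, p}. ?T p i)
        = (\<Sum>(p, i)\<in>(SIGMA p:{1..n}. {..<Suc n} - {p - 1, p}). ?T p i)"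
      by (rule sum.Sigma) auto
    also have "\<dots> = (\<Sum>(i, p)\<in>{..<n} \<times> {1..n - 1}. ?U i p)"
    proof (rule sum.reindex_bij_witness[of _ "\<lambda>(i, p). if i < p then (Suc p, i) else (p, Suc i)"
          ?j])
      fix a assume "a \<in> (SIGMA p:{1..n}. {..<Suc n} - {p - 1, p})"
      then obtain p i where a: "a = (p, i)" and pi: "p \<in> {1..n}" "i \<in> {..<Suc n}" "i \<notin> {p - 1, p}" by blast
      then have p: "1 \<le> p" "p \<le> n" by auto
      show "(case ?j a of (i, p) \<Rightarrow> ?U i p) = (case a of (p, i) \<Rightarrow> ?T p i)"
      proof (cases "i < p - 1")
        case True
        have "?U i (p - 1) = ?T p i"
          unfolding hochschild_face_insert(3)[OF n_def[symmetric] p True] by (rule signed_cong) (use p True in auto)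
        then show ?thesis using True by (simp only: a if_True prod.case)
      next
        case False
        then have i: "p < i" "i \<le> n" using pi by auto
        have "?U (i - 1) p = ?T p i"
          unfolding hochschild_face_insert(4)[OF n_def[symmetric] p i] by (rule signed_cong) (use i p in auto)
        then show ?thesis using False by (simp only: a if_False prod.case)
      qed
    qed (auto split: if_splits)
    also have "\<dots> = (\<Sum>i<n. \<Sum>p=1..n - 1. ?U i p)"
      by (rule sum.cartesian_product[symmetric])
    also have "\<dots> = hochschild \<mu> (insertions y F) w"
      using n2 by (simp add: hochschild_def insertions_def n_def[symmetric] pm.scale_sum_right del: pm.scale_scale
        cong: sum.cong_simp)
    finally show ?thesis .
  qed
  finally show ?thesis by (simp add: n_def add.commute)
qed

text \<open>
  The operation \<open>leibniz\<close> on words satisfies a recursion in the last letter, which matches the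
  commutation of insertions with \<open>hochschild\<close>.
\<close>

lemma alternation_hochschild:
  assumes "xs \<noteq> []" "set xs \<subseteq> K" "bracket_additive K \<mu> \<beta> F"
  shows "alternation (hochschild \<mu> F) xs = leibniz \<beta> (alternation F) xs"
  using assms
proof (induction xs arbitrary: F rule: rev_nonempty_induct)
  case (single x)
  then show ?case by (simp add: hochschild_def leibniz_def)
next
  case (snoc y xs)
  let ?n = "length xs"
  have xs: "set xs \<subseteq> K" and y: "y \<in> K" using snoc.prems by auto
  have "alternation (hochschild \<mu> F) (xs @ [y]) = alternation (\<lambda>w. hochschild \<mu> (insertions y F) w
      + signed (Suc ?n) (adjoint \<beta> y F w)) xs"
    unfolding alternation_snoc[OF snoc(1)]
    by (rule alternation_cong[OF snoc(1)], subst insertions_hochschild[OF snoc.prems(2) _ _ y])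
      (use xs snoc(1) in auto)
  also have "\<dots> = leibniz \<beta> (alternation (insertions y F)) xs
      + signed (Suc ?n) (\<Sum>i<?n. alternation F (xs[i := \<beta> (xs ! i) y]))"
    unfolding alternation_linear alternation_adjoint[OF snoc(1)]
    by (simp add: snoc.IH[OF xs bracket_additive_insertions[OF snoc.prems(2) y]])
  also have "leibniz \<beta> (alternation (insertions y F)) xs = (\<Sum>j<?n. \<Sum>i<j. signed (j + 1)
      (alternation F (remove_nth j ((xs @ [y])[i := \<beta> ((xs @ [y]) ! i) ((xs @ [y]) ! j)]))))"
  proof -
    have "alternation (insertions y F) (remove_nth j (xs[i := z])) = alternation F (remove_nth j ((xs @ [y])[i := z]))"
      if "i < j" "j < ?n" for i j z
    proof -
      have "remove_nth j ((xs @ [y])[i := z]) = remove_nth j (xs[i := z]) @ [y]"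
        using that by (simp add: remove_nth_def list_update_append)
      moreover have "remove_nth j (xs[i := z]) \<noteq> []"
        using that by (auto simp: remove_nth_def)
      ultimately show ?thesis by (simp add: alternation_snoc)
    qed
    then show ?thesis
      unfolding leibniz_def by (intro sum.cong) (auto simp: nth_append)
  qed
  also have "signed (Suc ?n) (\<Sum>i<?n. alternation F (xs[i := \<beta> (xs ! i) y])) = (\<Sum>i<?n. signed (?n + 1)
      (alternation F (remove_nth ?n ((xs @ [y])[i := \<beta> ((xs @ [y]) ! i) ((xs @ [y]) ! ?n)]))))"
    by (simp add: pm.scale_sum_right remove_nth_def list_update_append nth_append)
  finally show ?case by (simp add: leibniz_def)
qed

text \<open>The cycle \<open>b \<mapsto> b + 1 \<mapsto> \<dots> \<mapsto> m \<mapsto> b\<close>.\<close>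

definition interval_cycle :: "nat \<Rightarrow> nat \<Rightarrow> nat \<Rightarrow> nat" where
  "interval_cycle m b q = (if q = m then b else if b \<le> q \<and> q < m then Suc q else q)"

lemma interval_cycle_step:
  "b < m \<Longrightarrow> interval_cycle m b = Transposition.transpose b (Suc b) \<circ> interval_cycle m (Suc b)"
  by (auto simp: fun_eq_iff interval_cycle_def Transposition.transpose_def)

lemma interval_cycle_permutes_sign:
  assumes "b \<le> m"
  shows "interval_cycle m b permutes {b..m} \<and> sign (interval_cycle m b) = (- 1) ^ (m - b)"
  using assms
proof (induction b rule: inc_induct)
  case base
  have "interval_cycle m m = id" by (auto simp: interval_cycle_def fun_eq_iff)
  then show ?case using permutes_id[of "{m..m}"] by (simp only: sign_id diff_self_eq_0 power_0)
next
  case (step b)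
  have t: "Transposition.transpose b (Suc b) permutes {b..m}"
    using step by (intro permutes_swap_id) auto
  have c: "interval_cycle m (Suc b) permutes {b..m}"
    by (rule permutes_subset[OF conjunct1[OF step.IH]]) simp
  have "sign (interval_cycle m b) = sign (Transposition.transpose b (Suc b)) * sign (interval_cycle m (Suc b))"
    unfolding interval_cycle_step[OF step(2)]
    by (rule sign_compose[OF permutes_imp_permutation[OF _ t] permutes_imp_permutation[OF _ c]]) simp_all
  also have "\<dots> = (- 1) ^ (m - b)"
    using step by (simp add: sign_swap_id Suc_diff_Suc[symmetric])
  finally show ?case
    using permutes_compose[OF c t] unfolding interval_cycle_step[OF step(2)] by blast
qed

lemma inv_interval_cycle:
  assumes "b \<le> m"
  shows "inv_into UNIV (interval_cycle m b) q = (if q = b then m else if b < q \<and> q \<le> m then q - 1 else q)"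
proof -
  have inj: "inj (interval_cycle m b)"
    using interval_cycle_permutes_sign[OF assms] permutes_inj by blast
  show ?thesis
    by (rule inv_f_eq[OF inj]) (use assms in \<open>auto simp: interval_cycle_def\<close>)
qed

definition permuted_word :: "'r list \<Rightarrow> (nat \<Rightarrow> nat) \<Rightarrow> 'r list" where
  "permuted_word xs \<sigma> = map (\<lambda>p. xs ! inv_into UNIV \<sigma> p) [0..<length xs]"

lemma nth_permuted_word: "q < length xs \<Longrightarrow> permuted_word xs \<sigma> ! q = xs ! inv_into UNIV \<sigma> q"
  by (simp add: permuted_word_def)

lemma length_permuted_word [simp]: "length (permuted_word xs \<sigma>) = length xs"
  by (simp add: permuted_word_def)

lemma permutes_inv_less:
  assumes "\<sigma> permutes {1..n}" "p < Suc n"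
  shows "inv_into UNIV \<sigma> p < Suc n"
  using assms(2) permutes_in_image[OF permutes_inv[OF assms(1)], of p]
    permutes_not_in[OF permutes_inv[OF assms(1)], of p] by (cases "p = 0") auto

lemma permuted_word_mem:
  assumes "\<sigma> permutes {1..n}" "xs \<in> words R (Suc n)"
  shows "permuted_word xs \<sigma> \<in> words R (Suc n)"
  using permutes_inv_less[OF assms(1)] words_nth[OF assms(2)] assms(2) by (auto simp: permuted_word_def)

lemma permuted_word_insert:
  assumes p: "p permutes {1..n}" and n: "length xs = Suc n" and b: "b \<in> {1..Suc n}"
  shows "permuted_word (xs @ [y]) (interval_cycle (Suc n) b \<circ> p) = insert_letter b y (permuted_word xs p)"
proof (rule nth_equalityI)
  show "length (permuted_word (xs @ [y]) (interval_cycle (Suc n) b \<circ> p)) = length (insert_letter b y (permuted_word xs p))"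
    using n b by (simp add: permuted_word_def)
  fix q assume "q < length (permuted_word (xs @ [y]) (interval_cycle (Suc n) b \<circ> p))"
  then have q: "q \<le> Suc n" using n by (simp add: permuted_word_def)
  have bij: "bij (interval_cycle (Suc n) b)" "bij p"
    using interval_cycle_permutes_sign[of b "Suc n"] b p permutes_bij by auto
  have ip: "inv_into UNIV p permutes {1..n}" by (rule permutes_inv[OF p])
  have iq: "inv_into UNIV (interval_cycle (Suc n) b \<circ> p) q = inv_into UNIV p (inv_into UNIV (interval_cycle (Suc n) b) q)"
    using o_inv_distrib[OF bij] by (simp add: fun_eq_iff)
  have top: "inv_into UNIV p (Suc n) = Suc n" by (rule permutes_not_in[OF ip]) simp
  note small = permutes_inv_less[OF p]
  show "permuted_word (xs @ [y]) (interval_cycle (Suc n) b \<circ> p) ! q = insert_letter b y (permuted_word xs p) ! q"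
  proof (cases rule: linorder_cases[of q b])
    case less
    then show ?thesis using b n small[of q]
      by (simp add: nth_permuted_word nth_insert_letter iq inv_interval_cycle nth_append)
  next
    case equal
    then show ?thesis using b n
      by (simp add: nth_permuted_word nth_insert_letter iq[unfolded equal] inv_interval_cycle nth_append top)
  next
    case greater
    then show ?thesis using b n q small[of "q - 1"]
      by (simp add: nth_permuted_word nth_insert_letter iq inv_interval_cycle nth_append)
  qed
qed

lemma bij_betw_interval_cycle:
  "bij_betw (\<lambda>(b, p). interval_cycle (Suc n) b \<circ> p) ({1..Suc n} \<times> {p. p permutes {1..n}})
     {\<sigma>. \<sigma> permutes {1..Suc n}}"
proof (rule bij_betw_byWitness[where f' = "\<lambda>\<sigma>. (\<sigma> (Suc n), inv_into UNIV (interval_cycle (Suc n) (\<sigma> (Suc n))) \<circ> \<sigma>)"])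
  let ?c = "interval_cycle (Suc n)"
  have c: "?c b permutes {1..Suc n}" if "b \<in> {1..Suc n}" for b
    by (rule permutes_subset[OF conjunct1[OF interval_cycle_permutes_sign[of b "Suc n"]]]) (use that in auto)
  have top: "?c b (Suc n) = b" for b by (simp add: interval_cycle_def)
  have fix_top: "p (Suc n) = Suc n" if "p permutes {1..n}" for p
    by (rule permutes_not_in[OF that]) simp
  show "\<forall>a\<in>{1..Suc n} \<times> {p. p permutes {1..n}}.
      (\<lambda>\<sigma>. (\<sigma> (Suc n), inv_into UNIV (?c (\<sigma> (Suc n))) \<circ> \<sigma>)) (case a of (b, p) \<Rightarrow> ?c b \<circ> p) = a"
  proof
    fix a assume "a \<in> {1..Suc n} \<times> {p. p permutes {1..n}}"
    then obtain b p where a: "a = (b, p)" and b: "b \<in> {1..Suc n}" and p: "p permutes {1..n}" by auto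
    have "inv_into UNIV (?c b) \<circ> (?c b \<circ> p) = p"
      using permutes_inv_o(2)[OF c[OF b]] by (simp flip: comp_assoc)
    then show "(\<lambda>\<sigma>. (\<sigma> (Suc n), inv_into UNIV (?c (\<sigma> (Suc n))) \<circ> \<sigma>)) (case a of (b, p) \<Rightarrow> ?c b \<circ> p) = a"
      by (simp add: fix_top[OF p] top a)
  qed
  show "\<forall>\<sigma>\<in>{\<sigma>. \<sigma> permutes {1..Suc n}}.
      (case (\<sigma> (Suc n), inv_into UNIV (?c (\<sigma> (Suc n))) \<circ> \<sigma>) of (b, p) \<Rightarrow> ?c b \<circ> p) = \<sigma>"
  proof clarify
    fix \<sigma> assume s: "\<sigma> permutes {1..Suc n}"
    have "\<sigma> (Suc n) \<in> {1..Suc n}" using permutes_in_image[OF s, of "Suc n"] by simp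
    then show "?c (\<sigma> (Suc n)) \<circ> (inv_into UNIV (?c (\<sigma> (Suc n))) \<circ> \<sigma>) = \<sigma>"
      using permutes_inv_o(1)[OF c] by (simp flip: comp_assoc)
  qed
  show "(\<lambda>(b, p). ?c b \<circ> p) ` ({1..Suc n} \<times> {p. p permutes {1..n}}) \<subseteq> {\<sigma>. \<sigma> permutes {1..Suc n}}"
  proof clarify
    fix b p assume b: "b \<in> {1..Suc n}" and p: "p permutes {1..n}"
    have "p permutes {1..Suc n}" by (rule permutes_subset[OF p]) simp
    then show "?c b \<circ> p permutes {1..Suc n}" by (rule permutes_compose[OF _ c[OF b]])
  qed
  show "(\<lambda>\<sigma>. (\<sigma> (Suc n), inv_into UNIV (?c (\<sigma> (Suc n))) \<circ> \<sigma>)) ` {\<sigma>. \<sigma> permutes {1..Suc n}}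
      \<subseteq> {1..Suc n} \<times> {p. p permutes {1..n}}"
  proof (rule image_subsetI)
    fix \<sigma> assume "\<sigma> \<in> {\<sigma>. \<sigma> permutes {1..Suc n}}"
    then have s: "\<sigma> permutes {1..Suc n}" by simp
    define b where "b = \<sigma> (Suc n)"
    have b: "b \<in> {1..Suc n}" using permutes_in_image[OF s, of "Suc n"] by (simp add: b_def)
    have perm: "inv_into UNIV (?c b) \<circ> \<sigma> permutes {1..Suc n}"
      by (rule permutes_compose[OF s permutes_inv[OF c[OF b]]])
    have "(inv_into UNIV (?c b) \<circ> \<sigma>) (Suc n) = Suc n"
      using b by (simp add: inv_interval_cycle flip: b_def)
    then have "inv_into UNIV (?c b) \<circ> \<sigma> permutes {1..n}"
      by (intro permutes_superset[OF perm]) (auto simp: le_Suc_eq)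
    then show "(\<sigma> (Suc n), inv_into UNIV (?c (\<sigma> (Suc n))) \<circ> \<sigma>) \<in> {1..Suc n} \<times> {p. p permutes {1..n}}"
      using b by (auto simp: b_def)
  qed
qed

text \<open>
  A permutation \<open>\<sigma>\<close> of \<open>{1..n + 1}\<close> is a permutation of \<open>{1..n}\<close> followed by the cycle that moves
  \<open>n + 1\<close> to \<open>b = \<sigma> (n + 1)\<close>; on words this inserts the last letter at position \<open>b\<close>.
\<close>

lemma sum_permutations_eq_alternation:
  assumes "length xs = Suc n"
  shows "(\<Sum>\<sigma> | \<sigma> permutes {1..n}. scale_pm (of_int (sign \<sigma>)) (F (permuted_word xs \<sigma>))) = alternation F xs"
  using assms
proof (induction n arbitrary: xs F)
  case 0
  then obtain x where "xs = [x]" by (cases xs) auto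
  moreover have "{\<sigma>. \<sigma> permutes {1..0::nat}} = {id}" by (auto simp: permutes_id)
  ultimately show ?case by (simp add: permuted_word_def)
next
  case (Suc n)
  then obtain ys y where xs: "xs = ys @ [y]" "length ys = Suc n" by (cases xs rule: rev_cases) auto
  let ?c = "interval_cycle (Suc n)" and ?P = "{p. p permutes {1..n}}"
  let ?t = "\<lambda>\<sigma>. scale_pm (of_int (sign \<sigma>)) (F (permuted_word xs \<sigma>))"
  have summand: "?t (?c b \<circ> p) = scale_pm (of_int (sign p)) (signed (Suc n + b) (F (insert_letter b y (permuted_word ys p))))"
    if b: "b \<in> {1..Suc n}" and p: "p permutes {1..n}" for b p
  proof -
    have "?c b permutes {b..Suc n}" and sc: "sign (?c b) = (- 1) ^ (Suc n - b)"
      using interval_cycle_permutes_sign[of b "Suc n"] b by auto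
    then have "permutation (?c b)" "permutation p"
      using p by (auto intro: permutes_imp_permutation[rotated])
    then have "sign (?c b \<circ> p) = (- 1) ^ (Suc n - b) * sign p"
      using sc by (simp add: sign_compose)
    moreover have "(- 1 :: int) ^ (Suc n - b) = (- 1) ^ (Suc n + b)"
      using b by (simp add: minus_one_power_iff)
    ultimately show ?thesis
      unfolding xs(1) permuted_word_insert[OF p xs(2) b] by (simp add: mult.commute)
  qed
  have "(\<Sum>\<sigma> | \<sigma> permutes {1..Suc n}. ?t \<sigma>) = (\<Sum>(b, p)\<in>{1..Suc n} \<times> ?P. ?t (?c b \<circ> p))"
    using sum.reindex_bij_betw[OF bij_betw_interval_cycle, of ?t] by (simp add: case_prod_unfold)
  also have "\<dots> = (\<Sum>b=1..Suc n. \<Sum>p\<in>?P. ?t (?c b \<circ> p))"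
    by (rule sum.cartesian_product[symmetric])
  also have "\<dots> = (\<Sum>p\<in>?P. \<Sum>b=1..Suc n. ?t (?c b \<circ> p))" by (rule sum.swap)
  also have "\<dots> = (\<Sum>p\<in>?P. scale_pm (of_int (sign p)) (insertions y F (permuted_word ys p)))"
  proof (rule sum.cong[OF refl])
    fix p assume "p \<in> ?P"
    moreover have "length (permuted_word ys p) = Suc n" by (simp add: permuted_word_def xs)
    ultimately show "(\<Sum>b=1..Suc n. ?t (?c b \<circ> p)) = scale_pm (of_int (sign p)) (insertions y F (permuted_word ys p))"
      unfolding insertions_def pm.scale_sum_right by (intro sum.cong) (auto simp only: summand)
  qed
  also have "\<dots> = alternation F xs"
  proof -
    have ys: "ys \<noteq> []" using xs by auto
    show ?thesis unfolding xs(1) alternation_snoc[OF ys] by (rule Suc.IH[OF xs(2)])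
  qed
  finally show ?case .
qed


section \<open>Matrices over an algebra with bilinear product\<close>

definition bilinear_mult :: "('k, 'r) module \<Rightarrow> bool" where
  "bilinear_mult R \<longleftrightarrow> (\<forall>y\<in>carrier R. (\<lambda>x. x \<otimes>\<^bsub>R\<^esub> y) \<in> linear_maps R R) \<and>
     (\<forall>x\<in>carrier R. (\<lambda>y. x \<otimes>\<^bsub>R\<^esub> y) \<in> linear_maps R R)"

lemma bilinear_multD:
  assumes "bilinear_mult R"
  shows "y \<in> carrier R \<Longrightarrow> (\<lambda>x. x \<otimes>\<^bsub>R\<^esub> y) \<in> linear_maps R R"
    and "x \<in> carrier R \<Longrightarrow> (\<lambda>y. x \<otimes>\<^bsub>R\<^esub> y) \<in> linear_maps R R"
    and "x \<in> carrier R \<Longrightarrow> y \<in> carrier R \<Longrightarrow> x \<otimes>\<^bsub>R\<^esub> y \<in> carrier R"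
  using assms linear_maps_closed by (fastforce simp: bilinear_mult_def)+

lemma commutator_linear:
  assumes R: "vect R" and b: "bilinear_mult R" and z: "z \<in> carrier R"
  shows "(\<lambda>x. commutator R x z) \<in> linear_maps R R" "(\<lambda>x. commutator R z x) \<in> linear_maps R R"
proof -
  interpret R: vect R by (rule R)
  have *: "(\<lambda>x. f x \<oplus>\<^bsub>R\<^esub> (- 1) \<odot>\<^bsub>R\<^esub> g x) \<in> linear_maps R R"
    if "f \<in> linear_maps R R" "g \<in> linear_maps R R" for f g
    by (rule linear_maps_combination(1)[OF R that(1) linear_maps_combination(2)[OF R that(2) that(2)]])
  have eq: "commutator R x y = (x \<otimes>\<^bsub>R\<^esub> y) \<oplus>\<^bsub>R\<^esub> (- 1) \<odot>\<^bsub>R\<^esub> (y \<otimes>\<^bsub>R\<^esub> x)"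
    if "x \<in> carrier R" "y \<in> carrier R" for x y
    using that bilinear_multD(3)[OF b] by (simp add: commutator_def R.minus_combination)
  show "(\<lambda>x. commutator R x z) \<in> linear_maps R R"
    using *[OF bilinear_multD(1)[OF b z] bilinear_multD(2)[OF b z]] z
    by (subst linear_maps_cong[OF R eq]) auto
  show "(\<lambda>x. commutator R z x) \<in> linear_maps R R"
    using *[OF bilinear_multD(2)[OF b z] bilinear_multD(1)[OF b z]] z
    by (subst linear_maps_cong[OF R eq]) auto
qed

lemma commutator_closed:
  assumes "vect R" "bilinear_mult R" "x \<in> carrier R" "y \<in> carrier R"
  shows "commutator R x y \<in> carrier R"
  using linear_maps_closed[OF commutator_linear(1)[OF assms(1,2,4)] assms(3)] .

lemma gl_simps [simp]:
  "zero (gl A) = (\<lambda>i j. \<zero>\<^bsub>A\<^esub>)" "add (gl A) = (\<lambda>X Y i j. X i j \<oplus>\<^bsub>A\<^esub> Y i j)"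
  "smult (gl A) = (\<lambda>c X i j. c \<odot>\<^bsub>A\<^esub> X i j)"
  by (simp_all add: gl_def)

text \<open>In this form the supports of finitely many matrices have a common bound.\<close>

lemma carrier_gl_iff:
  "X \<in> carrier (gl A) \<longleftrightarrow> (\<forall>i j. X i j \<in> carrier A) \<and>
     (\<forall>\<^sub>F N in sequentially. \<forall>i j. X i j \<noteq> \<zero>\<^bsub>A\<^esub> \<longrightarrow> i < N \<and> j < N)"
proof -
  let ?S = "{(i, j). X i j \<noteq> \<zero>\<^bsub>A\<^esub>}"
  have "finite ?S \<longleftrightarrow> (\<forall>\<^sub>F N in sequentially. \<forall>i j. X i j \<noteq> \<zero>\<^bsub>A\<^esub> \<longrightarrow> i < N \<and> j < N)"
  proof
    assume fin: "finite ?S"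
    have "\<forall>i j. X i j \<noteq> \<zero>\<^bsub>A\<^esub> \<longrightarrow> i < N \<and> j < N" if N: "Suc (Max (fst ` ?S \<union> snd ` ?S)) \<le> N" for N
    proof (intro allI impI)
      fix i j assume "X i j \<noteq> \<zero>\<^bsub>A\<^esub>"
      then have "i \<in> fst ` ?S \<union> snd ` ?S" "j \<in> fst ` ?S \<union> snd ` ?S" by force+
      moreover have "finite (fst ` ?S \<union> snd ` ?S)" using fin by (intro finite_UnI finite_imageI)
      ultimately have "i \<le> Max (fst ` ?S \<union> snd ` ?S)" "j \<le> Max (fst ` ?S \<union> snd ` ?S)"
        by (simp_all only: Max_ge)
      then show "i < N \<and> j < N" using N by linarith
    qed
    then show "\<forall>\<^sub>F N in sequentially. \<forall>i j. X i j \<noteq> \<zero>\<^bsub>A\<^esub> \<longrightarrow> i < N \<and> j < N"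
      unfolding eventually_sequentially by blast
  next
    assume "\<forall>\<^sub>F N in sequentially. \<forall>i j. X i j \<noteq> \<zero>\<^bsub>A\<^esub> \<longrightarrow> i < N \<and> j < N"
    then obtain N where "\<forall>i j. X i j \<noteq> \<zero>\<^bsub>A\<^esub> \<longrightarrow> i < N \<and> j < N"
      unfolding eventually_sequentially by blast
    then have "?S \<subseteq> {..<N} \<times> {..<N}" by auto
    then show "finite ?S" by (rule finite_subset) simp
  qed
  then show ?thesis by (simp add: gl_def)
qed

lemma carrier_glI:
  assumes "\<And>i j. X i j \<in> carrier A" "\<And>i j. X i j \<noteq> \<zero>\<^bsub>A\<^esub> \<Longrightarrow> i < N \<and> j < N"
  shows "X \<in> carrier (gl A)"
  unfolding carrier_gl_iff eventually_sequentially using assms by (meson less_le_trans)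

context
  fixes A :: "('k::field, 'a) module"
  assumes A: "vect A"
begin

interpretation A: vect A by (rule A)

lemma vect_gl: "vect (gl A)"
proof (rule vectI)
  have add: "X \<oplus>\<^bsub>gl A\<^esub> Y \<in> carrier (gl A)" if "X \<in> carrier (gl A)" "Y \<in> carrier (gl A)" for X Y
  proof -
    have "\<forall>\<^sub>F N in sequentially. (\<forall>i j. X i j \<noteq> \<zero>\<^bsub>A\<^esub> \<longrightarrow> i < N \<and> j < N) \<and> (\<forall>i j. Y i j \<noteq> \<zero>\<^bsub>A\<^esub> \<longrightarrow> i < N \<and> j < N)"
      using that by (intro eventually_conj) (auto simp: carrier_gl_iff)
    then have "\<forall>\<^sub>F N in sequentially. \<forall>i j. X i j \<oplus>\<^bsub>A\<^esub> Y i j \<noteq> \<zero>\<^bsub>A\<^esub> \<longrightarrow> i < N \<and> j < N"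
      by (rule eventually_mono) (metis A.l_zero A.zero_closed)
    then show ?thesis using that by (simp add: carrier_gl_iff)
  qed
  have smult: "c \<odot>\<^bsub>gl A\<^esub> X \<in> carrier (gl A)" if "X \<in> carrier (gl A)" for c X
  proof -
    have "\<forall>\<^sub>F N in sequentially. \<forall>i j. X i j \<noteq> \<zero>\<^bsub>A\<^esub> \<longrightarrow> i < N \<and> j < N"
      using that by (simp add: carrier_gl_iff)
    then have "\<forall>\<^sub>F N in sequentially. \<forall>i j. c \<odot>\<^bsub>A\<^esub> X i j \<noteq> \<zero>\<^bsub>A\<^esub> \<longrightarrow> i < N \<and> j < N"
      by (rule eventually_mono) (metis A.smult_zero)
    then show ?thesis using that by (simp add: carrier_gl_iff)
  qed
  have entry: "X i j \<in> carrier A" if "X \<in> carrier (gl A)" for X i j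
    using that by (simp add: carrier_gl_iff)
  show "abelian_group (gl A)"
  proof (rule abelian_groupI)
    fix X assume X: "X \<in> carrier (gl A)"
    show "\<exists>Y\<in>carrier (gl A). Y \<oplus>\<^bsub>gl A\<^esub> X = \<zero>\<^bsub>gl A\<^esub>"
      using smult[OF X, of "- 1"] entry[OF X]
      by (intro bexI[of _ "(- 1) \<odot>\<^bsub>gl A\<^esub> X"]) (auto simp: fun_eq_iff A.minus_one_smult A.l_neg)
    fix Y assume Y: "Y \<in> carrier (gl A)"
    show "X \<oplus>\<^bsub>gl A\<^esub> Y \<in> carrier (gl A)" by (rule add[OF X Y])
    show "X \<oplus>\<^bsub>gl A\<^esub> Y = Y \<oplus>\<^bsub>gl A\<^esub> X"
      using entry[OF X] entry[OF Y] by (simp add: fun_eq_iff A.a_comm)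
    fix Z assume Z: "Z \<in> carrier (gl A)"
    show "X \<oplus>\<^bsub>gl A\<^esub> Y \<oplus>\<^bsub>gl A\<^esub> Z = X \<oplus>\<^bsub>gl A\<^esub> (Y \<oplus>\<^bsub>gl A\<^esub> Z)"
      using entry[OF X] entry[OF Y] entry[OF Z] by (simp add: fun_eq_iff A.a_assoc)
  qed (auto simp: entry carrier_gl_iff)
  show "c \<odot>\<^bsub>gl A\<^esub> X \<in> carrier (gl A)" if "X \<in> carrier (gl A)" for c X by (rule smult[OF that])
qed (auto simp: carrier_gl_iff A.add_smult A.smult_add A.mult_smult)

lemma entry_linear: "(\<lambda>X. X i j) \<in> linear_maps (gl A) A"
  by (rule linear_mapsI) (auto simp: carrier_gl_iff)

context
  assumes bilinear: "bilinear_mult A"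
begin

lemma gl_mult_eq:
  assumes X: "X \<in> carrier (gl A)" and Y: "Y \<in> carrier (gl A)"
    and N: "\<And>i j. X i j \<noteq> \<zero>\<^bsub>A\<^esub> \<Longrightarrow> j < N"
  shows "(X \<otimes>\<^bsub>gl A\<^esub> Y) i j = (\<Oplus>\<^bsub>A\<^esub>l\<in>{..<N}. X i l \<otimes>\<^bsub>A\<^esub> Y l j)"
proof -
  have cl: "X i j \<in> carrier A" "Y i j \<in> carrier A" for i j using X Y by (auto simp: carrier_gl_iff)
  have "\<zero>\<^bsub>A\<^esub> \<otimes>\<^bsub>A\<^esub> Y l j = \<zero>\<^bsub>A\<^esub>" for l
    by (rule linear_maps_zero[OF A A bilinear_multD(1)[OF bilinear cl(2)]])
  then have "(\<Oplus>\<^bsub>A\<^esub>l\<in>{l. X i l \<noteq> \<zero>\<^bsub>A\<^esub>}. X i l \<otimes>\<^bsub>A\<^esub> Y l j) = (\<Oplus>\<^bsub>A\<^esub>l\<in>{..<N}. X i l \<otimes>\<^bsub>A\<^esub> Y l j)"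
    using N cl bilinear_multD(3)[OF bilinear] by (intro A.add.finprod_mono_neutral_cong_left) auto
  then show ?thesis by (simp add: gl_def)
qed

lemma gl_mult_closed:
  assumes X: "X \<in> carrier (gl A)" and Y: "Y \<in> carrier (gl A)"
  shows "X \<otimes>\<^bsub>gl A\<^esub> Y \<in> carrier (gl A)"
proof -
  have "\<forall>\<^sub>F N in sequentially. (\<forall>i j. X i j \<noteq> \<zero>\<^bsub>A\<^esub> \<longrightarrow> i < N \<and> j < N) \<and> (\<forall>i j. Y i j \<noteq> \<zero>\<^bsub>A\<^esub> \<longrightarrow> i < N \<and> j < N)"
    using X Y by (intro eventually_conj) (auto simp: carrier_gl_iff)
  then obtain N where N: "\<And>i j. X i j \<noteq> \<zero>\<^bsub>A\<^esub> \<Longrightarrow> i < N \<and> j < N" "\<And>i j. Y i j \<noteq> \<zero>\<^bsub>A\<^esub> \<Longrightarrow> i < N \<and> j < N"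
    unfolding eventually_sequentially by blast
  have cl: "X i j \<in> carrier A" "Y i j \<in> carrier A" for i j using X Y by (auto simp: carrier_gl_iff)
  note eq = gl_mult_eq[OF X Y, of N] and zero = linear_maps_zero[OF A A bilinear_multD(1)[OF bilinear cl(2)]]
    linear_maps_zero[OF A A bilinear_multD(2)[OF bilinear cl(1)]]
  show ?thesis
  proof (rule carrier_glI)
    show "(X \<otimes>\<^bsub>gl A\<^esub> Y) i j \<in> carrier A" for i j
      using N(1) cl bilinear_multD(3)[OF bilinear] by (subst eq) (auto intro!: A.finsum_closed)
    fix i j assume nz: "(X \<otimes>\<^bsub>gl A\<^esub> Y) i j \<noteq> \<zero>\<^bsub>A\<^esub>"
    have "\<exists>l<N. X i l \<otimes>\<^bsub>A\<^esub> Y l j \<noteq> \<zero>\<^bsub>A\<^esub>"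
    proof (rule ccontr)
      assume "\<not> ?thesis"
      then have "(\<Oplus>\<^bsub>A\<^esub>l\<in>{..<N}. X i l \<otimes>\<^bsub>A\<^esub> Y l j) = \<zero>\<^bsub>A\<^esub>"
        by (intro A.add.finprod_one_eqI) auto
      then show False using nz eq N(1) by simp
    qed
    then obtain l where "X i l \<otimes>\<^bsub>A\<^esub> Y l j \<noteq> \<zero>\<^bsub>A\<^esub>" by blast
    then have "X i l \<noteq> \<zero>\<^bsub>A\<^esub>" "Y l j \<noteq> \<zero>\<^bsub>A\<^esub>" using zero by auto
    then show "i < N \<and> j < N" using N by blast
  qed
qed

lemma bilinear_mult_gl: "bilinear_mult (gl A)"
proof -
  interpret gl: vect "gl A" by (rule vect_gl)
  have bound: "\<exists>N. (\<forall>i j. X i j \<noteq> \<zero>\<^bsub>A\<^esub> \<longrightarrow> j < N) \<and> (\<forall>i j. X' i j \<noteq> \<zero>\<^bsub>A\<^esub> \<longrightarrow> j < N)"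
    if "X \<in> carrier (gl A)" "X' \<in> carrier (gl A)" for X X'
  proof -
    have "\<forall>\<^sub>F N in sequentially. (\<forall>i j. X i j \<noteq> \<zero>\<^bsub>A\<^esub> \<longrightarrow> i < N \<and> j < N) \<and> (\<forall>i j. X' i j \<noteq> \<zero>\<^bsub>A\<^esub> \<longrightarrow> i < N \<and> j < N)"
      using that by (intro eventually_conj) (auto simp: carrier_gl_iff)
    then show ?thesis unfolding eventually_sequentially by blast
  qed
  have cl: "X i j \<in> carrier A" if "X \<in> carrier (gl A)" for X i j using that by (simp add: carrier_gl_iff)
  have clm: "X i l \<otimes>\<^bsub>A\<^esub> Y l j \<in> carrier A" if "X \<in> carrier (gl A)" "Y \<in> carrier (gl A)" for X Y i l j
    using that by (intro bilinear_multD(3)[OF bilinear] cl)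
  have "(\<lambda>X. X \<otimes>\<^bsub>gl A\<^esub> Y) \<in> linear_maps (gl A) (gl A)" if Y: "Y \<in> carrier (gl A)" for Y
  proof (rule linear_mapsI)
    fix X assume X: "X \<in> carrier (gl A)"
    show "X \<otimes>\<^bsub>gl A\<^esub> Y \<in> carrier (gl A)" by (rule gl_mult_closed[OF X Y])
    show "(c \<odot>\<^bsub>gl A\<^esub> X) \<otimes>\<^bsub>gl A\<^esub> Y = c \<odot>\<^bsub>gl A\<^esub> (X \<otimes>\<^bsub>gl A\<^esub> Y)" for c
    proof (intro ext)
      fix i j
      obtain N where N: "\<And>i j. X i j \<noteq> \<zero>\<^bsub>A\<^esub> \<Longrightarrow> j < N" using bound[OF X X] by blast
      have N': "j < N" if "(c \<odot>\<^bsub>gl A\<^esub> X) i j \<noteq> \<zero>\<^bsub>A\<^esub>" for i j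
        using that N[of i j] by (cases "X i j = \<zero>\<^bsub>A\<^esub>") auto
      have cX: "c \<odot>\<^bsub>gl A\<^esub> X \<in> carrier (gl A)" by (rule gl.smult_mem[OF X])
      have "((c \<odot>\<^bsub>gl A\<^esub> X) \<otimes>\<^bsub>gl A\<^esub> Y) i j = (\<Oplus>\<^bsub>A\<^esub>l\<in>{..<N}. (c \<odot>\<^bsub>A\<^esub> X i l) \<otimes>\<^bsub>A\<^esub> Y l j)"
        by (subst gl_mult_eq[OF cX Y N']) simp_all
      also have "\<dots> = (\<Oplus>\<^bsub>A\<^esub>l\<in>{..<N}. c \<odot>\<^bsub>A\<^esub> (X i l \<otimes>\<^bsub>A\<^esub> Y l j))"
        using clm[OF X Y] linear_maps_smult[OF bilinear_multD(1)[OF bilinear cl[OF Y]] cl[OF X]]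
        by (intro A.finsum_cong) (auto simp: simp_implies_def)
      also have "\<dots> = (c \<odot>\<^bsub>gl A\<^esub> (X \<otimes>\<^bsub>gl A\<^esub> Y)) i j"
        using clm[OF X Y] N by (simp add: gl_mult_eq[OF X Y, of N] A.smult_finsum Pi_def)
      finally show "((c \<odot>\<^bsub>gl A\<^esub> X) \<otimes>\<^bsub>gl A\<^esub> Y) i j = (c \<odot>\<^bsub>gl A\<^esub> (X \<otimes>\<^bsub>gl A\<^esub> Y)) i j" .
    qed
    fix X' assume X': "X' \<in> carrier (gl A)"
    show "(X \<oplus>\<^bsub>gl A\<^esub> X') \<otimes>\<^bsub>gl A\<^esub> Y = (X \<otimes>\<^bsub>gl A\<^esub> Y) \<oplus>\<^bsub>gl A\<^esub> (X' \<otimes>\<^bsub>gl A\<^esub> Y)"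
    proof (intro ext)
      fix i j
      obtain N where N: "\<And>i j. X i j \<noteq> \<zero>\<^bsub>A\<^esub> \<Longrightarrow> j < N" "\<And>i j. X' i j \<noteq> \<zero>\<^bsub>A\<^esub> \<Longrightarrow> j < N"
        using bound[OF X X'] by blast
      have N': "j < N" if "(X \<oplus>\<^bsub>gl A\<^esub> X') i j \<noteq> \<zero>\<^bsub>A\<^esub>" for i j
        using that N[of i j] by (cases "X i j = \<zero>\<^bsub>A\<^esub>"; cases "X' i j = \<zero>\<^bsub>A\<^esub>") auto
      have "((X \<oplus>\<^bsub>gl A\<^esub> X') \<otimes>\<^bsub>gl A\<^esub> Y) i j = (\<Oplus>\<^bsub>A\<^esub>l\<in>{..<N}. (X i l \<oplus>\<^bsub>A\<^esub> X' i l) \<otimes>\<^bsub>A\<^esub> Y l j)"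
        using gl_mult_eq[OF gl.a_closed[OF X X'] Y N'] by simp
      also have "\<dots> = (\<Oplus>\<^bsub>A\<^esub>l\<in>{..<N}. (X i l \<otimes>\<^bsub>A\<^esub> Y l j) \<oplus>\<^bsub>A\<^esub> (X' i l \<otimes>\<^bsub>A\<^esub> Y l j))"
        using clm[OF X Y] clm[OF X' Y] linear_maps_add[OF bilinear_multD(1)[OF bilinear cl[OF Y]] cl[OF X] cl[OF X']]
        by (intro A.finsum_cong) (auto simp: simp_implies_def simp del: A.finsum_addf)
      also have "\<dots> = (X \<otimes>\<^bsub>gl A\<^esub> Y \<oplus>\<^bsub>gl A\<^esub> X' \<otimes>\<^bsub>gl A\<^esub> Y) i j"
        using clm[OF X Y] clm[OF X' Y] N by (simp add: gl_mult_eq[OF X Y, of N] gl_mult_eq[OF X' Y, of N] Pi_def)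
      finally show "((X \<oplus>\<^bsub>gl A\<^esub> X') \<otimes>\<^bsub>gl A\<^esub> Y) i j = (X \<otimes>\<^bsub>gl A\<^esub> Y \<oplus>\<^bsub>gl A\<^esub> X' \<otimes>\<^bsub>gl A\<^esub> Y) i j" .
    qed
  qed
  moreover have "(\<lambda>Y. X \<otimes>\<^bsub>gl A\<^esub> Y) \<in> linear_maps (gl A) (gl A)" if X: "X \<in> carrier (gl A)" for X
  proof (rule linear_mapsI)
    obtain N where N: "\<And>i j. X i j \<noteq> \<zero>\<^bsub>A\<^esub> \<Longrightarrow> j < N" using bound[OF X X] by blast
    note eq = gl_mult_eq[OF X _ N]
    fix Y assume Y: "Y \<in> carrier (gl A)"
    show "X \<otimes>\<^bsub>gl A\<^esub> Y \<in> carrier (gl A)" by (rule gl_mult_closed[OF X Y])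
    show "X \<otimes>\<^bsub>gl A\<^esub> (c \<odot>\<^bsub>gl A\<^esub> Y) = c \<odot>\<^bsub>gl A\<^esub> (X \<otimes>\<^bsub>gl A\<^esub> Y)" for c
    proof (intro ext)
      fix i j
      have "(X \<otimes>\<^bsub>gl A\<^esub> (c \<odot>\<^bsub>gl A\<^esub> Y)) i j = (\<Oplus>\<^bsub>A\<^esub>l\<in>{..<N}. X i l \<otimes>\<^bsub>A\<^esub> (c \<odot>\<^bsub>A\<^esub> Y l j))"
        by (subst eq[OF gl.smult_mem[OF Y]]) auto
      also have "\<dots> = (\<Oplus>\<^bsub>A\<^esub>l\<in>{..<N}. c \<odot>\<^bsub>A\<^esub> (X i l \<otimes>\<^bsub>A\<^esub> Y l j))"
        using clm[OF X Y] linear_maps_smult[OF bilinear_multD(2)[OF bilinear cl[OF X]] cl[OF Y]]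
        by (intro A.finsum_cong) (auto simp: simp_implies_def)
      also have "\<dots> = (c \<odot>\<^bsub>gl A\<^esub> (X \<otimes>\<^bsub>gl A\<^esub> Y)) i j"
        using clm[OF X Y] by (simp add: eq[OF Y] A.smult_finsum Pi_def)
      finally show "(X \<otimes>\<^bsub>gl A\<^esub> (c \<odot>\<^bsub>gl A\<^esub> Y)) i j = (c \<odot>\<^bsub>gl A\<^esub> (X \<otimes>\<^bsub>gl A\<^esub> Y)) i j" .
    qed
    fix Y' assume Y': "Y' \<in> carrier (gl A)"
    show "X \<otimes>\<^bsub>gl A\<^esub> (Y \<oplus>\<^bsub>gl A\<^esub> Y') = (X \<otimes>\<^bsub>gl A\<^esub> Y) \<oplus>\<^bsub>gl A\<^esub> (X \<otimes>\<^bsub>gl A\<^esub> Y')"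
    proof (intro ext)
      fix i j
      have "(X \<otimes>\<^bsub>gl A\<^esub> (Y \<oplus>\<^bsub>gl A\<^esub> Y')) i j = (\<Oplus>\<^bsub>A\<^esub>l\<in>{..<N}. X i l \<otimes>\<^bsub>A\<^esub> (Y l j \<oplus>\<^bsub>A\<^esub> Y' l j))"
        by (subst eq[OF gl.a_closed[OF Y Y']]) auto
      also have "\<dots> = (\<Oplus>\<^bsub>A\<^esub>l\<in>{..<N}. (X i l \<otimes>\<^bsub>A\<^esub> Y l j) \<oplus>\<^bsub>A\<^esub> (X i l \<otimes>\<^bsub>A\<^esub> Y' l j))"
        using clm[OF X Y] clm[OF X Y'] linear_maps_add[OF bilinear_multD(2)[OF bilinear cl[OF X]] cl[OF Y] cl[OF Y']]
        by (intro A.finsum_cong) (auto simp: simp_implies_def simp del: A.finsum_addf)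
      also have "\<dots> = (X \<otimes>\<^bsub>gl A\<^esub> Y \<oplus>\<^bsub>gl A\<^esub> X \<otimes>\<^bsub>gl A\<^esub> Y') i j"
        using clm[OF X Y] clm[OF X Y'] by (simp add: eq[OF Y] eq[OF Y'] Pi_def)
      finally show "(X \<otimes>\<^bsub>gl A\<^esub> (Y \<oplus>\<^bsub>gl A\<^esub> Y')) i j = (X \<otimes>\<^bsub>gl A\<^esub> Y \<oplus>\<^bsub>gl A\<^esub> X \<otimes>\<^bsub>gl A\<^esub> Y') i j" .
    qed
  qed
  ultimately show ?thesis by (simp add: bilinear_mult_def)
qed

end

end

lemma group_ring_simps [simp]:
  "carrier (group_ring G) = {x. Poly_Mapping.keys x \<subseteq> carrier G}"
  "zero (group_ring G) = 0" "add (group_ring G) = (+)" "smult (group_ring G) = scale_pm"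
  by (simp_all add: group_ring_def)

lemma vect_group_ring: "vect (group_ring G)"
proof (rule vectI)
  interpret F: vect "free_module (carrier G)" by (rule vect_free_module)
  show "abelian_group (group_ring G)"
  proof (rule abelian_groupI)
    fix x assume "x \<in> carrier (group_ring G)"
    then show "\<exists>y\<in>carrier (group_ring G). y \<oplus>\<^bsub>group_ring G\<^esub> x = \<zero>\<^bsub>group_ring G\<^esub>"
      by (intro bexI[of _ "- x"]) auto
  qed (auto simp: algebra_simps dest!: subsetD[OF Poly_Mapping.keys_add])
qed (auto simp: pm.scale_left_distrib pm.scale_right_distrib dest!: subsetD[OF keys_scale_pm])

lemma group_ring_mult_eq:
  assumes "finite S" "finite T" "Poly_Mapping.keys x \<subseteq> S" "Poly_Mapping.keys y \<subseteq> T"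
  shows "x \<otimes>\<^bsub>group_ring G\<^esub> y = (\<Sum>g\<in>S. \<Sum>h\<in>T.
    Poly_Mapping.single (g \<otimes>\<^bsub>G\<^esub> h) (Poly_Mapping.lookup x g * Poly_Mapping.lookup y h))"
proof -
  have "(\<Sum>h\<in>Poly_Mapping.keys y. Poly_Mapping.single (g \<otimes>\<^bsub>G\<^esub> h) (Poly_Mapping.lookup x g * Poly_Mapping.lookup y h))
      = (\<Sum>h\<in>T. Poly_Mapping.single (g \<otimes>\<^bsub>G\<^esub> h) (Poly_Mapping.lookup x g * Poly_Mapping.lookup y h))" for g
    using assms by (intro sum.mono_neutral_left) (auto simp: in_keys_iff)
  moreover have "(\<Sum>g\<in>Poly_Mapping.keys x. \<Sum>h\<in>T. Poly_Mapping.single (g \<otimes>\<^bsub>G\<^esub> h) (Poly_Mapping.lookup x g * Poly_Mapping.lookup y h))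
      = (\<Sum>g\<in>S. \<Sum>h\<in>T. Poly_Mapping.single (g \<otimes>\<^bsub>G\<^esub> h) (Poly_Mapping.lookup x g * Poly_Mapping.lookup y h))"
    using assms by (intro sum.mono_neutral_left) (auto simp: in_keys_iff)
  ultimately show ?thesis by (simp add: group_ring_def)
qed

lemma bilinear_mult_group_ring:
  fixes G :: "('g, 'm) monoid_scheme"
  assumes "group G"
  shows "bilinear_mult (group_ring G :: ('k::field, 'g \<Rightarrow>\<^sub>0 'k) module)"
proof -
  interpret group G by fact
  have closed: "x \<otimes>\<^bsub>group_ring G\<^esub> y \<in> carrier (group_ring G)"
    if "x \<in> carrier (group_ring G)" "y \<in> carrier (group_ring G)" for x y :: "'g \<Rightarrow>\<^sub>0 'k"
  proof -
    have "(\<Sum>g\<in>Poly_Mapping.keys x. \<Sum>h\<in>Poly_Mapping.keys y.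
        Poly_Mapping.single (g \<otimes>\<^bsub>G\<^esub> h) (Poly_Mapping.lookup x g * Poly_Mapping.lookup y h))
      \<in> {z. Poly_Mapping.keys z \<subseteq> carrier G}"
      using that by (intro CollectI order.trans[OF Poly_Mapping.keys_sum] UN_least) auto
    then show ?thesis by (simp add: group_ring_def)
  qed
  have addl: "(x + x') \<otimes>\<^bsub>group_ring G\<^esub> y = x \<otimes>\<^bsub>group_ring G\<^esub> y + x' \<otimes>\<^bsub>group_ring G\<^esub> y"
    for x x' y :: "'g \<Rightarrow>\<^sub>0 'k"
    using Poly_Mapping.keys_add[of x x']
    by (simp add: group_ring_mult_eq[of "Poly_Mapping.keys x \<union> Poly_Mapping.keys x'" "Poly_Mapping.keys y"]
        lookup_add algebra_simps single_add sum.distrib)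
  have addr: "x \<otimes>\<^bsub>group_ring G\<^esub> (y + y') = x \<otimes>\<^bsub>group_ring G\<^esub> y + x \<otimes>\<^bsub>group_ring G\<^esub> y'"
    for x y y' :: "'g \<Rightarrow>\<^sub>0 'k"
    using Poly_Mapping.keys_add[of y y']
    by (simp add: group_ring_mult_eq[of "Poly_Mapping.keys x" "Poly_Mapping.keys y \<union> Poly_Mapping.keys y'"]
        lookup_add algebra_simps single_add sum.distrib)
  have scale: "scale_pm c x \<otimes>\<^bsub>group_ring G\<^esub> y = scale_pm c (x \<otimes>\<^bsub>group_ring G\<^esub> y)"
    "x \<otimes>\<^bsub>group_ring G\<^esub> scale_pm c y = scale_pm c (x \<otimes>\<^bsub>group_ring G\<^esub> y)" for c and x y :: "'g \<Rightarrow>\<^sub>0 'k"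
    using keys_scale_pm[of c x] keys_scale_pm[of c y]
    by (simp_all add: group_ring_mult_eq[of "Poly_Mapping.keys x" "Poly_Mapping.keys y"]
        pm.scale_sum_right mult.assoc mult.left_commute)
  show ?thesis
    unfolding bilinear_mult_def
    by (intro conjI ballI linear_mapsI) (use closed in \<open>simp_all add: addl addr scale\<close>)
qed


section \<open>Linearity of the differentials and of the chain maps\<close>

text \<open>Each summand of the differential depends on a letter through one slot of a tensor only, in which
  the letter stands alone or inside a commutator.\<close>

lemma leibniz_multilinear:
  fixes R :: "('k::field, 'r) module"
  assumes R: "vect R" and b: "bilinear_mult R"
  shows "multilinear R (CL R (n - 1)) n (\<lambda>xs. \<Oplus>\<^bsub>CL R (n - 1)\<^esub> j \<in> {0..<n}. \<Oplus>\<^bsub>CL R (n - 1)\<^esub> i \<in> {0..<j}.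
        (- 1) ^ (j + 1) \<odot>\<^bsub>CL R (n - 1)\<^esub>
          tensor R (remove_nth j (xs[i := commutator R (xs ! i) (xs ! j)])))"
proof -
  have V: "vect (CL R (n - 1))" unfolding CL_def by (rule vect_tensor_power[OF R])
  show ?thesis
  proof (intro multilinear_finsum[OF V R] multilinear_smult[OF V])
    fix j i assume "j \<in> {0..<n}" "i \<in> {0..<j}"
    then have ij: "i < j" "j < n" by auto
    let ?T = "\<lambda>xs. remove_nth j (xs[i := commutator R (xs ! i) (xs ! j)])"
    have comm: "commutator R (xs ! i) (xs ! j) \<in> carrier R" if "xs \<in> words R n" for xs
      using ij words_nth[OF that] by (intro commutator_closed[OF R b]) auto
    show "multilinear R (CL R (n - 1)) n (\<lambda>xs. tensor R (?T xs))"
    proof (rule multilinear_substitute[OF _ _ _ R])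
      show "multilinear R (CL R (n - 1)) (n - 1) (tensor R)"
        unfolding CL_def by (rule tensor_multilinear[OF R])
      show T: "?T xs \<in> words R (n - 1)" if "xs \<in> words R n" for xs
        using words_update[OF that comm[OF that], of i] ij
          set_remove_nth[of j "xs[i := commutator R (xs ! i) (xs ! j)]"] by (auto simp: length_remove_nth)
      fix xs p assume xs: "xs \<in> words R n" and p: "p < n"
      have len: "length xs = n" using xs by simp
      consider "p = i" | "p = j" | "p < j" "p \<noteq> i" | "j < p" using ij by linarith
      then show "\<exists>q<n - 1. \<exists>ws\<in>words R (n - 1). \<exists>L\<in>linear_maps R R. \<forall>x\<in>carrier R. ?T (xs[p := x]) = ws[q := L x]"
      proof cases
        case 1
        have "?T (xs[p := x]) = (?T xs)[i := commutator R x (xs ! j)]" for x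
          using ij len 1 by (intro nth_equalityI) (auto simp: length_remove_nth nth_remove_nth nth_list_update)
        then show ?thesis
          using commutator_linear(1)[OF R b words_nth[OF xs ij(2)]] T[OF xs] ij
          by (intro exI[of _ i] conjI bexI[of _ "?T xs"]) auto
      next
        case 2
        have "?T (xs[p := x]) = (?T xs)[i := commutator R (xs ! i) x]" for x
          using ij len 2 by (intro nth_equalityI) (auto simp: length_remove_nth nth_remove_nth nth_list_update)
        then show ?thesis
          using commutator_linear(2)[OF R b words_nth[OF xs, of i]] T[OF xs] ij
          by (intro exI[of _ i] conjI bexI[of _ "?T xs"]) auto
      next
        case 3
        have "?T (xs[p := x]) = (?T xs)[p := x]" for x
          using ij len 3 by (intro nth_equalityI) (auto simp: length_remove_nth nth_remove_nth nth_list_update)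
        then show ?thesis
          using T[OF xs] ij 3
          by (intro exI[of _ p] conjI bexI[of _ "?T xs"] bexI[of _ "\<lambda>x. x"] linear_mapsI) auto
      next
        case 4
        have "?T (xs[p := x]) = (?T xs)[p - 1 := x]" for x
          using ij len 4 p by (intro nth_equalityI) (auto simp: length_remove_nth nth_remove_nth nth_list_update)
        then show ?thesis
          using T[OF xs] ij 4 p
          by (intro exI[of _ "p - 1"] conjI bexI[of _ "?T xs"] bexI[of _ "\<lambda>x. x"] linear_mapsI) auto
      qed
    qed
  qed
qed

lemma antisymmetrize_multilinear:
  assumes R: "vect R"
  shows "multilinear R (CHH R n) (n + 1) (\<lambda>xs. \<Oplus>\<^bsub>CHH R n\<^esub> \<sigma> \<in> {\<sigma>. \<sigma> permutes {1..n}}.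
        of_int (sign \<sigma>) \<odot>\<^bsub>CHH R n\<^esub> tensor R (map (\<lambda>p. xs ! (inv_into UNIV \<sigma> p)) [0..<n + 1]))"
proof -
  have V: "vect (CHH R n)" unfolding CHH_def by (rule vect_tensor_power[OF R])
  show ?thesis
  proof (intro multilinear_finsum[OF V R] multilinear_smult[OF V])
    fix \<sigma> assume "\<sigma> \<in> {\<sigma>. \<sigma> permutes {1..n}}"
    then have s: "\<sigma> permutes {0..<n + 1}" by (auto intro: permutes_subset[of \<sigma> "{1..n}"])
    have lt: "\<sigma> p < n + 1 \<longleftrightarrow> p < n + 1" "inv_into UNIV \<sigma> p < n + 1 \<longleftrightarrow> p < n + 1" for p
      using permutes_in_image[OF s, of p] permutes_in_image[OF permutes_inv[OF s], of p] by auto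
    let ?T = "\<lambda>xs. map (\<lambda>p. xs ! (inv_into UNIV \<sigma> p)) [0..<n + 1]"
    show "multilinear R (CHH R n) (n + 1) (\<lambda>xs. tensor R (?T xs))"
    proof (rule multilinear_substitute[OF _ _ _ R])
      show "multilinear R (CHH R n) (n + 1) (tensor R)"
        unfolding CHH_def by (rule tensor_multilinear[OF R])
      show T: "?T xs \<in> words R (n + 1)" if "xs \<in> words R (n + 1)" for xs
        using words_nth[OF that] lt by auto
      fix xs p assume xs: "xs \<in> words R (n + 1)" and p: "p < n + 1"
      have "?T (xs[p := x]) = (?T xs)[\<sigma> p := x]" for x
        using xs p lt permutes_inverses[OF s]
        by (intro nth_equalityI) (auto simp: nth_list_update simp del: upt_Suc)
      then show "\<exists>q<n + 1. \<exists>ws\<in>words R (n + 1). \<exists>L\<in>linear_maps R R. \<forall>x\<in>carrier R. ?T (xs[p := x]) = ws[q := L x]"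
        using T[OF xs] lt p
        by (intro exI[of _ "\<sigma> p"] conjI bexI[of _ "?T xs"] bexI[of _ "\<lambda>x. x"] linear_mapsI) auto
    qed
  qed
qed

text \<open>The trace and the projection to the bar complex sum over finite index sets that depend on the
  argument; on any finitely many arguments they agree with a sum over a fixed, larger set.\<close>

lemma multilinear_eventually:
  assumes "F \<noteq> bot" and multi: "\<forall>\<^sub>F i in F. multilinear R M n (g i)"
    and ev: "\<And>xs. xs \<in> words R n \<Longrightarrow> \<forall>\<^sub>F i in F. f xs = g i xs" and R: "vect R"
  shows "multilinear R M n f"
proof (rule multilinearI)
  interpret R: vect R by (rule R)
  have ex: "\<exists>i. P i" if "\<forall>\<^sub>F i in F. P i" for P
    using eventually_happens[OF that] assms(1) by blast
  show "f xs \<in> carrier M" if xs: "xs \<in> words R n" for xs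
  proof -
    obtain i where i: "multilinear R M n (g i)" "f xs = g i xs"
      using ex[OF eventually_conj[OF multi ev[OF xs]]] by (elim exE conjE) (rule that)
    show ?thesis unfolding i(2) by (rule multilinearD(1)[OF i(1) xs])
  qed
  fix xs p assume xs: "xs \<in> words R n" and p: "p < n"
  note w = words_update[OF xs, of _ p]
  show "(\<lambda>x. f (xs[p := x])) \<in> linear_maps R M"
  proof (rule linear_mapsI)
    fix x assume x: "x \<in> carrier R"
    show "f (xs[p := c \<odot>\<^bsub>R\<^esub> x]) = c \<odot>\<^bsub>M\<^esub> f (xs[p := x])" for c
    proof -
      obtain i where i: "multilinear R M n (g i)" "f (xs[p := x]) = g i (xs[p := x])"
          "f (xs[p := c \<odot>\<^bsub>R\<^esub> x]) = g i (xs[p := c \<odot>\<^bsub>R\<^esub> x])"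
        using ex[OF eventually_conj[OF multi eventually_conj[OF ev[OF w[OF x]] ev[OF w[OF R.smult_mem[OF x, of c]]]]]] by (elim exE conjE) (rule that)
      show ?thesis unfolding i(2,3) by (rule linear_maps_smult[OF multilinearD(2)[OF i(1) xs p] x])
    qed
    show "f (xs[p := x]) \<in> carrier M"
    proof -
      obtain i where i: "multilinear R M n (g i)" "f (xs[p := x]) = g i (xs[p := x])"
        using ex[OF eventually_conj[OF multi ev[OF w[OF x]]]] by (elim exE conjE) (rule that)
      show ?thesis unfolding i(2) by (rule multilinearD(1)[OF i(1) w[OF x]])
    qed
    fix y assume y: "y \<in> carrier R"
    obtain i where i: "multilinear R M n (g i)" "f (xs[p := x]) = g i (xs[p := x])"
        "f (xs[p := y]) = g i (xs[p := y])" "f (xs[p := x \<oplus>\<^bsub>R\<^esub> y]) = g i (xs[p := x \<oplus>\<^bsub>R\<^esub> y])"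
      using ex[OF eventually_conj[OF multi eventually_conj[OF ev[OF w[OF x]]
            eventually_conj[OF ev[OF w[OF y]] ev[OF w[OF R.a_closed[OF x y]]]]]]] by (elim exE conjE) (rule that)
    show "f (xs[p := x \<oplus>\<^bsub>R\<^esub> y]) = f (xs[p := x]) \<oplus>\<^bsub>M\<^esub> f (xs[p := y])"
      unfolding i(2-4) by (rule linear_maps_add[OF multilinearD(2)[OF i(1) xs p] x y])
  qed
qed

lemma tensor_zero_letter:
  assumes R: "vect R" and xs: "xs \<in> words R n" and zero: "\<zero>\<^bsub>R\<^esub> \<in> set xs"
  shows "tensor R xs = \<zero>\<^bsub>tensor_power R n\<^esub>"
proof -
  obtain p where p: "p < n" "xs ! p = \<zero>\<^bsub>R\<^esub>" using xs zero by (auto simp: in_set_conv_nth)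
  have "tensor R (xs[p := \<zero>\<^bsub>R\<^esub>]) = \<zero>\<^bsub>tensor_power R n\<^esub>"
    by (rule linear_maps_zero[OF R vect_tensor_power[OF R] multilinearD(2)[OF tensor_multilinear[OF R] xs p(1)]])
  then show ?thesis using p by (metis list_update_id)
qed

definition cyclic_entries :: "nat \<Rightarrow> (nat \<Rightarrow> nat \<Rightarrow> 'a) list \<Rightarrow> nat list \<Rightarrow> 'a list" where
  "cyclic_entries n Xs is = map (\<lambda>p. (Xs ! p) (is ! p) (is ! ((p + 1) mod (n + 1)))) [0..<n + 1]"

lemma trace_multilinear:
  assumes A: "vect A"
  shows "multilinear (gl A) (CHH A n) (n + 1)
    (\<lambda>Xs. \<Oplus>\<^bsub>CHH A n\<^esub> is \<in> {is. length is = n + 1 \<and> \<zero>\<^bsub>A\<^esub> \<notin> set (cyclic_entries n Xs is)}.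
       tensor A (cyclic_entries n Xs is))"
proof -
  interpret C: vect "CHH A n" unfolding CHH_def by (rule vect_tensor_power[OF A])
  interpret A: vect A by (rule A)
  define I where "I N = {is. set is \<subseteq> {..<N} \<and> length is = n + 1}" for N :: nat
  have finI: "finite (I N)" for N unfolding I_def by (rule finite_lists_length_eq) simp
  have entries: "cyclic_entries n Xs is \<in> words A (n + 1)" if "Xs \<in> words (gl A) (n + 1)" for Xs "is"
    using words_nth[OF that] by (auto simp: cyclic_entries_def carrier_gl_iff)
  show ?thesis
  proof (rule multilinear_eventually[where F = sequentially
        and g = "\<lambda>N Xs. \<Oplus>\<^bsub>CHH A n\<^esub> is \<in> I N. tensor A (cyclic_entries n Xs is)"])
    show "\<forall>\<^sub>F N in sequentially. multilinear (gl A) (CHH A n) (n + 1)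
        (\<lambda>Xs. \<Oplus>\<^bsub>CHH A n\<^esub> is \<in> I N. tensor A (cyclic_entries n Xs is))"
    proof (intro always_eventually allI multilinear_finsum[OF C.vect_axioms vect_gl[OF A]])
      fix N "is" assume "is \<in> I N"
      show "multilinear (gl A) (CHH A n) (n + 1) (\<lambda>Xs. tensor A (cyclic_entries n Xs is))"
      proof (rule multilinear_substitute[OF _ entries _ vect_gl[OF A]])
        show "multilinear A (CHH A n) (n + 1) (tensor A)"
          unfolding CHH_def by (rule tensor_multilinear[OF A])
        fix Xs p assume Xs: "Xs \<in> words (gl A) (n + 1)" and p: "p < n + 1"
        have "cyclic_entries n (Xs[p := X]) is
            = (cyclic_entries n Xs is)[p := X (is ! p) (is ! ((p + 1) mod (n + 1)))]" for X
          using Xs p unfolding cyclic_entries_def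
          by (intro nth_equalityI) (auto simp: nth_list_update simp del: upt_Suc)
        then show "\<exists>q<n + 1. \<exists>ws\<in>words A (n + 1). \<exists>L\<in>linear_maps (gl A) A. \<forall>X\<in>carrier (gl A).
            cyclic_entries n (Xs[p := X]) is = ws[q := L X]"
          using p entries[OF Xs]
          by (intro exI[of _ p] conjI bexI[of _ "cyclic_entries n Xs is"] bexI[OF _ entry_linear[OF A, of "is ! p" "is ! ((p + 1) mod (n + 1))"]]) simp_all
      qed
    qed
    fix Xs assume Xs: "Xs \<in> words (gl A) (n + 1)"
    have "\<forall>\<^sub>F N in sequentially. \<forall>X\<in>set Xs. \<forall>i j. X i j \<noteq> \<zero>\<^bsub>A\<^esub> \<longrightarrow> i < N \<and> j < N"
      using Xs by (intro eventually_ball_finite) (auto simp: carrier_gl_iff subset_iff)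
    then show "\<forall>\<^sub>F N in sequentially.
        (\<Oplus>\<^bsub>CHH A n\<^esub> is \<in> {is. length is = n + 1 \<and> \<zero>\<^bsub>A\<^esub> \<notin> set (cyclic_entries n Xs is)}. tensor A (cyclic_entries n Xs is))
        = (\<Oplus>\<^bsub>CHH A n\<^esub> is \<in> I N. tensor A (cyclic_entries n Xs is))"
    proof eventually_elim
      case (elim N)
      show ?case
      proof (rule C.add.finprod_mono_neutral_cong_left[OF finI])
        show "{is. length is = n + 1 \<and> \<zero>\<^bsub>A\<^esub> \<notin> set (cyclic_entries n Xs is)} \<subseteq> I N"
        proof
          fix "is" assume "is \<in> {is. length is = n + 1 \<and> \<zero>\<^bsub>A\<^esub> \<notin> set (cyclic_entries n Xs is)}"
          then have l: "length is = n + 1" and nz: "\<zero>\<^bsub>A\<^esub> \<notin> set (cyclic_entries n Xs is)" by auto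
          have "is ! p < N" if p: "p < n + 1" for p
          proof -
            have "(Xs ! p) (is ! p) (is ! ((p + 1) mod (n + 1))) \<noteq> \<zero>\<^bsub>A\<^esub>"
            proof
              assume "(Xs ! p) (is ! p) (is ! ((p + 1) mod (n + 1))) = \<zero>\<^bsub>A\<^esub>"
              then have "\<zero>\<^bsub>A\<^esub> \<in> set (cyclic_entries n Xs is)"
                unfolding cyclic_entries_def using p by (auto intro!: image_eqI[of _ _ p] simp del: upt_Suc)
              then show False using nz by simp
            qed
            moreover have "Xs ! p \<in> set Xs" using Xs p by simp
            ultimately show ?thesis using elim by blast
          qed
          then show "is \<in> I N" using l by (auto simp: I_def in_set_conv_nth)
        qed
        show "tensor A (cyclic_entries n Xs is) = \<zero>\<^bsub>CHH A n\<^esub>"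
          if "is \<in> I N - {is. length is = n + 1 \<and> \<zero>\<^bsub>A\<^esub> \<notin> set (cyclic_entries n Xs is)}" for "is"
          unfolding CHH_def using that by (intro tensor_zero_letter[OF A entries[OF Xs]]) (auto simp: I_def)
        show "(\<lambda>is. tensor A (cyclic_entries n Xs is)) \<in> I N \<rightarrow> carrier (CHH A n)"
          unfolding CHH_def using tensor_closed[OF A entries[OF Xs]] by blast
      qed simp
    qed
  qed (use vect_gl[OF A] in simp_all)
qed

lemma coefficient_product_linear:
  assumes "xs \<in> words (group_ring G) (n + 1)" "q < n + 1" "v \<in> carrier M" "vect M"
  shows "(\<lambda>x. (\<Prod>p\<le>n. Poly_Mapping.lookup (xs[q := x] ! p) (gs ! p)) \<odot>\<^bsub>M\<^esub> v) \<in> linear_maps (group_ring G) M"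
proof -
  interpret M: vect M by fact
  define c where "c = (\<Prod>p\<in>{..n} - {q}. Poly_Mapping.lookup (xs ! p) (gs ! p))"
  have "(\<Prod>p\<le>n. Poly_Mapping.lookup (xs[q := x] ! p) (gs ! p)) = Poly_Mapping.lookup x (gs ! q) * c" for x
    using assms unfolding c_def
    by (subst prod.remove[of _ q]) (auto simp: nth_list_update intro!: prod.cong arg_cong2[where f = "(*)"])
  then show ?thesis
    using assms(3) by (intro linear_mapsI) (auto simp: lookup_add algebra_simps M.add_smult simp flip: M.mult_smult)
qed

lemma bar_projection_multilinear:
  "multilinear (group_ring G) (bar G n) (n + 1)
     (\<lambda>as. \<Oplus>\<^bsub>bar G n\<^esub> gs \<in> {gs. length gs = n + 1 \<and> (\<forall>p\<le>n. gs ! p \<in> Poly_Mapping.keys (as ! p))}.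
        (\<Prod>p\<le>n. Poly_Mapping.lookup (as ! p) (gs ! p)) \<odot>\<^bsub>bar G n\<^esub> Poly_Mapping.single (tl gs) 1)"
proof -
  interpret B: vect "bar G n" unfolding bar_def by (rule vect_free_module)
  define I where "I S = {gs. set gs \<subseteq> S \<and> length gs = n + 1}" for S :: "'a set"
  have mem: "Poly_Mapping.single (tl gs) 1 \<in> carrier (bar G n)" if "gs \<in> I S" "S \<subseteq> carrier G" for gs S
    using that by (cases gs) (auto simp: I_def bar_def)
  show ?thesis
  proof (rule multilinear_eventually[where F = "finite_subsets_at_top (carrier G)"
        and g = "\<lambda>S as. \<Oplus>\<^bsub>bar G n\<^esub> gs \<in> I S. (\<Prod>p\<le>n. Poly_Mapping.lookup (as ! p) (gs ! p)) \<odot>\<^bsub>bar G n\<^esub> Poly_Mapping.single (tl gs) 1"])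
    have "multilinear (group_ring G) (bar G n) (n + 1) (\<lambda>as. \<Oplus>\<^bsub>bar G n\<^esub> gs \<in> I S.
        (\<Prod>p\<le>n. Poly_Mapping.lookup (as ! p) (gs ! p)) \<odot>\<^bsub>bar G n\<^esub> Poly_Mapping.single (tl gs) 1)"
      if S: "S \<subseteq> carrier G" for S
    proof (rule multilinear_finsum[OF B.vect_axioms vect_group_ring], rule multilinearI)
      fix gs as assume gs: "gs \<in> I S"
      show "(\<Prod>p\<le>n. Poly_Mapping.lookup (as ! p) (gs ! p)) \<odot>\<^bsub>bar G n\<^esub> Poly_Mapping.single (tl gs) 1 \<in> carrier (bar G n)"
        by (rule B.smult_mem[OF mem[OF gs S]])
      fix q assume "as \<in> words (group_ring G) (n + 1)" "q < n + 1"
      then show "(\<lambda>x. (\<Prod>p\<le>n. Poly_Mapping.lookup (as[q := x] ! p) (gs ! p)) \<odot>\<^bsub>bar G n\<^esub> Poly_Mapping.single (tl gs) 1)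
          \<in> linear_maps (group_ring G) (bar G n)"
        by (rule coefficient_product_linear[OF _ _ mem[OF gs S] B.vect_axioms])
    qed
    then show "\<forall>\<^sub>F S in finite_subsets_at_top (carrier G). multilinear (group_ring G) (bar G n) (n + 1) (\<lambda>as.
        \<Oplus>\<^bsub>bar G n\<^esub> gs \<in> I S. (\<Prod>p\<le>n. Poly_Mapping.lookup (as ! p) (gs ! p)) \<odot>\<^bsub>bar G n\<^esub> Poly_Mapping.single (tl gs) 1)"
      unfolding eventually_finite_subsets_at_top by auto
    fix as assume as: "as \<in> words (group_ring G) (n + 1)"
    let ?K = "\<Union>a\<in>set as. Poly_Mapping.keys a"
    have eq: "(\<Oplus>\<^bsub>bar G n\<^esub> gs \<in> {gs. length gs = n + 1 \<and> (\<forall>p\<le>n. gs ! p \<in> Poly_Mapping.keys (as ! p))}.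
        (\<Prod>p\<le>n. Poly_Mapping.lookup (as ! p) (gs ! p)) \<odot>\<^bsub>bar G n\<^esub> Poly_Mapping.single (tl gs) 1)
      = (\<Oplus>\<^bsub>bar G n\<^esub> gs \<in> I S. (\<Prod>p\<le>n. Poly_Mapping.lookup (as ! p) (gs ! p)) \<odot>\<^bsub>bar G n\<^esub> Poly_Mapping.single (tl gs) 1)"
      if S: "finite S" "?K \<subseteq> S" "S \<subseteq> carrier G" for S
    proof (rule B.add.finprod_mono_neutral_cong_left)
      show "finite (I S)" unfolding I_def by (rule finite_lists_length_eq[OF S(1)])
      show "{gs. length gs = n + 1 \<and> (\<forall>p\<le>n. gs ! p \<in> Poly_Mapping.keys (as ! p))} \<subseteq> I S"
      proof
        fix gs assume "gs \<in> {gs. length gs = n + 1 \<and> (\<forall>p\<le>n. gs ! p \<in> Poly_Mapping.keys (as ! p))}"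
        then have len: "length gs = n + 1" and gs: "\<And>p. p \<le> n \<Longrightarrow> gs ! p \<in> Poly_Mapping.keys (as ! p)"
          by simp_all
        have "as ! p \<in> set as" if "p \<le> n" for p using that as by simp
        then have "gs ! p \<in> ?K" if "p < n + 1" for p
          using that gs[of p] by (intro UN_I[of "as ! p"]) simp_all
        then have "gs ! p \<in> S" if "p < n + 1" for p using that S(2) by blast
        then show "gs \<in> I S" using len by (auto simp: I_def in_set_conv_nth)
      qed
      show "(\<lambda>gs. (\<Prod>p\<le>n. Poly_Mapping.lookup (as ! p) (gs ! p)) \<odot>\<^bsub>bar G n\<^esub> Poly_Mapping.single (tl gs) 1)
          \<in> I S \<rightarrow> carrier (bar G n)"
        using mem[OF _ S(3)] by (intro Pi_I B.smult_mem)
      fix gs assume "gs \<in> I S - {gs. length gs = n + 1 \<and> (\<forall>p\<le>n. gs ! p \<in> Poly_Mapping.keys (as ! p))}"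
      then have gs: "gs \<in> I S" and "\<exists>p\<le>n. Poly_Mapping.lookup (as ! p) (gs ! p) = 0"
        by (auto simp: I_def in_keys_iff)
      then have "(\<Prod>p\<le>n. Poly_Mapping.lookup (as ! p) (gs ! p)) = 0" by (auto simp: prod_zero_iff)
      then show "(\<Prod>p\<le>n. Poly_Mapping.lookup (as ! p) (gs ! p)) \<odot>\<^bsub>bar G n\<^esub> Poly_Mapping.single (tl gs) 1 = \<zero>\<^bsub>bar G n\<^esub>"
        by (simp only: B.zero_smult mem[OF gs S(3)])
    qed simp
    have K: "finite ?K" "?K \<subseteq> carrier G" using as by auto
    show "\<forall>\<^sub>F S in finite_subsets_at_top (carrier G).
        (\<Oplus>\<^bsub>bar G n\<^esub> gs \<in> {gs. length gs = n + 1 \<and> (\<forall>p\<le>n. gs ! p \<in> Poly_Mapping.keys (as ! p))}.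
        (\<Prod>p\<le>n. Poly_Mapping.lookup (as ! p) (gs ! p)) \<odot>\<^bsub>bar G n\<^esub> Poly_Mapping.single (tl gs) 1)
      = (\<Oplus>\<^bsub>bar G n\<^esub> gs \<in> I S. (\<Prod>p\<le>n. Poly_Mapping.lookup (as ! p) (gs ! p)) \<odot>\<^bsub>bar G n\<^esub> Poly_Mapping.single (tl gs) 1)"
      unfolding eventually_finite_subsets_at_top
      by (intro exI[of _ ?K] conjI K allI impI, elim conjE) (rule eq)
  qed (use vect_group_ring in simp_all)
qed

lemma vect_bar: "vect (bar G n)"
  unfolding bar_def by (rule vect_free_module)

lemma bar_simps [simp]:
  "carrier (bar G n) = {x. Poly_Mapping.keys x \<subseteq> {gs. length gs = n \<and> set gs \<subseteq> carrier G}}"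
  "zero (bar G n) = 0" "add (bar G n) = (+)" "smult (bar G n) = scale_pm"
  by (simp_all add: bar_def)


section \<open>The composite on elementary matrices\<close>

definition unit_matrix :: "nat \<times> nat \<times> 'g \<Rightarrow> nat \<Rightarrow> nat \<Rightarrow> ('g \<Rightarrow>\<^sub>0 'k::field)" where
  "unit_matrix = (\<lambda>(i, j, g) p q. if p = i \<and> q = j then Poly_Mapping.single g 1 else 0)"

definition triples :: "('g, 'm) monoid_scheme \<Rightarrow> (nat \<times> nat \<times> 'g) set" where
  "triples G = UNIV \<times> UNIV \<times> carrier G"

definition triple_mult :: "('g, 'm) monoid_scheme \<Rightarrow> nat \<times> nat \<times> 'g \<Rightarrow> nat \<times> nat \<times> 'g \<Rightarrow> nat \<times> nat \<times> 'g" where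
  "triple_mult G = (\<lambda>(i, _, g) (_, l, h). (i, l, g \<otimes>\<^bsub>G\<^esub> h))"

definition row :: "nat \<times> nat \<times> 'g \<Rightarrow> nat" where "row w = fst w"
definition col :: "nat \<times> nat \<times> 'g \<Rightarrow> nat" where "col w = fst (snd w)"
definition label :: "nat \<times> nat \<times> 'g \<Rightarrow> 'g" where "label w = snd (snd w)"

lemma triple_mult_simps [simp]:
  "row (triple_mult G v w) = row v" "col (triple_mult G v w) = col w"
  "label (triple_mult G v w) = label v \<otimes>\<^bsub>G\<^esub> label w"
  by (auto simp: triple_mult_def row_def col_def label_def split: prod.splits)

text \<open>The words of elementary matrices whose trace does not vanish.\<close>

definition closed_word :: "(nat \<times> nat \<times> 'g) list \<Rightarrow> bool" where
  "closed_word ws \<longleftrightarrow> (\<forall>p<length ws. col (ws ! p) = row (ws ! (Suc p mod length ws)))"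

lemma in_triples_iff: "w \<in> triples G \<longleftrightarrow> label w \<in> carrier G"
  by (cases w) (auto simp: triples_def label_def)

text \<open>A face multiplies the letters at places \<open>k\<close> and \<open>k + 1\<close> (cyclically) and so hides exactly one of
  the matching conditions.\<close>

lemma closed_word_face:
  assumes n: "length ws = Suc n" "1 \<le> n" and k: "k \<le> n"
  shows "closed_word ws \<longleftrightarrow> col (ws ! k) = row (ws ! (Suc k mod Suc n)) \<and>
    closed_word (hochschild_face (triple_mult G) k ws)"
proof -
  let ?v = "hochschild_face (triple_mult G) k ws"
  have len: "length ?v = n" using n k by simp
  have nth: "?v ! q = (if k < n then (if q < k then ws ! q else if q = k then triple_mult G (ws ! k) (ws ! Suc k) else ws ! Suc q)
      else if q = 0 then triple_mult G (ws ! k) (ws ! 0) else ws ! q)" if "q < n" for q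
    using nth_hochschild_face[of ws k q "triple_mult G"] n k that by simp
  show ?thesis
  proof (cases "k < n")
    case True
    have row: "row (?v ! q) = row (ws ! (if q \<le> k then q else Suc q))" if "q < n" for q
      using nth[OF that] True by auto
    have col: "col (?v ! q) = col (ws ! (if q < k then q else Suc q))" if "q < n" for q
      using nth[OF that] True by auto
    have step: "col (?v ! q) = row (?v ! (Suc q mod n)) \<longleftrightarrow>
        col (ws ! (if q < k then q else Suc q)) = row (ws ! (Suc (if q < k then q else Suc q) mod Suc n))"
      if q: "q < n" for q
    proof (cases "Suc q = n")
      case True
      then show ?thesis using \<open>k < n\<close> col[OF q] row[of 0] n by auto
    next
      case False
      then show ?thesis using q \<open>k < n\<close> col[OF q] row[of "Suc q"] by auto
    qed
    have "(\<forall>p<Suc n. P p) \<longleftrightarrow> P k \<and> (\<forall>q<n. P (if q < k then q else Suc q))" for P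
    proof (intro iffI conjI allI impI)
      fix p assume *: "P k \<and> (\<forall>q<n. P (if q < k then q else Suc q))" and p: "p < Suc n"
      show "P p"
      proof (cases rule: linorder_cases[of p k])
        case less
        then have "P (if p < k then p else Suc p)" using * True by (meson less_trans)
        then show ?thesis using less by simp
      next
        case greater
        then obtain r where "p = Suc r" "k \<le> r" by (cases p) auto
        then show ?thesis using *[THEN conjunct2, rule_format, of r] p by simp
      qed (use * in auto)
    qed (use True in auto)
    then show ?thesis
      unfolding closed_word_def len n(1) using step by simp
  next
    case False
    then have kn: "k = n" using k by simp
    have row: "row (?v ! q) = row (ws ! (if q = 0 then n else q))" if "q < n" for q
      using nth[OF that] kn by auto
    have col: "col (?v ! q) = col (ws ! q)" if "q < n" for q
      using nth[OF that] kn by auto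
    have step: "col (?v ! q) = row (?v ! (Suc q mod n)) \<longleftrightarrow> col (ws ! q) = row (ws ! (Suc q mod Suc n))"
      if q: "q < n" for q
    proof (cases "Suc q = n")
      case True
      then show ?thesis using col[OF q] row[of 0] n by auto
    next
      case False
      then show ?thesis using q col[OF q] row[of "Suc q"] by auto
    qed
    then show ?thesis
      unfolding closed_word_def len n(1) using kn by (auto simp: less_Suc_eq)
  qed
qed

text \<open>Forgetting the first letter turns the Hochschild faces into the faces of the bar complex; the
  product with \<open>g\<^sub>0\<close> is forgotten in the two outer faces.\<close>

lemma tl_hochschild_face:
  assumes n: "length gs = Suc n" "1 \<le> n" and k: "k \<le> n"
  shows "tl (hochschild_face (monoid.mult G) k gs) = bar_face G n k (tl gs)"
proof (rule nth_equalityI)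
  obtain g hs where gs: "gs = g # hs" "length hs = n" using n by (cases gs) auto
  show len: "length (tl (hochschild_face (monoid.mult G) k gs)) = length (bar_face G n k (tl gs))"
    using n k gs by (auto simp: bar_face_def)
  fix q assume "q < length (tl (hochschild_face (monoid.mult G) k gs))"
  then have q: "Suc q < n" using n k by simp
  have "tl (hochschild_face (monoid.mult G) k gs) ! q = hochschild_face (monoid.mult G) k gs ! Suc q"
    using q n k by (subst nth_tl) auto
  also have "\<dots> = bar_face G n k (tl gs) ! q"
    using q n k gs
    by (subst nth_hochschild_face) (auto simp: bar_face_def nth_append nth_tl nth_butlast nth_Cons' min_def)
  finally show "tl (hochschild_face (monoid.mult G) k gs) ! q = bar_face G n k (tl gs) ! q" .
qed

lemma finsum_group_ring:
  assumes "\<And>a. a \<in> I \<Longrightarrow> Poly_Mapping.keys (h a) \<subseteq> carrier G"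
  shows "(\<Oplus>\<^bsub>group_ring G\<^esub>a\<in>I. h a) = (\<Sum>a\<in>I. h a)"
proof -
  interpret vect "group_ring G" by (rule vect_group_ring)
  show ?thesis using assms
    by (induction I rule: infinite_finite_induct) (simp_all add: Pi_def)
qed

lemma multilinear_cong:
  assumes "vect R" "\<And>xs. xs \<in> words R n \<Longrightarrow> f xs = g xs"
  shows "multilinear R M n f \<longleftrightarrow> multilinear R M n g"
proof -
  have "(\<lambda>x. f (xs[p := x])) \<in> linear_maps R M \<longleftrightarrow> (\<lambda>x. g (xs[p := x])) \<in> linear_maps R M"
    if "xs \<in> words R n" for xs p
    using assms(2) words_update[OF that] by (intro linear_maps_cong[OF assms(1)]) blast
  then show ?thesis
    unfolding multilinear_def using assms(2) by (metis (no_types, lifting))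
qed

lemma bar_face_closed:
  assumes "group G" "length gs = n" "set gs \<subseteq> carrier G" "i \<le> n" "1 \<le> n"
  shows "length (bar_face G n i gs) = n - 1 \<and> set (bar_face G n i gs) \<subseteq> carrier G"
proof -
  interpret group G by fact
  have "set (tl gs) \<subseteq> set gs" "set (butlast gs) \<subseteq> set gs"
    by (auto dest: in_set_butlastD list.set_sel(2)[rotated])
      (metis list.set_sel(2) tl_Nil empty_iff empty_set)+
  moreover have "gs ! (i - 1) \<in> carrier G" "i < n \<Longrightarrow> gs ! i \<in> carrier G" if "i \<noteq> 0"
    using assms that nth_mem[of "i - 1" gs] nth_mem[of i gs] by auto
  ultimately show ?thesis
    using assms by (auto simp: bar_face_def dest: in_set_takeD in_set_dropD)
qed

lemma bar_diff_inner:
  assumes "group G" "length gs = Suc n" "set gs \<subseteq> carrier G"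
  shows "(\<Oplus>\<^bsub>bar G n\<^esub> i \<in> {0..Suc n}. (- 1) ^ i \<odot>\<^bsub>bar G n\<^esub> Poly_Mapping.single (bar_face G (Suc n) i gs) 1)
    = (\<Sum>i\<le>Suc n. signed i (Poly_Mapping.single (bar_face G (Suc n) i gs) (1 :: 'k::field)))"
    (is "?L = ?R")
    and "(\<Oplus>\<^bsub>bar G n\<^esub> i \<in> {0..Suc n}. (- 1) ^ i \<odot>\<^bsub>bar G n\<^esub> Poly_Mapping.single (bar_face G (Suc n) i gs) 1)
      \<in> carrier (bar G n :: ('k::field, _) module)"
proof -
  interpret B: vect "bar G n" by (rule vect_bar)
  have mem: "(- 1) ^ i \<odot>\<^bsub>bar G n\<^esub> Poly_Mapping.single (bar_face G (Suc n) i gs) 1 \<in> carrier (bar G n)"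
    if "i \<in> {0..Suc n}" for i
    using bar_face_closed[OF assms, of i] that by (intro B.smult_mem) auto
  show "?L \<in> carrier (bar G n)" using mem by (intro B.finsum_closed) blast
  have "?L = (\<Sum>i\<in>{0..Suc n}. signed i (Poly_Mapping.single (bar_face G (Suc n) i gs) 1))"
    unfolding bar_def using mem by (subst finsum_free_module) (auto simp: bar_def)
  then show "?L = ?R" by (simp only: atLeast0AtMost)
qed

lemma bar_diff_linear:
  assumes "group G"
  shows "bar_diff G (Suc n) \<in> linear_maps (bar G (Suc n)) (bar G n)"
proof -
  have "bar_diff G (Suc n) \<in> linear_maps (free_module {gs. length gs = Suc n \<and> set gs \<subseteq> carrier G}) (bar G n)"
    unfolding bar_diff_def diff_Suc_1
    using bar_diff_inner(2)[OF assms] by (intro linear_extension_linear[OF vect_bar]) auto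
  then show ?thesis unfolding bar_def[of G "Suc n"] .
qed

lemma bar_diff_single:
  assumes "group G" "length gs = Suc n" "set gs \<subseteq> carrier G"
  shows "bar_diff G (Suc n) (Poly_Mapping.single gs 1)
    = (\<Sum>i\<le>Suc n. signed i (Poly_Mapping.single (bar_face G (Suc n) i gs) 1))"
  unfolding bar_diff_def diff_Suc_1
  by (subst linear_extension_single[OF vect_bar]) (use bar_diff_inner[OF assms] in auto)

text \<open>The algebra \<open>A = k[G]\<close> is a parameter of its own, which fixes the field \<open>k\<close>.\<close>

locale group_algebra = group G for G :: "('g, 'm) monoid_scheme" +
  fixes A :: "('k::field, 'g \<Rightarrow>\<^sub>0 'k) module"
  assumes A_def: "A = group_ring G"
begin

abbreviation "R \<equiv> gl A"
abbreviation E :: "nat \<times> nat \<times> 'g \<Rightarrow> nat \<Rightarrow> nat \<Rightarrow> ('g \<Rightarrow>\<^sub>0 'k)" where "E \<equiv> unit_matrix"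

lemma vect_A: "vect A" unfolding A_def by (rule vect_group_ring)
lemma vect_R: "vect R" by (rule vect_gl[OF vect_A])
lemma bilinear_R: "bilinear_mult R"
  unfolding A_def by (rule bilinear_mult_gl[OF vect_group_ring bilinear_mult_group_ring[OF is_group]])
lemma vect_CL: "vect (CL R n)" unfolding CL_def by (rule vect_tensor_power[OF vect_R])
lemma vect_CHH: "vect (CHH R n)" "vect (CHH A n)"
  unfolding CHH_def by (rule vect_tensor_power[OF vect_R] vect_tensor_power[OF vect_A])+

lemma leibniz_diff_linear: "leibniz_diff R n \<in> linear_maps (CL R n) (CL R (n - 1))"
  using tensor_lift_linear[OF vect_R vect_CL leibniz_multilinear[OF vect_R bilinear_R]]
  unfolding leibniz_diff_def CL_def .

lemma leibniz_diff_tensor: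
  "xs \<in> words R n \<Longrightarrow> leibniz_diff R n (tensor R xs) =
     (\<Oplus>\<^bsub>CL R (n - 1)\<^esub> j \<in> {0..<n}. \<Oplus>\<^bsub>CL R (n - 1)\<^esub> i \<in> {0..<j}.
        (- 1) ^ (j + 1) \<odot>\<^bsub>CL R (n - 1)\<^esub> tensor R (remove_nth j (xs[i := commutator R (xs ! i) (xs ! j)])))"
  unfolding leibniz_diff_def
  by (rule tensor_lift_tensor[OF vect_R vect_CL leibniz_multilinear[OF vect_R bilinear_R]])

lemma antisymmetrize_linear: "antisymmetrize R n \<in> linear_maps (CL R (Suc n)) (CHH R n)"
  using tensor_lift_linear[OF vect_R vect_CHH(1) antisymmetrize_multilinear[OF vect_R]]
  unfolding antisymmetrize_def CL_def Suc_eq_plus1 .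

lemma trace_map_linear: "trace_map A n \<in> linear_maps (CHH R n) (CHH A n)"
  using tensor_lift_linear[OF vect_R vect_CHH(2) trace_multilinear[OF vect_A]]
  unfolding trace_map_def CHH_def Let_def cyclic_entries_def .

lemma bar_projection_linear: "bar_projection G n \<in> linear_maps (CHH A n) (bar G n)"
  using tensor_lift_linear[OF vect_A vect_bar bar_projection_multilinear[where G = G and ?'b = 'k, folded A_def]]
  unfolding bar_projection_def CHH_def .

lemma gl_to_bar_linear: "gl_to_bar G n \<in> linear_maps (CL R (Suc n)) (bar G n)"
  using linear_maps_comp[OF antisymmetrize_linear linear_maps_comp[OF trace_map_linear bar_projection_linear]]
  unfolding gl_to_bar_def comp_def A_def .

definition trace_bar :: "(nat \<Rightarrow> nat \<Rightarrow> 'g \<Rightarrow>\<^sub>0 'k) list \<Rightarrow> ('g list \<Rightarrow>\<^sub>0 'k)" where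
  "trace_bar xs = bar_projection G (length xs - 1) (trace_map A (length xs - 1) (tensor R xs))"

lemma trace_bar_multilinear: "multilinear R (bar G n) (Suc n) trace_bar"
proof -
  have "multilinear R (bar G n) (Suc n) (\<lambda>xs. bar_projection G n (trace_map A n (tensor R xs)))"
    using multilinear_linear_comp[OF tensor_multilinear[OF vect_R]
        linear_maps_comp[OF trace_map_linear[unfolded CHH_def[of R]] bar_projection_linear]] by simp
  then show ?thesis
    by (rule iffD1[OF multilinear_cong[OF vect_R], rotated]) (auto simp: trace_bar_def)
qed

lemma trace_bar_bracket: "bracket_additive (carrier R) (monoid.mult R) (commutator R) trace_bar"
  unfolding bracket_additive_def
proof (intro allI impI)
  fix w q x y assume w: "set w \<subseteq> carrier R" "q < length w" and x: "x \<in> carrier R" and y: "y \<in> carrier R"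
  define n where "n = length w - 1"
  have wn: "w \<in> words R (Suc n)" and q: "q < Suc n" using w by (auto simp: n_def)
  interpret B: vect "bar G n" by (rule vect_bar)
  note lin = multilinearD(2)[OF trace_bar_multilinear wn q]
  note xy = bilinear_multD(3)[OF bilinear_R x y] bilinear_multD(3)[OF bilinear_R y x]
  show "trace_bar (w[q := commutator R x y]) = trace_bar (w[q := x \<otimes>\<^bsub>R\<^esub> y]) - trace_bar (w[q := y \<otimes>\<^bsub>R\<^esub> x])"
    using linear_maps_minus[OF vect_R vect_bar lin xy] linear_maps_closed[OF lin xy(1)] linear_maps_closed[OF lin xy(2)]
    by (simp add: commutator_def B.minus_combination del: bar_simps(1))
qed

lemma gl_to_bar_tensor:
  assumes "xs \<in> words R (Suc n)"
  shows "gl_to_bar G n (tensor R xs) = alternation trace_bar xs"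
proof -
  have xs: "xs \<in> words R (n + 1)" and len: "length xs = Suc n" using assms by auto
  let ?P = "\<lambda>x. bar_projection G n (trace_map A n x)"
  have P: "?P \<in> linear_maps (CHH R n) (bar G n)"
    by (rule linear_maps_comp[OF trace_map_linear bar_projection_linear])
  interpret C: vect "CHH R n" by (rule vect_CHH)
  have w: "permuted_word xs \<sigma> \<in> words R (n + 1)" if "\<sigma> permutes {1..n}" for \<sigma>
    using permuted_word_mem[OF that assms] by simp
  have mem: "tensor R (permuted_word xs \<sigma>) \<in> carrier (CHH R n)" if "\<sigma> permutes {1..n}" for \<sigma>
    unfolding CHH_def by (rule tensor_closed[OF vect_R w[OF that]])
  have "gl_to_bar G n (tensor R xs) = ?P (antisymmetrize R n (tensor R xs))"
    by (simp add: gl_to_bar_def A_def)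
  also have "antisymmetrize R n (tensor R xs) = (\<Oplus>\<^bsub>CHH R n\<^esub> \<sigma> \<in> {\<sigma>. \<sigma> permutes {1..n}}.
      of_int (sign \<sigma>) \<odot>\<^bsub>CHH R n\<^esub> tensor R (permuted_word xs \<sigma>))"
    unfolding antisymmetrize_def permuted_word_def len Suc_eq_plus1
    by (rule tensor_lift_tensor[OF vect_R vect_CHH(1) antisymmetrize_multilinear[OF vect_R] xs])
  also have "?P \<dots> = (\<Oplus>\<^bsub>bar G n\<^esub> \<sigma> \<in> {\<sigma>. \<sigma> permutes {1..n}}.
      ?P (of_int (sign \<sigma>) \<odot>\<^bsub>CHH R n\<^esub> tensor R (permuted_word xs \<sigma>)))"
    using mem by (intro linear_maps_finsum[OF vect_CHH(1) vect_bar P]) auto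
  also have "\<dots> = (\<Sum>\<sigma> | \<sigma> permutes {1..n}. ?P (of_int (sign \<sigma>) \<odot>\<^bsub>CHH R n\<^esub> tensor R (permuted_word xs \<sigma>)))"
    unfolding bar_def
    by (intro finsum_free_module) (use linear_maps_closed[OF P C.smult_mem[OF mem]] in \<open>auto simp: bar_def\<close>)
  also have "\<dots> = (\<Sum>\<sigma> | \<sigma> permutes {1..n}. scale_pm (of_int (sign \<sigma>)) (trace_bar (permuted_word xs \<sigma>)))"
    by (intro sum.cong refl)
      (use linear_maps_smult[OF P mem] in \<open>simp add: trace_bar_def len\<close>)
  also have "\<dots> = alternation trace_bar xs" by (rule sum_permutations_eq_alternation[OF len])
  finally show ?thesis .
qed

lemma unit_matrix_closed: "w \<in> triples G \<Longrightarrow> E w \<in> carrier R"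
  by (cases w, rule carrier_glI[of _ _ "Suc (max (row w) (col w))"])
    (auto simp: A_def unit_matrix_def triples_def row_def col_def split: if_splits)

lemma unit_words: "length ws = n \<Longrightarrow> set ws \<subseteq> triples G \<Longrightarrow> map E ws \<in> words R n"
  using unit_matrix_closed by auto

lemma single_one_nonzero [simp]: "Poly_Mapping.single g (1 :: 'k) \<noteq> 0"
  by (metis lookup_single_eq lookup_zero zero_neq_one)

lemma unit_matrix_mult:
  assumes "v \<in> triples G" "w \<in> triples G"
  shows "E v \<otimes>\<^bsub>R\<^esub> E w = (if col v = row w then E (triple_mult G v w) else \<zero>\<^bsub>R\<^esub>)"
proof (intro ext)
  fix p q
  interpret A: vect A by (rule vect_A)
  obtain i j g where v: "v = (i, j, g)" by (cases v)
  obtain k l h where w: "w = (k, l, h)" by (cases w)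
  have gh: "g \<in> carrier G" "h \<in> carrier G" using assms by (auto simp: v w triples_def)
  have supp: "{r. E v p r \<noteq> \<zero>\<^bsub>A\<^esub>} = (if p = i then {j} else {})"
    by (auto simp: v unit_matrix_def A_def)
  have zero: "x \<otimes>\<^bsub>A\<^esub> 0 = 0" for x
    by (simp add: A_def group_ring_def)
  have prod: "Poly_Mapping.single g 1 \<otimes>\<^bsub>A\<^esub> Poly_Mapping.single h 1 = Poly_Mapping.single (g \<otimes>\<^bsub>G\<^esub> h) 1"
    by (simp add: A_def group_ring_def)
  have "(E v \<otimes>\<^bsub>R\<^esub> E w) p q = (\<Oplus>\<^bsub>A\<^esub>r\<in>(if p = i then {j} else {}). E v p r \<otimes>\<^bsub>A\<^esub> E w r q)"
    by (simp add: gl_def supp)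
  also have "\<dots> = (if p = i then E v p j \<otimes>\<^bsub>A\<^esub> E w j q else 0)"
  proof -
    have "E v p r \<in> carrier A" "E w r q \<in> carrier A" for r
      using gh by (auto simp: v w unit_matrix_def A_def)
    then have "E v p j \<otimes>\<^bsub>A\<^esub> E w j q \<in> carrier A"
      unfolding A_def by (intro bilinear_multD(3)[OF bilinear_mult_group_ring[OF is_group]])
    then have "(\<Oplus>\<^bsub>A\<^esub>r\<in>{j}. E v p r \<otimes>\<^bsub>A\<^esub> E w r q) = E v p j \<otimes>\<^bsub>A\<^esub> E w j q"
      by (rule A.finsum_single)
    moreover have "\<zero>\<^bsub>A\<^esub> = 0" by (simp add: A_def)
    ultimately show ?thesis by (cases "p = i") simp_all
  qed
  also have "\<dots> = (if col v = row w then E (triple_mult G v w) else \<zero>\<^bsub>R\<^esub>) p q"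
    by (auto simp: v w unit_matrix_def zero prod triple_mult_def row_def col_def) (auto simp: A_def)
  finally show "(E v \<otimes>\<^bsub>R\<^esub> E w) p q = (if col v = row w then E (triple_mult G v w) else \<zero>\<^bsub>R\<^esub>) p q" .
qed

lemma lin_span_finsum:
  assumes "vect M" "S \<subseteq> carrier M" "\<And>a. a \<in> I \<Longrightarrow> h a \<in> lin_span M S"
  shows "(\<Oplus>\<^bsub>M\<^esub>a\<in>I. h a) \<in> lin_span M S"
proof -
  interpret vect M by fact
  have "lin_span M S \<subseteq> carrier M"
  proof
    fix x assume "x \<in> lin_span M S"
    then show "x \<in> carrier M" by induction (use assms(2) in auto)
  qed
  then show ?thesis using assms(3)
    by (induction I rule: infinite_finite_induct)
      (simp_all add: Pi_def subset_iff lin_span_zero lin_span_add)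
qed

lemma unit_matrices_span: "carrier R \<subseteq> lin_span R (E ` triples G)"
proof
  fix X assume X: "X \<in> carrier R"
  interpret R: vect R by (rule vect_R)
  obtain N where N: "\<And>i j. X i j \<noteq> 0 \<Longrightarrow> i < N \<and> j < N"
    using X[unfolded carrier_gl_iff eventually_sequentially] unfolding A_def group_ring_simps by blast
  define K where "K = (\<Union>i<N. \<Union>j<N. Poly_Mapping.keys (X i j))"
  have K: "finite K" "K \<subseteq> carrier G" using X by (auto simp: K_def carrier_gl_iff A_def)
  define I where "I = {..<N} \<times> {..<N} \<times> K"
  have I: "I \<subseteq> triples G" "finite I" using K by (auto simp: I_def triples_def)
  let ?h = "\<lambda>w. Poly_Mapping.lookup (X (row w) (col w)) (label w) \<odot>\<^bsub>R\<^esub> E w"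
  have mem: "?h w \<in> carrier R" if "w \<in> I" for w
    by (rule R.smult_mem[OF unit_matrix_closed]) (use I that in auto)
  have "X p q = (\<Oplus>\<^bsub>R\<^esub>w\<in>I. ?h w) p q" for p q
  proof -
    have "(\<Oplus>\<^bsub>R\<^esub>w\<in>I. ?h w) p q = (\<Oplus>\<^bsub>A\<^esub>w\<in>I. ?h w p q)"
      using mem by (intro linear_maps_finsum[OF vect_R vect_A entry_linear[OF vect_A]]) auto
    also have "\<dots> = (\<Sum>w\<in>I. ?h w p q)"
    proof -
      have "?h w p q \<in> carrier A" if "w \<in> I" for w
        using mem[OF that] unfolding carrier_gl_iff by blast
      then show ?thesis unfolding A_def by (intro finsum_group_ring) simp
    qed
    also have "\<dots> = (\<Sum>i<N. \<Sum>j<N. \<Sum>g\<in>K. ?h (i, j, g) p q)"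
      by (simp add: I_def sum.cartesian_product split_def)
    also have "\<dots> = (\<Sum>i<N. \<Sum>j<N. if i = p \<and> j = q then \<Sum>g\<in>K. Poly_Mapping.single g (Poly_Mapping.lookup (X p q) g) else 0)"
      by (intro sum.cong refl) (auto simp: A_def unit_matrix_def row_def col_def label_def)
    also have "\<dots> = (if p < N \<and> q < N then \<Sum>g\<in>K. Poly_Mapping.single g (Poly_Mapping.lookup (X p q) g) else 0)"
    proof -
      have "(\<Sum>j<N. if i = p \<and> j = q then c else 0) = (if i = p then \<Sum>j<N. if j = q then c else 0 else 0)"
        for i and c :: "'g \<Rightarrow>\<^sub>0 'k" by simp
      then show ?thesis by simp
    qed
    also have "\<dots> = X p q"
    proof (cases "p < N \<and> q < N")
      case True
      then have "Poly_Mapping.keys (X p q) \<subseteq> K" by (auto simp: K_def)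
      then have "(\<Sum>g\<in>K. Poly_Mapping.single g (Poly_Mapping.lookup (X p q) g))
          = (\<Sum>g\<in>Poly_Mapping.keys (X p q). Poly_Mapping.single g (Poly_Mapping.lookup (X p q) g))"
        using K by (intro sum.mono_neutral_right) (auto simp: in_keys_iff)
      also have "\<dots> = X p q" using single_sum_expansion[of "X p q"] by simp
      finally show ?thesis using True by simp
    next
      case False
      then show ?thesis using N[of p q] by auto
    qed
    finally show ?thesis by simp
  qed
  then have "X = (\<Oplus>\<^bsub>R\<^esub>w\<in>I. ?h w)" by (intro ext)
  moreover have "(\<Oplus>\<^bsub>R\<^esub>w\<in>I. ?h w) \<in> lin_span R (E ` triples G)"
    by (intro lin_span_finsum[OF vect_R] lin_span_smult lin_span_base) (use I unit_matrix_closed in auto)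
  ultimately show "X \<in> lin_span R (E ` triples G)" by simp
qed

lemma trace_map_unit:
  assumes ws: "length ws = Suc n" "set ws \<subseteq> triples G"
  shows "trace_map A n (tensor R (map E ws)) =
    (if closed_word ws then tensor A (map (\<lambda>w. Poly_Mapping.single (label w) 1) ws) else \<zero>\<^bsub>CHH A n\<^esub>)"
proof -
  interpret C: vect "CHH A n" by (rule vect_CHH)
  have w: "map E ws \<in> words R (n + 1)" using unit_words[OF ws] by simp
  have nz: "E (ws ! p) a b \<noteq> 0 \<longleftrightarrow> a = row (ws ! p) \<and> b = col (ws ! p)" for p a b
    by (auto simp: unit_matrix_def row_def col_def split: prod.splits)
  have entry: "E (ws ! p) (row (ws ! p)) (col (ws ! p)) = Poly_Mapping.single (label (ws ! p)) 1" for p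
    by (auto simp: unit_matrix_def row_def col_def label_def split: prod.splits)
  have nz_all: "\<zero>\<^bsub>A\<^esub> \<notin> set (cyclic_entries n (map E ws) is) \<longleftrightarrow>
      (\<forall>p<Suc n. is ! p = row (ws ! p) \<and> is ! (Suc p mod Suc n) = col (ws ! p))" for "is"
  proof -
    have "\<zero>\<^bsub>A\<^esub> \<notin> set (cyclic_entries n (map E ws) is)
        \<longleftrightarrow> (\<forall>p<Suc n. (map E ws ! p) (is ! p) (is ! (Suc p mod Suc n)) \<noteq> \<zero>\<^bsub>A\<^esub>)"
      unfolding cyclic_entries_def Suc_eq_plus1[symmetric] set_map set_upt image_iff by (metis atLeastLessThan_iff le0)
    also have "\<dots> \<longleftrightarrow> (\<forall>p<Suc n. is ! p = row (ws ! p) \<and> is ! (Suc p mod Suc n) = col (ws ! p))"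
      using nz ws by (simp add: A_def)
    finally show ?thesis .
  qed
  let ?I = "{is. length is = n + 1 \<and> \<zero>\<^bsub>A\<^esub> \<notin> set (cyclic_entries n (map E ws) is)}"
  have sub: "is = map row ws" if "is \<in> ?I" for "is"
    using that ws by (intro nth_equalityI) (auto simp: nz_all)
  have I: "?I = (if closed_word ws then {map row ws} else {})"
  proof (cases "closed_word ws")
    case True
    then have "map row ws \<in> ?I" using ws by (simp add: nz_all closed_word_def)
    then show ?thesis using sub True by auto
  next
    case False
    have "closed_word ws" if "is \<in> ?I" for "is"
      using that sub[OF that] ws by (simp add: nz_all closed_word_def)
    then show ?thesis using False by auto
  qed
  have "trace_map A n (tensor R (map E ws)) = (\<Oplus>\<^bsub>CHH A n\<^esub> is \<in> ?I. tensor A (cyclic_entries n (map E ws) is))"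
    unfolding trace_map_def Let_def
    using tensor_lift_tensor[OF vect_R vect_CHH(2) trace_multilinear[OF vect_A] w]
    by (simp add: cyclic_entries_def)
  also have "\<dots> = (if closed_word ws then tensor A (map (\<lambda>w. Poly_Mapping.single (label w) 1) ws) else \<zero>\<^bsub>CHH A n\<^esub>)"
  proof (cases "closed_word ws")
    case True
    have "cyclic_entries n (map E ws) (map row ws) = map (\<lambda>w. Poly_Mapping.single (label w) 1) ws"
    proof (rule nth_equalityI)
      fix p assume "p < length (cyclic_entries n (map E ws) (map row ws))"
      then have p: "p < Suc n" by (simp add: cyclic_entries_def)
      then have "row (ws ! (Suc p mod Suc n)) = col (ws ! p)" using True ws by (simp add: closed_word_def)
      moreover have "Suc p mod Suc n < Suc n" by simp
      ultimately show "cyclic_entries n (map E ws) (map row ws) ! p = map (\<lambda>w. Poly_Mapping.single (label w) 1) ws ! p"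
        using p ws entry[of p] unfolding cyclic_entries_def by (simp del: upt_Suc)
    qed (simp add: cyclic_entries_def ws)
    moreover have "map (\<lambda>w. Poly_Mapping.single (label w) (1::'k)) ws \<in> words A (n + 1)"
      using ws by (auto simp: A_def in_triples_iff)
    ultimately show ?thesis
      using True C.finsum_single[of "\<lambda>is. tensor A (cyclic_entries n (map E ws) is)" "map row ws"]
        tensor_closed[OF vect_A, of "map (\<lambda>w. Poly_Mapping.single (label w) 1) ws" "n + 1"]
      unfolding I CHH_def by simp
  next
    case False
    then show ?thesis unfolding I by simp
  qed
  finally show ?thesis .
qed

lemma bar_projection_unit:
  assumes gs: "length gs = Suc n" "set gs \<subseteq> carrier G"
  shows "bar_projection G n (tensor A (map (\<lambda>g. Poly_Mapping.single g 1) gs)) = Poly_Mapping.single (tl gs) 1"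
proof -
  interpret B: vect "bar G n" by (rule vect_bar)
  let ?as = "map (\<lambda>g. Poly_Mapping.single g (1::'k)) gs"
  have w: "?as \<in> words A (n + 1)" using gs by (auto simp: A_def)
  have "{hs. length hs = n + 1 \<and> (\<forall>p\<le>n. hs ! p \<in> Poly_Mapping.keys (?as ! p))} = {gs}"
    using gs by (auto intro!: nth_equalityI)
  moreover have "(\<Prod>p\<le>n. Poly_Mapping.lookup (?as ! p) (gs ! p)) = 1"
    using gs by (intro prod.neutral) auto
  moreover have "Poly_Mapping.single (tl gs) (1::'k) \<in> carrier (bar G n)"
    using gs by (cases gs) auto
  ultimately show ?thesis
    unfolding bar_projection_def
    using tensor_lift_tensor[OF vect_A vect_bar bar_projection_multilinear[where G = G and ?'b = 'k, folded A_def] w]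
    by simp
qed

lemma trace_bar_unit:
  assumes ws: "ws \<noteq> []" "set ws \<subseteq> triples G"
  shows "trace_bar (map E ws) = (if closed_word ws then Poly_Mapping.single (tl (map label ws)) 1 else 0)"
proof -
  obtain n where n: "length ws = Suc n" using ws by (cases ws) auto
  have labels: "set (map label ws) \<subseteq> carrier G" using ws by (auto simp: in_triples_iff)
  have "bar_projection G n \<zero>\<^bsub>CHH A n\<^esub> = 0"
    using linear_maps_zero[OF vect_CHH(2) vect_bar bar_projection_linear] by simp
  then show ?thesis
    using bar_projection_unit[of "map label ws" n] labels n
    by (simp add: trace_bar_def trace_map_unit[OF n ws(2)] comp_def)
qed

text \<open>Every face of a word of elementary matrices either is again a word of elementary matrices or contains the zero matrix.\<close>

lemma hochschild_trace_bar:
  assumes ws: "length ws = Suc (Suc n)" "set ws \<subseteq> triples G"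
  shows "hochschild (monoid.mult R) trace_bar (map E ws) = bar_diff G (Suc n) (trace_bar (map E ws))"
proof -
  let ?gs = "tl (map label ws)"
  have wk: "ws ! k \<in> triples G" if "k < Suc (Suc n)" for k using ws nth_mem[of k ws] that by auto
  have gs: "length ?gs = Suc n" "set ?gs \<subseteq> carrier G"
    using ws by (cases ws; auto simp: in_triples_iff)+
  have face: "trace_bar (hochschild_face (monoid.mult R) k (map E ws))
      = (if closed_word ws then Poly_Mapping.single (bar_face G (Suc n) k ?gs) 1 else 0)"
    if k: "k < Suc (Suc n)" for k
  proof (cases "col (ws ! k) = row (ws ! (Suc k mod Suc (Suc n)))")
    case True
    let ?v = "hochschild_face (triple_mult G) k ws"
    have mult: "E (ws ! k) \<otimes>\<^bsub>R\<^esub> E (ws ! (Suc k mod Suc (Suc n))) = E (triple_mult G (ws ! k) (ws ! (Suc k mod Suc (Suc n))))"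
      using unit_matrix_mult[of "ws ! k" "ws ! (Suc k mod Suc (Suc n))"] wk k True by simp
    have v: "hochschild_face (monoid.mult R) k (map E ws) = map E ?v"
    proof (cases "k = Suc n")
      case True
      then show ?thesis using ws k mult
        by (intro nth_equalityI) (auto simp: nth_hochschild_face)
    next
      case False
      then show ?thesis using ws k mult
        by (intro nth_equalityI) (auto simp: nth_hochschild_face)
    qed
    have lab: "map label ?v = hochschild_face (monoid.mult G) k (map label ws)"
      using ws k by (intro nth_equalityI) (auto simp: nth_hochschild_face)
    have len: "length ?v = Suc n" using ws k by simp
    have "?v ! q \<in> triples G" if "q < Suc n" for q
      using wk k that ws by (subst nth_hochschild_face) (auto simp: in_triples_iff)
    then have "set ?v \<subseteq> triples G" using len by (metis in_set_conv_nth subsetI)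
    moreover have "?v \<noteq> []" using len by auto
    moreover have "tl (map label ?v) = bar_face G (Suc n) k ?gs"
      unfolding lab by (rule tl_hochschild_face) (use ws k in auto)
    ultimately show ?thesis
      using closed_word_face[of ws "Suc n" k G] ws k True by (simp add: v trace_bar_unit)
  next
    case False
    have z: "E (ws ! k) \<otimes>\<^bsub>R\<^esub> E (ws ! (Suc k mod Suc (Suc n))) = \<zero>\<^bsub>R\<^esub>"
      using unit_matrix_mult[of "ws ! k" "ws ! (Suc k mod Suc (Suc n))"] wk k False by simp
    let ?w = "hochschild_face (monoid.mult R) k (map E ws)"
    define q where "q = (if k = Suc n then 0 else k)"
    have q: "q < Suc n" using k by (auto simp: q_def)
    have "?w ! q = \<zero>\<^bsub>R\<^esub>"
      using z k ws q by (subst nth_hochschild_face) (auto simp: q_def split: if_splits)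
    moreover have len: "length ?w = Suc n" using ws k by simp
    ultimately have w0: "?w = ?w[q := \<zero>\<^bsub>R\<^esub>]" by (metis list_update_id)
    have "?w ! r \<in> carrier R" if "r < Suc n" for r
      using wk k that ws unit_matrix_closed bilinear_multD(3)[OF bilinear_R]
      by (subst nth_hochschild_face) auto
    then have w: "?w \<in> words R (Suc n)" using len by (auto simp: in_set_conv_nth)
    have "trace_bar (?w[q := \<zero>\<^bsub>R\<^esub>]) = \<zero>\<^bsub>bar G n\<^esub>"
      by (rule linear_maps_zero[OF vect_R vect_bar multilinearD(2)[OF trace_bar_multilinear w q]])
    then have "trace_bar ?w = 0" using w0 by simp
    moreover have "\<not> closed_word ws" using False ws k by (auto simp: closed_word_def)
    ultimately show ?thesis by simp
  qed
  have "hochschild (monoid.mult R) trace_bar (map E ws) = (\<Sum>k<Suc (Suc n). signed k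
      (if closed_word ws then Poly_Mapping.single (bar_face G (Suc n) k ?gs) 1 else 0))"
    unfolding hochschild_def using ws by (auto intro!: sum.cong simp: face simp del: sum.lessThan_Suc)
  also have "\<dots> = (if closed_word ws then bar_diff G (Suc n) (Poly_Mapping.single ?gs 1) else 0)"
  proof (cases "closed_word ws")
    case True
    then show ?thesis unfolding bar_diff_single[OF is_group gs] lessThan_Suc_atMost by (simp only: if_True)
  qed simp
  also have "\<dots> = bar_diff G (Suc n) (trace_bar (map E ws))"
    using linear_maps_zero[OF vect_bar vect_bar bar_diff_linear[OF is_group, of n]] ws
    by (subst trace_bar_unit) auto
  finally show ?thesis .
qed

lemma linear_maps_bar_sum:
  assumes "P \<in> linear_maps (bar G m) (bar G n)" "\<And>a. a \<in> I \<Longrightarrow> (h a :: _ \<Rightarrow>\<^sub>0 'k) \<in> carrier (bar G m)"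
  shows "P (\<Sum>a\<in>I. h a) = (\<Sum>a\<in>I. P (h a))"
proof -
  have "(\<Oplus>\<^bsub>bar G m\<^esub>a\<in>I. h a) = (\<Sum>a\<in>I. h a)"
    unfolding bar_def by (rule finsum_free_module) (use assms(2) in auto)
  moreover have "(\<Oplus>\<^bsub>bar G n\<^esub>a\<in>I. P (h a)) = (\<Sum>a\<in>I. P (h a))"
    unfolding bar_def
    by (rule finsum_free_module) (use linear_maps_closed[OF assms(1) assms(2)] in auto)
  ultimately show ?thesis
    using linear_maps_finsum[OF vect_bar vect_bar assms(1), of h I] assms(2) by auto
qed

lemma alternation_bar_diff:
  assumes ws: "length ws = Suc (Suc n)" "set ws \<subseteq> triples G"
  shows "alternation (\<lambda>w. bar_diff G (Suc n) (trace_bar w)) (map E ws)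
    = bar_diff G (Suc n) (alternation trace_bar (map E ws))"
proof -
  interpret B: vect "bar G (Suc n)" by (rule vect_bar)
  have len: "length (map E ws) = Suc (Suc n)" using ws by simp
  have mem: "trace_bar (permuted_word (map E ws) \<sigma>) \<in> carrier (bar G (Suc n))" if "\<sigma> permutes {1..Suc n}" for \<sigma>
    by (rule multilinearD(1)[OF trace_bar_multilinear permuted_word_mem[OF that unit_words[OF ws]]])
  have "bar_diff G (Suc n) (\<Sum>\<sigma> | \<sigma> permutes {1..Suc n}. scale_pm (of_int (sign \<sigma>)) (trace_bar (permuted_word (map E ws) \<sigma>)))
      = (\<Sum>\<sigma> | \<sigma> permutes {1..Suc n}. bar_diff G (Suc n) (scale_pm (of_int (sign \<sigma>)) (trace_bar (permuted_word (map E ws) \<sigma>))))"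
    using B.smult_mem[OF mem] by (intro linear_maps_bar_sum[OF bar_diff_linear[OF is_group]]) (simp del: bar_simps(1))
  also have "\<dots> = (\<Sum>\<sigma> | \<sigma> permutes {1..Suc n}. scale_pm (of_int (sign \<sigma>)) (bar_diff G (Suc n) (trace_bar (permuted_word (map E ws) \<sigma>))))"
    using linear_maps_smult[OF bar_diff_linear[OF is_group] mem] by (intro sum.cong refl) simp
  finally show ?thesis
    by (simp only: sum_permutations_eq_alternation[OF len, of trace_bar]
        sum_permutations_eq_alternation[OF len, of "\<lambda>w. bar_diff G (Suc n) (trace_bar w)"])
qed

text \<open>
  Both sides are multilinear, so it suffices to compare them on words of elementary matrices.  There
  \<open>alternation_hochschild\<close> turns the Leibniz differential into the Hochschild boundary, which trace and
  projection turn into the boundary of the bar complex.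
\<close>

theorem gl_to_bar_chain_map:
  assumes X: "X \<in> carrier (CL R (Suc (Suc n)))"
  shows "gl_to_bar G n (leibniz_diff R (Suc (Suc n)) X) = bar_diff G (Suc n) (gl_to_bar G (Suc n) X)"
proof -
  interpret C: vect "CL R (Suc n)" by (rule vect_CL)
  have P: "(\<lambda>X. gl_to_bar G n (leibniz_diff R (Suc (Suc n)) X)) \<in> linear_maps (tensor_power R (Suc (Suc n))) (bar G n)"
    using linear_maps_comp[OF leibniz_diff_linear[of "Suc (Suc n)"]] gl_to_bar_linear[of n] by (simp add: CL_def)
  have Q: "(\<lambda>X. bar_diff G (Suc n) (gl_to_bar G (Suc n) X)) \<in> linear_maps (tensor_power R (Suc (Suc n))) (bar G n)"
    using linear_maps_comp[OF gl_to_bar_linear[of "Suc n"] bar_diff_linear[OF is_group]] by (simp add: CL_def)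
  have eq: "gl_to_bar G n (leibniz_diff R (Suc (Suc n)) (tensor R xs)) = bar_diff G (Suc n) (gl_to_bar G (Suc n) (tensor R xs))"
    if xs: "length xs = Suc (Suc n)" "set xs \<subseteq> E ` triples G" for xs
  proof -
    have "xs \<in> lists (E ` triples G)" using xs(2) by blast
    then obtain ws where ws: "xs = map E ws" "set ws \<subseteq> triples G" by (auto simp: lists_image)
    have len: "length ws = Suc (Suc n)" using xs ws by simp
    have w: "xs \<in> words R (Suc (Suc n))" using unit_words[OF len ws(2)] ws(1) by simp
    let ?y = "\<lambda>j i. remove_nth j (xs[i := commutator R (xs ! i) (xs ! j)])"
    have y: "?y j i \<in> words R (Suc n)" if ij: "i < j" "j < Suc (Suc n)" for i j
    proof -
      have "xs[i := commutator R (xs ! i) (xs ! j)] \<in> words R (Suc (Suc n))"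
        using words_nth[OF w] ij by (intro words_update[OF w] commutator_closed[OF vect_R bilinear_R]) auto
      then show ?thesis using ij set_remove_nth[of j "xs[i := commutator R (xs ! i) (xs ! j)]"]
        by (auto simp: length_remove_nth)
    qed
    have mem: "(- 1) ^ (j + 1) \<odot>\<^bsub>CL R (Suc n)\<^esub> tensor R (?y j i) \<in> carrier (CL R (Suc n))"
      if "i < j" "j < Suc (Suc n)" for i j
      using tensor_closed[OF vect_R y[OF that]] by (intro C.smult_mem) (simp add: CL_def)
    have fin: "f (\<Oplus>\<^bsub>CL R (Suc n)\<^esub>a\<in>I. h a) = (\<Sum>a\<in>I. f (h a))"
      if f: "f \<in> linear_maps (CL R (Suc n)) (bar G n)" and "\<And>a. a \<in> I \<Longrightarrow> h a \<in> carrier (CL R (Suc n))"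
      for f :: "_ \<Rightarrow> 'g list \<Rightarrow>\<^sub>0 'k" and h and I :: "nat set"
    proof -
      have "f (\<Oplus>\<^bsub>CL R (Suc n)\<^esub>a\<in>I. h a) = (\<Oplus>\<^bsub>bar G n\<^esub>a\<in>I. f (h a))"
        using that by (intro linear_maps_finsum[OF vect_CL vect_bar]) auto
      also have "\<dots> = (\<Sum>a\<in>I. f (h a))"
        unfolding bar_def by (rule finsum_free_module) (use linear_maps_closed[OF f that(2)] in auto)
      finally show ?thesis .
    qed
    have "gl_to_bar G n (leibniz_diff R (Suc (Suc n)) (tensor R xs)) = gl_to_bar G n
       (\<Oplus>\<^bsub>CL R (Suc n)\<^esub> j \<in> {0..<Suc (Suc n)}. \<Oplus>\<^bsub>CL R (Suc n)\<^esub> i \<in> {0..<j}.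
        (- 1) ^ (j + 1) \<odot>\<^bsub>CL R (Suc n)\<^esub> tensor R (?y j i))"
      unfolding leibniz_diff_tensor[OF w] by simp
    also have "\<dots> = (\<Sum>j\<in>{0..<Suc (Suc n)}. gl_to_bar G n (\<Oplus>\<^bsub>CL R (Suc n)\<^esub> i \<in> {0..<j}.
        (- 1) ^ (j + 1) \<odot>\<^bsub>CL R (Suc n)\<^esub> tensor R (?y j i)))"
      using mem by (intro fin[OF gl_to_bar_linear] C.finsum_closed) auto
    also have "\<dots> = (\<Sum>j\<in>{0..<Suc (Suc n)}. \<Sum>i\<in>{0..<j}. gl_to_bar G n
        ((- 1) ^ (j + 1) \<odot>\<^bsub>CL R (Suc n)\<^esub> tensor R (?y j i)))"
      using mem by (intro sum.cong refl fin[OF gl_to_bar_linear]) auto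
    also have "\<dots> = (\<Sum>j\<in>{0..<Suc (Suc n)}. \<Sum>i\<in>{0..<j}. signed (j + 1) (alternation trace_bar (?y j i)))"
    proof (intro sum.cong refl)
      fix j i assume "j \<in> {0..<Suc (Suc n)}" "i \<in> {0..<j}"
      then have yw: "?y j i \<in> words R (Suc n)" by (intro y) auto
      then have "tensor R (?y j i) \<in> carrier (CL R (Suc n))"
        unfolding CL_def by (rule tensor_closed[OF vect_R])
      then show "gl_to_bar G n ((- 1) ^ (j + 1) \<odot>\<^bsub>CL R (Suc n)\<^esub> tensor R (?y j i))
          = signed (j + 1) (alternation trace_bar (?y j i))"
        using linear_maps_smult[OF gl_to_bar_linear] gl_to_bar_tensor[OF yw] by simp
    qed
    also have "\<dots> = leibniz (commutator R) (alternation trace_bar) xs"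
      unfolding leibniz_def using w by (simp add: atLeast0LessThan del: sum.lessThan_Suc)
    also have "\<dots> = alternation (hochschild (monoid.mult R) trace_bar) xs"
      by (rule alternation_hochschild[OF _ _ trace_bar_bracket, symmetric]) (use w in auto)
    also have "\<dots> = alternation (\<lambda>w. bar_diff G (Suc n) (trace_bar w)) xs"
    proof (rule alternation_cong)
      fix v assume v: "length v = length xs" "set v \<subseteq> set xs"
      then have "v \<in> lists (E ` triples G)" using xs(2) by blast
      then obtain vs where vs: "v = map E vs" "set vs \<subseteq> triples G" by (auto simp: lists_image)
      then show "hochschild (monoid.mult R) trace_bar v = bar_diff G (Suc n) (trace_bar v)"
        using v(1) xs(1) by (simp add: hochschild_trace_bar)
    qed (use xs in auto)
    also have "\<dots> = bar_diff G (Suc n) (gl_to_bar G (Suc n) (tensor R xs))"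
      by (simp only: gl_to_bar_tensor[OF w[unfolded ws(1)]] ws(1) alternation_bar_diff[OF len ws(2)])
    finally show ?thesis .
  qed
  have "gl_to_bar G n (leibniz_diff R (Suc (Suc n)) (tensor R xs)) = bar_diff G (Suc n) (gl_to_bar G (Suc n) (tensor R xs))"
    if "xs \<in> words R (Suc (Suc n))" for xs
    by (rule multilinear_eq_on_lin_span[OF vect_R vect_bar multilinear_linear_comp[OF tensor_multilinear[OF vect_R] P]
          multilinear_linear_comp[OF tensor_multilinear[OF vect_R] Q] _ unit_matrices_span eq that])
      (use unit_matrix_closed in auto)
  from tensor_power_linear_eqI[OF vect_R vect_bar P Q this] X show ?thesis by (simp add: CL_def)
qed

end


section \<open>Index chains with equal faces\<close>

abbreviation all_lists :: "('k::field, nat list \<Rightarrow>\<^sub>0 'k) module" where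
  "all_lists \<equiv> free_module UNIV"

text \<open>The linear map of formal sums of lists that is induced by a map \<open>f\<close> of lists.\<close>

definition push :: "(nat list \<Rightarrow> nat list) \<Rightarrow> (nat list \<Rightarrow>\<^sub>0 'k::field) \<Rightarrow> (nat list \<Rightarrow>\<^sub>0 'k)" where
  "push f = linear_extension all_lists (\<lambda>w. Poly_Mapping.single (f w) 1)"

definition mass :: "(nat list \<Rightarrow>\<^sub>0 'k::field) \<Rightarrow> 'k" where
  "mass = linear_extension ground_field (\<lambda>_. 1)"

definition distinct_lists :: "nat \<Rightarrow> nat list set" where
  "distinct_lists n = {w. length w = n \<and> distinct w}"

lemma linear_maps_free_subset:
  "f \<in> linear_maps (free_module UNIV) M \<Longrightarrow> f \<in> linear_maps (free_module B) M"
  by (rule linear_mapsI)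
    (auto dest: linear_maps_closed linear_maps_add linear_maps_smult)

lemma push_linear: "push f \<in> linear_maps all_lists all_lists"
  unfolding push_def by (rule linear_extension_linear[OF vect_free_module]) simp

lemma push_single [simp]: "push f (Poly_Mapping.single w 1) = Poly_Mapping.single (f w) 1"
  unfolding push_def by (rule linear_extension_single[OF vect_free_module]) simp

lemma push_add: "push f (x + y) = push f x + push f y"
  using linear_maps_add[OF push_linear, of x y f] by simp

lemma push_zero [simp]: "push f 0 = 0"
  using linear_maps_zero[OF vect_free_module vect_free_module push_linear[of f]] by simp

lemma push_diff: "push f (x - y) = push f x - push f y"
  using push_add[of f "x - y" y] by (simp add: algebra_simps)

lemma mass_linear: "mass \<in> linear_maps (free_module B) ground_field"
  unfolding mass_def by (rule linear_extension_linear[OF vect_ground_field]) simp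

lemma mass_single [simp]: "mass (Poly_Mapping.single w 1) = 1"
  unfolding mass_def by (rule linear_extension_single[OF vect_ground_field]) simp

lemma push_push_eqI:
  assumes "Poly_Mapping.keys x \<subseteq> B" "\<And>w. w \<in> B \<Longrightarrow> f (g w) = f' (g' w)"
  shows "push f (push g x) = push f' (push g' x)"
  by (rule free_module_linear_eqI[OF vect_free_module
        linear_maps_free_subset[OF linear_maps_comp[OF push_linear push_linear]]
        linear_maps_free_subset[OF linear_maps_comp[OF push_linear push_linear]] _ assms(1)])
    (simp add: assms(2))

lemma push_push_id:
  assumes "Poly_Mapping.keys x \<subseteq> B" "\<And>w. w \<in> B \<Longrightarrow> f (g w) = w"
  shows "push f (push g x) = x"
proof -
  have id: "(\<lambda>x. x) \<in> linear_maps all_lists all_lists" by (rule linear_mapsI) auto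
  show ?thesis
    by (rule free_module_linear_eqI[OF vect_free_module
          linear_maps_free_subset[OF linear_maps_comp[OF push_linear push_linear]]
          linear_maps_free_subset[OF id] _ assms(1)])
      (simp add: assms(2))
qed

lemma mass_push: "mass (push f x) = mass x"
  by (rule free_module_linear_eqI[OF vect_ground_field linear_maps_comp[OF push_linear mass_linear] mass_linear])
    simp_all

lemma keys_push: "Poly_Mapping.keys (push f x) \<subseteq> f ` Poly_Mapping.keys x"
proof -
  have "push f x = (\<Sum>w\<in>Poly_Mapping.keys x. Poly_Mapping.single (f w) (Poly_Mapping.lookup x w))"
    unfolding push_def linear_extension_def by (subst finsum_free_module) simp_all
  then show ?thesis
    using Poly_Mapping.keys_sum[of "\<lambda>w. Poly_Mapping.single (f w) (Poly_Mapping.lookup x w)" "Poly_Mapping.keys x"]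
    by (auto split: if_splits)
qed

lemma remove_remove_nth:
  "k < j \<Longrightarrow> j < length w \<Longrightarrow> remove_nth k (remove_nth j w) = remove_nth (j - 1) (remove_nth k w)"
  by (rule nth_equalityI) (auto simp: length_remove_nth nth_remove_nth)

lemma remove_insert_same: "j \<le> length w \<Longrightarrow> remove_nth j (insert_letter j a w) = w"
  by (simp add: remove_nth_def insert_letter_def)

lemma remove_insert_before:
  assumes "k < j" "j \<le> length w"
  shows "remove_nth k (insert_letter j a w) = insert_letter (j - 1) a (remove_nth k w)"
proof (rule nth_equalityI)
  have l: "length (remove_nth k w) = length w - 1" "length (remove_nth k (insert_letter j a w)) = length w"
    using assms by (simp_all add: length_remove_nth)
  then show "length (remove_nth k (insert_letter j a w)) = length (insert_letter (j - 1) a (remove_nth k w))"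
    using assms by simp
  fix q assume "q < length (remove_nth k (insert_letter j a w))"
  then have "q < length w" using l by simp
  then show "remove_nth k (insert_letter j a w) ! q = insert_letter (j - 1) a (remove_nth k w) ! q"
    using assms l by (simp add: nth_remove_nth nth_insert_letter) linarith?
qed

lemma distinct_insert_letter:
  "distinct (insert_letter j a w) \<longleftrightarrow> a \<notin> set w \<and> distinct w"
proof -
  have "distinct (u @ a # v) \<longleftrightarrow> a \<notin> set (u @ v) \<and> distinct (u @ v)" for u v :: "'a list" by auto
  from this[of "take j w" "drop j w"] show ?thesis unfolding insert_letter_def append_take_drop_id .
qed

text \<open>
  Filling: a chain \<open>x\<close> whose first \<open>j\<close> faces are \<open>c\<close> is corrected in its face \<open>j\<close> by inserting a
  fresh letter at place \<open>j\<close> into the error \<open>c - d\<^sub>j x\<close>.  The faces of the error of index less than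
  \<open>j\<close> vanish, so that the earlier faces of \<open>x\<close> do not change.
\<close>

lemma fill_faces:
  fixes c c' :: "nat list \<Rightarrow>\<^sub>0 'k::field"
  assumes c: "Poly_Mapping.keys c \<subseteq> distinct_lists n"
    and faces: "\<And>k. k < n \<Longrightarrow> push (remove_nth k) c = c'"
    and j: "j \<le> Suc n"
  shows "\<exists>x. Poly_Mapping.keys x \<subseteq> distinct_lists (Suc n) \<and> (\<forall>k<j. push (remove_nth k) x = c)"
  using j
proof (induction j)
  case 0
  show ?case by (rule exI[of _ 0]) simp
next
  case (Suc j)
  then obtain x where x: "Poly_Mapping.keys x \<subseteq> distinct_lists (Suc n)"
    and xf: "\<And>k. k < j \<Longrightarrow> push (remove_nth k) x = c" by auto
  have j: "j \<le> n" using Suc.prems by simp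
  define z where "z = c - push (remove_nth j) x"
  have "Poly_Mapping.keys (push (remove_nth j) x) \<subseteq> distinct_lists n"
  proof -
    have "remove_nth j w \<in> distinct_lists n" if "w \<in> distinct_lists (Suc n)" for w
    proof -
      have "distinct (take j w @ drop (Suc j) w)"
        using that set_take_disj_set_drop_if_distinct[of w j "Suc j"]
        by (auto simp: distinct_lists_def)
      then show ?thesis using that j by (simp add: distinct_lists_def remove_nth_def)
    qed
    then show ?thesis using keys_push[of "remove_nth j" x] x by blast
  qed
  then have z: "Poly_Mapping.keys z \<subseteq> distinct_lists n"
    unfolding z_def using Poly_Mapping.keys_diff[of c "push (remove_nth j) x"] c by blast
  have zf: "push (remove_nth k) z = 0" if k: "k < j" for k
  proof -
    have "push (remove_nth k) (push (remove_nth j) x) = push (remove_nth (j - 1)) (push (remove_nth k) x)"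
      by (rule push_push_eqI[OF x]) (use k j in \<open>auto simp: remove_remove_nth distinct_lists_def\<close>)
    then show ?thesis
      using xf[OF k] faces[of k] faces[of "j - 1"] k j by (simp add: z_def push_diff)
  qed
  obtain a where a: "a \<notin> \<Union> (set ` Poly_Mapping.keys z)"
    using ex_new_if_finite[of "\<Union> (set ` Poly_Mapping.keys z)"] by auto
  let ?y = "push (insert_letter j a) z"
  have "Poly_Mapping.keys ?y \<subseteq> distinct_lists (Suc n)"
  proof
    fix v assume "v \<in> Poly_Mapping.keys ?y"
    then obtain w where w: "w \<in> Poly_Mapping.keys z" "v = insert_letter j a w"
      using keys_push[of "insert_letter j a" z] by blast
    then have "w \<in> distinct_lists n" "a \<notin> set w" using z a by auto
    then show "v \<in> distinct_lists (Suc n)"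
      using w j by (simp add: distinct_lists_def distinct_insert_letter)
  qed
  then have "Poly_Mapping.keys (x + ?y) \<subseteq> distinct_lists (Suc n)"
    using x Poly_Mapping.keys_add[of x ?y] by blast
  moreover have "push (remove_nth k) (x + ?y) = c" if k: "k < Suc j" for k
  proof (cases "k = j")
    case True
    have "push (remove_nth j) ?y = z"
      by (rule push_push_id[OF z]) (use j in \<open>auto simp: remove_insert_same distinct_lists_def\<close>)
    then show ?thesis using True by (simp add: push_add z_def)
  next
    case False
    then have k: "k < j" using that by simp
    have "push (remove_nth k) ?y = push (insert_letter (j - 1) a) (push (remove_nth k) z)"
      by (rule push_push_eqI[OF z]) (use k j in \<open>auto simp: remove_insert_before distinct_lists_def\<close>)
    then show ?thesis using xf[OF k] zf[OF k] by (simp add: push_add)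
  qed
  ultimately show ?case by blast
qed

text \<open>
  The induction keeps the faces \<open>c'\<close> of \<open>c\<close> along: that \<open>c\<close> itself has equal faces makes the family
  \<open>c, \<dots>, c\<close> of prescribed faces compatible, which the filling needs.  Faces preserve the mass.
\<close>

lemma equal_faces_exist:
  "\<exists>c c' :: nat list \<Rightarrow>\<^sub>0 'k::field. Poly_Mapping.keys c \<subseteq> distinct_lists (Suc n) \<and>
     Poly_Mapping.keys c' \<subseteq> distinct_lists n \<and> (\<forall>k\<le>n. push (remove_nth k) c = c') \<and> mass c = 1"
proof (induction n)
  case 0
  show ?case
    by (rule exI[of _ "Poly_Mapping.single [0] 1"], rule exI[of _ "Poly_Mapping.single [] 1"])
      (simp add: distinct_lists_def remove_nth_def)
next
  case (Suc n)
  then obtain c c' :: "nat list \<Rightarrow>\<^sub>0 'k" where c: "Poly_Mapping.keys c \<subseteq> distinct_lists (Suc n)"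
    and faces: "\<And>k. k < Suc n \<Longrightarrow> push (remove_nth k) c = c'" and mass: "mass c = 1"
    by (auto simp: less_Suc_eq_le)
  obtain x where x: "Poly_Mapping.keys x \<subseteq> distinct_lists (Suc (Suc n))"
    "\<And>k. k < Suc (Suc n) \<Longrightarrow> push (remove_nth k) x = c"
    using fill_faces[OF c faces order.refl] by auto
  have "mass x = 1" using mass_push[of "remove_nth 0" x] x(2)[of 0] mass by simp
  then show ?case using c x by (intro exI[of _ x] exI[of _ c]) (auto simp: less_Suc_eq_le)
qed


section \<open>A section of the composite\<close>

text \<open>
  The word \<open>E(i\<^sub>n, i\<^sub>0), E(i\<^sub>0, i\<^sub>1), \<dots>, E(i\<^sub>n\<^sub>-\<^sub>1, i\<^sub>n)\<close> with labels \<open>hs\<close>.  The column index of letter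
  \<open>p\<close> is \<open>i\<^sub>p\<close>; with this choice face \<open>k\<close> of the word, including the last one, just removes \<open>i\<^sub>k\<close>.
\<close>

definition cyclic_word :: "nat list \<Rightarrow> 'g list \<Rightarrow> (nat \<times> nat \<times> 'g) list" where
  "cyclic_word is hs = map (\<lambda>p. (is ! (if p = 0 then length hs - 1 else p - 1), is ! p, hs ! p)) [0..<length hs]"

lemma length_cyclic_word [simp]: "length (cyclic_word is hs) = length hs"
  by (simp add: cyclic_word_def)

lemma nth_cyclic_word:
  assumes "p < length hs"
  shows "row (cyclic_word is hs ! p) = is ! (if p = 0 then length hs - 1 else p - 1)"
    "col (cyclic_word is hs ! p) = is ! p"
    "label (cyclic_word is hs ! p) = hs ! p"
  using assms by (simp_all add: cyclic_word_def row_def col_def label_def)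

lemma map_label_cyclic_word: "map label (cyclic_word is hs) = hs"
  by (rule nth_equalityI) (simp_all add: nth_cyclic_word)

lemma cyclic_word_triples: "set hs \<subseteq> carrier G \<Longrightarrow> set (cyclic_word is hs) \<subseteq> triples G"
  by (auto simp: cyclic_word_def triples_def)

lemma triple_eqI: "row v = row w \<Longrightarrow> col v = col w \<Longrightarrow> label v = label w \<Longrightarrow> v = w"
  by (cases v; cases w) (auto simp: row_def col_def label_def)

lemma cyclic_word_face:
  assumes len: "length is = Suc n" "length hs = Suc n" and n: "1 \<le> n" and k: "k \<le> n"
  shows "hochschild_face (triple_mult G) k (cyclic_word is hs)
    = cyclic_word (remove_nth k is) (hochschild_face (monoid.mult G) k hs)"
proof (rule nth_equalityI)
  show "length (hochschild_face (triple_mult G) k (cyclic_word is hs))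
      = length (cyclic_word (remove_nth k is) (hochschild_face (monoid.mult G) k hs))"
    using assms by simp
  fix q assume "q < length (hochschild_face (triple_mult G) k (cyclic_word is hs))"
  then have q: "q < n" using assms by simp
  show "hochschild_face (triple_mult G) k (cyclic_word is hs) ! q
      = cyclic_word (remove_nth k is) (hochschild_face (monoid.mult G) k hs) ! q"
    by (rule triple_eqI)
      (use q assms in \<open>auto simp: nth_hochschild_face nth_cyclic_word nth_remove_nth\<close>)
qed

lemma closed_cyclic_word: "closed_word (cyclic_word is hs)"
  unfolding closed_word_def length_cyclic_word
proof (intro allI impI)
  fix p assume p: "p < length hs"
  show "col (cyclic_word is hs ! p) = row (cyclic_word is hs ! (Suc p mod length hs))"
  proof (cases "Suc p = length hs")
    case True
    then have "0 < length hs" "p = length hs - 1" by auto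
    then show ?thesis using True p by (simp add: nth_cyclic_word)
  next
    case False
    then show ?thesis using p by (simp add: nth_cyclic_word)
  qed
qed

text \<open>As the indices are distinct, each letter of a closed rearrangement determines the next one; since
  the first letter is fixed, the rearrangement is the identity.\<close>

lemma closed_permuted_cyclic_word:
  assumes s: "\<sigma> permutes {1..n}" and len: "length hs = Suc n" "length is = Suc n" "distinct is"
    and closed: "closed_word (permuted_word (cyclic_word is hs) \<sigma>)"
  shows "\<sigma> = id"
proof -
  define \<tau> where "\<tau> = inv_into UNIV \<sigma>"
  have t: "\<tau> permutes {1..n}" unfolding \<tau>_def by (rule permutes_inv[OF s])
  have lt: "\<tau> p < Suc n" if "p < Suc n" for p
    unfolding \<tau>_def by (rule permutes_inv_less[OF s that])
  have step: "\<tau> (Suc p) = Suc (\<tau> p)" if p: "Suc p < Suc n" for p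
  proof -
    have pos: "1 \<le> \<tau> (Suc p)" using permutes_in_image[OF t, of "Suc p"] p by auto
    have "col (permuted_word (cyclic_word is hs) \<sigma> ! p) = row (permuted_word (cyclic_word is hs) \<sigma> ! Suc p)"
      using closed p len by (auto simp: closed_word_def dest: spec[of _ p])
    then have "is ! \<tau> p = is ! (\<tau> (Suc p) - 1)"
      using p pos lt[of p] lt[of "Suc p"] len
      by (simp add: nth_permuted_word nth_cyclic_word flip: \<tau>_def)
    then show ?thesis
      using len lt[of p] lt[of "Suc p"] p pos by (simp add: nth_eq_iff_index_eq)
  qed
  have "\<tau> p = p" if "p < Suc n" for p
    using that
  proof (induction p)
    case 0
    show ?case by (rule permutes_not_in[OF t]) simp
  next
    case (Suc p)
    then show ?case using step[of p] by simp
  qed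
  moreover have "\<tau> p = p" if "\<not> p < Suc n" for p by (rule permutes_not_in[OF t]) (use that in auto)
  ultimately have "\<tau> = id" by (auto simp: fun_eq_iff)
  then have "inv_into UNIV \<tau> = id" by simp
  then show ?thesis using permutes_inv_inv[OF s] by (simp add: \<tau>_def)
qed

lemma bar_linear_eqI:
  assumes "vect M" "f \<in> linear_maps (bar G n) M" "g \<in> linear_maps (bar G n) M"
    and "\<And>gs. length gs = n \<Longrightarrow> set gs \<subseteq> carrier G \<Longrightarrow> f (Poly_Mapping.single gs 1) = g (Poly_Mapping.single gs 1)"
    and "z \<in> carrier (bar G n)"
  shows "f z = g z"
  by (rule free_module_linear_eqI[OF assms(1) assms(2,3)[unfolded bar_def]]) (use assms(4,5) in auto)

context group_algebra
begin

lemma cyclic_unit_word: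
  "length hs = n \<Longrightarrow> set hs \<subseteq> carrier G \<Longrightarrow> map E (cyclic_word is hs) \<in> words R n"
  by (rule unit_words[OF _ cyclic_word_triples]) simp_all

lemma alternation_cyclic_word:
  assumes len: "length hs = Suc n" "length is = Suc n" "distinct is" and hs: "set hs \<subseteq> carrier G"
  shows "alternation trace_bar (map E (cyclic_word is hs)) = Poly_Mapping.single (tl hs) 1"
proof -
  let ?ws = "cyclic_word is hs"
  have summand: "trace_bar (permuted_word (map E ?ws) \<sigma>) = (if \<sigma> = id then Poly_Mapping.single (tl hs) 1 else 0)"
    if s: "\<sigma> permutes {1..n}" for \<sigma>
  proof -
    note lt = permutes_inv_less[OF s]
    have "permuted_word (map E ?ws) \<sigma> = map E (permuted_word ?ws \<sigma>)"
      using lt len by (intro nth_equalityI) (simp_all add: nth_permuted_word)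
    moreover have "set (permuted_word ?ws \<sigma>) \<subseteq> set ?ws"
      unfolding permuted_word_def set_map by (rule image_subsetI, rule nth_mem) (simp add: lt len del: upt_Suc)
    then have "set (permuted_word ?ws \<sigma>) \<subseteq> triples G"
      using cyclic_word_triples[OF hs, of "is"] by blast
    moreover have "permuted_word ?ws \<sigma> \<noteq> []" using len by (simp add: permuted_word_def)
    moreover have "permuted_word ?ws id = ?ws"
      by (rule nth_equalityI) (simp_all add: nth_permuted_word)
    ultimately show ?thesis
      using closed_permuted_cyclic_word[OF s len] closed_cyclic_word[of "is" hs]
      by (auto simp: trace_bar_unit map_label_cyclic_word)
  qed
  have "alternation trace_bar (map E ?ws)
      = (\<Sum>\<sigma> | \<sigma> permutes {1..n}. scale_pm (of_int (sign \<sigma>)) (trace_bar (permuted_word (map E ?ws) \<sigma>)))"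
    using len by (intro sum_permutations_eq_alternation[symmetric]) simp
  also have "\<dots> = (\<Sum>\<sigma> | \<sigma> permutes {1..n}. if \<sigma> = id then Poly_Mapping.single (tl hs) 1 else 0)"
    using summand by (intro sum.cong refl) (simp add: sign_id)
  also have "\<dots> = Poly_Mapping.single (tl hs) 1"
    by (simp add: sum.delta finite_permutations permutes_id)
  finally show ?thesis .
qed

lemma tensor_class_linear_CL: "tensor_class R n \<in> linear_maps (free_module (words R n)) (CL R n)"
  unfolding CL_def by (rule tensor_class_linear[OF vect_R])

lemma tensor_class_sum:
  assumes "\<And>a. a \<in> I \<Longrightarrow> Poly_Mapping.keys (h a) \<subseteq> words R n"
  shows "(\<Oplus>\<^bsub>CL R n\<^esub>a\<in>I. tensor_class R n (h a)) = tensor_class R n (\<Sum>a\<in>I. h a)"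
proof -
  have "tensor_class R n (\<Oplus>\<^bsub>free_module (words R n)\<^esub>a\<in>I. h a) = (\<Oplus>\<^bsub>CL R n\<^esub>a\<in>I. tensor_class R n (h a))"
    using assms by (intro linear_maps_finsum[OF vect_free_module vect_CL tensor_class_linear_CL]) auto
  then show ?thesis using assms by (simp add: finsum_free_module)
qed

lemma tensor_class_scale:
  "Poly_Mapping.keys h \<subseteq> words R n \<Longrightarrow> c \<odot>\<^bsub>CL R n\<^esub> tensor_class R n h = tensor_class R n (scale_pm c h)"
  using linear_maps_smult[OF tensor_class_linear_CL, of h n c] by simp

lemma tensor_class_mem: "Poly_Mapping.keys h \<subseteq> words R n \<Longrightarrow> tensor_class R n h \<in> carrier (CL R n)"
  using linear_maps_closed[OF tensor_class_linear_CL, of h n] by simp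

text \<open>In a cyclic word with distinct indices only cyclically adjacent letters have a nonzero commutator, and each of these has one nonzero term, which is a Hochschild face.\<close>

lemma leibniz_diff_cyclic_word:
  assumes n: "1 \<le> n" and len: "length hs = Suc n" "length is = Suc n" "distinct is" and hs: "set hs \<subseteq> carrier G"
  defines "F \<equiv> \<lambda>k. Poly_Mapping.single (map E (hochschild_face (triple_mult G) k (cyclic_word is hs))) (1::'k)"
  shows "leibniz_diff R (Suc n) (tensor R (map E (cyclic_word is hs))) = tensor_class R n (\<Sum>k\<le>n. signed k (F k))"
    and "k \<le> n \<Longrightarrow> Poly_Mapping.keys (F k) \<subseteq> words R n"
proof -
  interpret R: vect R by (rule vect_R)
  interpret C: vect "CL R n" by (rule vect_CL)
  interpret FM: vect "free_module (words R n)" by (rule vect_free_module)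
  let ?ws = "cyclic_word is hs"
  let ?xs = "map E ?ws"
  have wk: "?ws ! p \<in> triples G" if "p < Suc n" for p
    using cyclic_word_triples[OF hs, of "is"] nth_mem[of p ?ws] that len by auto
  have w: "?xs \<in> words R (Suc n)"
    by (rule cyclic_unit_word[OF len(1) hs])
  have face_words: "map E (hochschild_face (triple_mult G) k ?ws) \<in> words R n" if k: "k \<le> n" for k
  proof (rule unit_words)
    have "hochschild_face (triple_mult G) k ?ws ! q \<in> triples G" if "q < n" for q
      using that k n len wk by (subst nth_hochschild_face) (auto simp: in_triples_iff)
    then show "set (hochschild_face (triple_mult G) k ?ws) \<subseteq> triples G"
      using k n len by (metis in_set_conv_nth subsetI length_hochschild_face length_cyclic_word
          Suc_le_mono le_imp_less_Suc diff_Suc_1 One_nat_def numeral_2_eq_2)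
  qed (use k n len in simp)
  then show keysF: "Poly_Mapping.keys (F k) \<subseteq> words R n" if "k \<le> n" for k
    using that unfolding F_def by simp
  define a where "a j i = (if j = Suc i then F i else 0)" for j i
  define b where "b j i = (if i = 0 \<and> j = n then F n else 0)" for j i :: nat
  have keys_a: "Poly_Mapping.keys (a j i) \<subseteq> words R n" if "i < j" "j < Suc n" for i j
    using keysF[of i] that unfolding a_def by auto
  have keys_b: "Poly_Mapping.keys (b j i) \<subseteq> words R n" for i j
    using keysF[of n] unfolding b_def by auto
  have zero_class: "tensor_class R n 0 = \<zero>\<^bsub>CL R n\<^esub>"
    using linear_maps_zero[OF vect_free_module vect_CL tensor_class_linear_CL] by simp
  have summand: "tensor R (remove_nth j (?xs[i := commutator R (?xs ! i) (?xs ! j)])) = tensor_class R n (a j i - b j i)"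
    if ij: "i < j" "j < Suc n" for i j
  proof -
    let ?y = "remove_nth j ?xs"
    have lr: "length (remove_nth j v) = n" if "length v = Suc n" for v :: "'x list"
      using that ij by (simp add: remove_nth_def)
    have nr: "remove_nth j v ! q = (if q < j then v ! q else v ! Suc q)" if "length v = Suc n" "q < n" for v :: "'x list" and q
      using that ij by (auto simp: remove_nth_def nth_append)
    have y: "?y \<in> words R n"
    proof -
      have "set ?y \<subseteq> set ?xs" by (rule set_remove_nth)
      then show ?thesis using w lr[of ?xs] len by auto
    qed
    have upd: "remove_nth j (?xs[i := z]) = ?y[i := z]" for z
      using ij len by (intro nth_equalityI) (auto simp: lr nr nth_list_update)
    have i: "i < n" using ij by simp
    have mem: "?xs ! i \<in> carrier R" "?xs ! j \<in> carrier R" using words_nth[OF w] ij by auto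
    note xy = bilinear_multD(3)[OF bilinear_R mem] bilinear_multD(3)[OF bilinear_R mem(2,1)]
    note lin = multilinearD(2)[OF tensor_multilinear[OF vect_R] y i, folded CL_def]
    have zero: "tensor R (?y[i := \<zero>\<^bsub>R\<^esub>]) = \<zero>\<^bsub>CL R n\<^esub>"
      by (rule linear_maps_zero[OF vect_R vect_CL lin])
    have single: "tensor R v = tensor_class R n (Poly_Mapping.single v 1)" if "length v = n" for v
      using that by (simp add: tensor_eq_class)
    have "tensor R (?y[i := ?xs ! i \<otimes>\<^bsub>R\<^esub> ?xs ! j]) = tensor_class R n (a j i)"
    proof (cases "j = Suc i")
      case True
      have "?xs ! i \<otimes>\<^bsub>R\<^esub> ?xs ! j = E (triple_mult G (?ws ! i) (?ws ! j))"
        using unit_matrix_mult[of "?ws ! i" "?ws ! j"] wk ij True len by (simp add: nth_cyclic_word)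
      moreover have "?y[i := E (triple_mult G (?ws ! i) (?ws ! j))] = map E (hochschild_face (triple_mult G) i ?ws)"
        using ij len n True
        by (intro nth_equalityI) (auto simp: lr[unfolded True] nr[unfolded True] nth_list_update nth_hochschild_face)
      ultimately show ?thesis
        using True n len ij by (simp add: a_def F_def single)
    next
      case False
      have "is ! i \<noteq> is ! (j - 1)"
        using False ij len by (simp add: nth_eq_iff_index_eq)
      then have "?xs ! i \<otimes>\<^bsub>R\<^esub> ?xs ! j = \<zero>\<^bsub>R\<^esub>"
        using unit_matrix_mult[of "?ws ! i" "?ws ! j"] wk ij len by (simp add: nth_cyclic_word)
      then show ?thesis using False by (simp only: zero zero_class a_def if_False)
    qed
    moreover have "tensor R (?y[i := ?xs ! j \<otimes>\<^bsub>R\<^esub> ?xs ! i]) = tensor_class R n (b j i)"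
    proof (cases "i = 0 \<and> j = n")
      case True
      have "?xs ! j \<otimes>\<^bsub>R\<^esub> ?xs ! i = E (triple_mult G (?ws ! j) (?ws ! i))"
        using unit_matrix_mult[of "?ws ! j" "?ws ! i"] wk ij True len by (simp add: nth_cyclic_word)
      moreover have "?y[i := E (triple_mult G (?ws ! j) (?ws ! i))] = map E (hochschild_face (triple_mult G) n ?ws)"
        using ij len n True
        by (intro nth_equalityI)
          (auto simp: lr[unfolded conjunct2[OF True]] nr[unfolded conjunct2[OF True]] nth_list_update nth_hochschild_face)
      ultimately show ?thesis
        using True n len ij by (simp add: b_def F_def single)
    next
      case False
      have "is ! j \<noteq> is ! (if i = 0 then n else i - 1)"
        using False ij len by (auto simp: nth_eq_iff_index_eq)
      then have "col (?ws ! j) \<noteq> row (?ws ! i)" using ij len by (cases "i = 0") (simp_all add: nth_cyclic_word)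
      then have "?xs ! j \<otimes>\<^bsub>R\<^esub> ?xs ! i = \<zero>\<^bsub>R\<^esub>"
        using unit_matrix_mult[of "?ws ! j" "?ws ! i"] wk ij len by simp
      then show ?thesis using False by (simp only: zero zero_class b_def if_False)
    qed
    moreover have "tensor R (?y[i := commutator R (?xs ! i) (?xs ! j)])
        = tensor R (?y[i := ?xs ! i \<otimes>\<^bsub>R\<^esub> ?xs ! j]) \<ominus>\<^bsub>CL R n\<^esub> tensor R (?y[i := ?xs ! j \<otimes>\<^bsub>R\<^esub> ?xs ! i])"
      unfolding commutator_def by (rule linear_maps_minus[OF vect_R vect_CL lin xy])
    moreover have "tensor_class R n (a j i - b j i) = tensor_class R n (a j i) \<ominus>\<^bsub>CL R n\<^esub> tensor_class R n (b j i)"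
      using linear_maps_minus[OF vect_free_module vect_CL tensor_class_linear_CL, of "a j i" n "b j i"]
        keys_a[OF ij] keys_b[of j i] by (simp add: FM.minus_combination)
    ultimately show ?thesis unfolding upd by simp
  qed
  have keys_ab: "Poly_Mapping.keys (signed (j + 1) (a j i - b j i)) \<subseteq> words R n" if "i < j" "j < Suc n" for i j
    using keys_scale_pm[of "(- 1) ^ (j + 1)" "a j i - b j i"] Poly_Mapping.keys_diff[of "a j i" "b j i"] keys_a[OF that] keys_b[of j i] by blast
  have "leibniz_diff R (Suc n) (tensor R ?xs) = (\<Oplus>\<^bsub>CL R n\<^esub> j \<in> {0..<Suc n}. \<Oplus>\<^bsub>CL R n\<^esub> i \<in> {0..<j}.
        (- 1) ^ (j + 1) \<odot>\<^bsub>CL R n\<^esub> tensor R (remove_nth j (?xs[i := commutator R (?xs ! i) (?xs ! j)])))"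
    using leibniz_diff_tensor[OF w] by (simp only: diff_Suc_1)
  also have "\<dots> = (\<Oplus>\<^bsub>CL R n\<^esub> j \<in> {0..<Suc n}. \<Oplus>\<^bsub>CL R n\<^esub> i \<in> {0..<j}. tensor_class R n (signed (j + 1) (a j i - b j i)))"
  proof -
    have t: "(- 1) ^ (j + 1) \<odot>\<^bsub>CL R n\<^esub> tensor R (remove_nth j (?xs[i := commutator R (?xs ! i) (?xs ! j)]))
        = tensor_class R n (signed (j + 1) (a j i - b j i))" if "i < j" "j < Suc n" for i j
      unfolding summand[OF that]
      by (rule tensor_class_scale[OF order.trans[OF Poly_Mapping.keys_diff Un_least[OF keys_a[OF that] keys_b]]])
    show ?thesis
      by (intro C.finsum_cong' refl Pi_I C.finsum_closed t tensor_class_mem keys_ab) auto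
  qed
  also have "\<dots> = (\<Oplus>\<^bsub>CL R n\<^esub> j \<in> {0..<Suc n}. tensor_class R n (\<Sum>i\<in>{0..<j}. signed (j + 1) (a j i - b j i)))"
    by (intro C.finsum_cong' refl Pi_I tensor_class_sum tensor_class_mem order.trans[OF Poly_Mapping.keys_sum] UN_least keys_ab) auto
  also have "\<dots> = tensor_class R n (\<Sum>j\<in>{0..<Suc n}. \<Sum>i\<in>{0..<j}. signed (j + 1) (a j i - b j i))"
    by (intro tensor_class_sum order.trans[OF Poly_Mapping.keys_sum] UN_least keys_ab) auto
  also have "(\<Sum>j\<in>{0..<Suc n}. \<Sum>i\<in>{0..<j}. signed (j + 1) (a j i - b j i)) = (\<Sum>k\<le>n. signed k (F k))"
  proof -
    have "(\<Sum>j<Suc n. \<Sum>i<j. signed (j + 1) (a j i)) = (\<Sum>k<n. signed k (F k))"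
    proof -
      have "(\<Sum>i<Suc k. signed (Suc k + 1) (a (Suc k) i)) = signed k (F k)" for k
        by (simp add: a_def)
      then show ?thesis by (subst sum.lessThan_Suc_shift) simp
    qed
    moreover have "(\<Sum>j<Suc n. \<Sum>i<j. signed (j + 1) (b j i)) = - signed n (F n)"
    proof -
      have "(\<Sum>i<j. signed (j + 1) (b j i)) = (if j = n then - signed n (F n) else 0)" for j
      proof (cases "j = n")
        case True
        then have "(\<Sum>i<j. signed (j + 1) (b j i)) = (\<Sum>i<n. if i = 0 then signed (n + 1) (F n) else 0)"
          by (intro sum.cong) (auto simp: b_def)
        then show ?thesis using n True by simp
      qed (simp add: b_def)
      then show ?thesis by simp
    qed
    moreover have "(\<Sum>k\<le>n. signed k (F k)) = (\<Sum>k<n. signed k (F k)) + signed n (F n)"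
      by (simp flip: lessThan_Suc_atMost)
    ultimately show ?thesis
      by (simp add: atLeast0LessThan pm.scale_right_diff_distrib sum_subtractf del: sum.lessThan_Suc power_Suc)
  qed
  finally show "leibniz_diff R (Suc n) (tensor R ?xs) = tensor_class R n (\<Sum>k\<le>n. signed k (F k))" .
qed

lemma leibniz_diff_cyclic_word_faces:
  assumes n: "1 \<le> n" and len: "length hs = Suc n" "length is = Suc n" "distinct is" and hs: "set hs \<subseteq> carrier G"
  shows "leibniz_diff R (Suc n) (tensor R (map E (cyclic_word is hs)))
    = (\<Oplus>\<^bsub>CL R n\<^esub>k\<in>{..n}. (- 1) ^ k \<odot>\<^bsub>CL R n\<^esub>
        tensor R (map E (cyclic_word (remove_nth k is) (hochschild_face (monoid.mult G) k hs))))"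
proof -
  interpret C: vect "CL R n" by (rule vect_CL)
  let ?F = "\<lambda>k. Poly_Mapping.single (map E (hochschild_face (triple_mult G) k (cyclic_word is hs))) (1::'k)"
  have keys: "Poly_Mapping.keys (?F k) \<subseteq> words R n" if "k \<in> {..n}" for k
    using leibniz_diff_cyclic_word(2)[OF n len hs] that by blast
  have t: "tensor_class R n (?F k) = tensor R (map E (cyclic_word (remove_nth k is) (hochschild_face (monoid.mult G) k hs)))"
    if "k \<in> {..n}" for k
    using that n len cyclic_word_face[OF len(2,1) n, of k G] by (simp add: tensor_eq_class)
  have "leibniz_diff R (Suc n) (tensor R (map E (cyclic_word is hs))) = tensor_class R n (\<Sum>k\<le>n. signed k (?F k))"
    by (rule leibniz_diff_cyclic_word(1)[OF n len hs])
  also have "\<dots> = (\<Oplus>\<^bsub>CL R n\<^esub>k\<in>{..n}. tensor_class R n (signed k (?F k)))"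
    by (intro tensor_class_sum[symmetric] order.trans[OF keys_scale_pm] keys)
  also have "\<dots> = (\<Oplus>\<^bsub>CL R n\<^esub>k\<in>{..n}. (- 1) ^ k \<odot>\<^bsub>CL R n\<^esub> tensor_class R n (?F k))"
    by (intro C.finsum_cong' refl Pi_I tensor_class_scale[symmetric] C.smult_mem tensor_class_mem keys)
  also have "\<dots> = (\<Oplus>\<^bsub>CL R n\<^esub>k\<in>{..n}. (- 1) ^ k \<odot>\<^bsub>CL R n\<^esub>
        tensor R (map E (cyclic_word (remove_nth k is) (hochschild_face (monoid.mult G) k hs))))"
    using C.smult_mem[OF tensor_class_mem[OF keys]] t by (intro C.finsum_cong') auto
  finally show ?thesis .
qed

text \<open>The section \<open>(g\<^sub>1, \<dots>, g\<^sub>n) \<mapsto> ((g\<^sub>1 \<dots> g\<^sub>n)\<^sup>-\<^sup>1, g\<^sub>1, \<dots>, g\<^sub>n)\<close> of the projection from the Hochschild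
  complex of the group ring to the bar complex.\<close>

definition total :: "'g list \<Rightarrow> 'g" where
  "total gs = foldr (monoid.mult G) gs \<one>\<^bsub>G\<^esub>"

definition cyclic_lift :: "'g list \<Rightarrow> 'g list" where
  "cyclic_lift gs = inv\<^bsub>G\<^esub> (total gs) # gs"

lemma total_closed: "set gs \<subseteq> carrier G \<Longrightarrow> total gs \<in> carrier G"
  by (induction gs) (auto simp: total_def)

lemma total_append: "set gs \<subseteq> carrier G \<Longrightarrow> set hs \<subseteq> carrier G \<Longrightarrow> total (gs @ hs) = total gs \<otimes>\<^bsub>G\<^esub> total hs"
proof (induction gs)
  case (Cons g gs)
  then show ?case using total_closed[of gs] total_closed[of hs] by (simp add: total_def m_assoc)
qed (use total_closed in \<open>simp add: total_def\<close>)

lemma cyclic_lift_closed: "set gs \<subseteq> carrier G \<Longrightarrow> set (cyclic_lift gs) \<subseteq> carrier G"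
  using total_closed by (auto simp: cyclic_lift_def)

text \<open>The first entry makes the product of all entries trivial.  Faces preserve that product up to
  conjugation, so they preserve its triviality, and the first entry is determined by the others.\<close>

lemma cyclic_lift_face:
  assumes gs: "length gs = n" "set gs \<subseteq> carrier G" and n: "1 \<le> n" and k: "k \<le> n"
  shows "hochschild_face (monoid.mult G) k (cyclic_lift gs) = cyclic_lift (bar_face G n k gs)"
proof -
  let ?v = "hochschild_face (monoid.mult G) k (cyclic_lift gs)"
  have len: "length (cyclic_lift gs) = Suc n" using gs by (simp add: cyclic_lift_def)
  have v: "length ?v = n" using len n k by simp
  have "tl ?v = bar_face G n k gs"
    using tl_hochschild_face[OF len n k, of G] by (simp add: cyclic_lift_def)
  moreover have "hd ?v = inv\<^bsub>G\<^esub> (total (bar_face G n k gs))"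
  proof -
    have hd: "hd ?v = ?v ! 0" using v n by (intro hd_conv_nth) auto
    consider "k = 0" | "0 < k" "k < n" | "k = n" using k by linarith
    then show ?thesis
    proof cases
      case 1
      obtain g hs where g: "gs = g # hs" using gs n by (cases gs) auto
      have "g \<in> carrier G" "total hs \<in> carrier G" using gs g total_closed[of hs] by auto
      then have "inv\<^bsub>G\<^esub> (g \<otimes>\<^bsub>G\<^esub> total hs) \<otimes>\<^bsub>G\<^esub> g = inv\<^bsub>G\<^esub> (total hs)"
        by (simp add: inv_mult_group m_assoc)
      then show ?thesis
        unfolding hd using 1 g gs n by (simp add: hochschild_face_def cyclic_lift_def bar_face_def total_def)
    next
      case 2
      define us vs where "us = take (k - 1) gs" and "vs = drop (k + 1) gs"
      have k': "k - 1 < length gs" "k < length gs" using 2 gs by auto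
      have split: "gs = us @ [gs ! (k - 1), gs ! k] @ vs"
        unfolding us_def vs_def using 2 k' by (metis Cons_nth_drop_Suc Suc_diff_1 Suc_eq_plus1 append_Cons append_Nil append_take_drop_id)
      have mem: "set us \<subseteq> carrier G" "set vs \<subseteq> carrier G" "gs ! (k - 1) \<in> carrier G" "gs ! k \<in> carrier G"
        using gs(2) k' by (auto simp: us_def vs_def dest: in_set_takeD in_set_dropD)
      have "total gs = total us \<otimes>\<^bsub>G\<^esub> total ([gs ! (k - 1), gs ! k] @ vs)"
        using mem by (subst split) (rule total_append; simp)
      also have "total ([gs ! (k - 1), gs ! k] @ vs) = total ([gs ! (k - 1) \<otimes>\<^bsub>G\<^esub> gs ! k] @ vs)"
        using mem total_closed[OF mem(2)] by (simp add: total_def m_assoc)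
      also have "total us \<otimes>\<^bsub>G\<^esub> \<dots> = total (us @ [gs ! (k - 1) \<otimes>\<^bsub>G\<^esub> gs ! k] @ vs)"
        using mem by (intro total_append[symmetric]) auto
      also have "us @ [gs ! (k - 1) \<otimes>\<^bsub>G\<^esub> gs ! k] @ vs = bar_face G n k gs"
        using 2 by (simp add: bar_face_def us_def vs_def)
      finally show ?thesis
        unfolding hd using 2 gs by (simp add: nth_hochschild_face len cyclic_lift_def)
    next
      case 3
      have split: "gs = butlast gs @ [last gs]" using gs n by (intro append_butlast_last_id[symmetric]) auto
      have mem: "set (butlast gs) \<subseteq> carrier G" "last gs \<in> carrier G"
        using gs n last_in_set[of gs] by (cases "gs = []"; auto dest: in_set_butlastD)+
      have "total gs = total (butlast gs) \<otimes>\<^bsub>G\<^esub> last gs"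
        using mem total_append[of "butlast gs" "[last gs]"] split by (simp add: total_def)
      then have "last gs \<otimes>\<^bsub>G\<^esub> inv\<^bsub>G\<^esub> (total gs) = inv\<^bsub>G\<^esub> (total (butlast gs))"
        using mem total_closed[OF mem(1)] by (simp add: inv_mult_group flip: m_assoc)
      moreover have "gs \<noteq> []" using gs n by auto
      ultimately show ?thesis
        unfolding hd using 3 gs n len by (simp add: hochschild_face_def cyclic_lift_def bar_face_def)
    qed
  qed
  moreover have "?v = hd ?v # tl ?v" using v n by (cases ?v) auto
  ultimately show ?thesis by (simp add: cyclic_lift_def)
qed

definition cyclic_chain :: "nat \<Rightarrow> (nat list \<Rightarrow>\<^sub>0 'k) \<Rightarrow> 'g list \<Rightarrow> ((nat \<Rightarrow> nat \<Rightarrow> 'g \<Rightarrow>\<^sub>0 'k) list \<Rightarrow>\<^sub>0 'k) set" where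
  "cyclic_chain n c hs = linear_extension (CL R n) (\<lambda>is. tensor R (map E (cyclic_word is hs))) c"

definition bar_to_gl :: "(nat list \<Rightarrow>\<^sub>0 'k) \<Rightarrow> nat \<Rightarrow> ('g list \<Rightarrow>\<^sub>0 'k) \<Rightarrow> ((nat \<Rightarrow> nat \<Rightarrow> 'g \<Rightarrow>\<^sub>0 'k) list \<Rightarrow>\<^sub>0 'k) set" where
  "bar_to_gl c n = linear_extension (CL R (Suc n)) (\<lambda>gs. cyclic_chain (Suc n) c (cyclic_lift gs))"

context
  fixes n :: nat and hs :: "'g list"
  assumes hs: "length hs = n" "set hs \<subseteq> carrier G"
begin

lemma cyclic_tensor_mem: "tensor R (map E (cyclic_word is hs)) \<in> carrier (CL R n)"
  unfolding CL_def by (rule tensor_closed[OF vect_R cyclic_unit_word[OF hs]])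

lemma cyclic_chain_linear: "(\<lambda>c. cyclic_chain n c hs) \<in> linear_maps (free_module B) (CL R n)"
  unfolding cyclic_chain_def by (rule linear_extension_linear[OF vect_CL cyclic_tensor_mem])

lemma cyclic_chain_single:
  "cyclic_chain n (Poly_Mapping.single is 1) hs = tensor R (map E (cyclic_word is hs))"
  unfolding cyclic_chain_def
  by (rule linear_extension_single[OF vect_CL, of "\<lambda>is. tensor R (map E (cyclic_word is hs))"])
    (rule cyclic_tensor_mem)

lemma cyclic_chain_mem: "cyclic_chain n c hs \<in> carrier (CL R n)"
  using linear_maps_closed[OF cyclic_chain_linear[of UNIV], of c] by simp

end

lemma cyclic_lift_props:
  assumes "length gs = n" "set gs \<subseteq> carrier G"
  shows "length (cyclic_lift gs) = Suc n" "set (cyclic_lift gs) \<subseteq> carrier G" "tl (cyclic_lift gs) = gs"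
  using assms cyclic_lift_closed[of gs] by (simp_all add: cyclic_lift_def)

lemma bar_to_gl_linear: "bar_to_gl c n \<in> linear_maps (bar G n) (CL R (Suc n))"
  unfolding bar_to_gl_def bar_def
  by (rule linear_extension_linear[OF vect_CL], rule cyclic_chain_mem[OF cyclic_lift_props(1,2)]) auto

lemma bar_to_gl_single:
  assumes "length gs = n" "set gs \<subseteq> carrier G"
  shows "bar_to_gl c n (Poly_Mapping.single gs 1) = cyclic_chain (Suc n) c (cyclic_lift gs)"
  unfolding bar_to_gl_def
  by (rule linear_extension_single[OF vect_CL, of "\<lambda>gs. cyclic_chain (Suc n) c (cyclic_lift gs)"])
    (rule cyclic_chain_mem[OF cyclic_lift_props(1,2)[OF assms]])

lemma gl_to_bar_cyclic_chain:
  assumes hs: "length hs = Suc n" "set hs \<subseteq> carrier G" and c: "Poly_Mapping.keys c \<subseteq> distinct_lists (Suc n)"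
  shows "gl_to_bar G n (cyclic_chain (Suc n) c hs) = scale_pm (mass c) (Poly_Mapping.single (tl hs) 1)"
proof -
  have r: "(\<lambda>c :: nat list \<Rightarrow>\<^sub>0 'k. scale_pm (mass c) (Poly_Mapping.single (tl hs) 1)) \<in> linear_maps (free_module (distinct_lists (Suc n))) (bar G n)"
  proof (rule linear_mapsI)
    have "set (tl hs) \<subseteq> carrier G" using hs by (cases hs) auto
    then show "scale_pm (mass c) (Poly_Mapping.single (tl hs) 1) \<in> carrier (bar G n)" for c :: "nat list \<Rightarrow>\<^sub>0 'k"
      using hs by (auto split: if_splits)
  next
    fix x y :: "nat list \<Rightarrow>\<^sub>0 'k"
    have "mass (x + y) = mass x + mass y" using linear_maps_add[OF mass_linear[of UNIV], of x y] by simp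
    then show "scale_pm (mass (x \<oplus>\<^bsub>free_module (distinct_lists (Suc n))\<^esub> y)) (Poly_Mapping.single (tl hs) 1)
        = scale_pm (mass x) (Poly_Mapping.single (tl hs) 1) \<oplus>\<^bsub>bar G n\<^esub> scale_pm (mass y) (Poly_Mapping.single (tl hs) 1)"
      by (simp add: pm.scale_left_distrib del: scale_pm_single)
  next
    fix a and x :: "nat list \<Rightarrow>\<^sub>0 'k"
    have "mass (scale_pm a x) = a * mass x" using linear_maps_smult[OF mass_linear[of UNIV], of x a] by simp
    then show "scale_pm (mass (a \<odot>\<^bsub>free_module (distinct_lists (Suc n))\<^esub> x)) (Poly_Mapping.single (tl hs) 1)
        = a \<odot>\<^bsub>bar G n\<^esub> scale_pm (mass x) (Poly_Mapping.single (tl hs) 1)"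
      by simp
  qed
  show ?thesis
  proof (rule free_module_linear_eqI[OF vect_bar linear_maps_comp[OF cyclic_chain_linear[OF hs] gl_to_bar_linear] r _ c])
    fix "is" assume "is \<in> distinct_lists (Suc n)"
    then show "gl_to_bar G n (cyclic_chain (Suc n) (Poly_Mapping.single is 1) hs)
        = scale_pm (mass (Poly_Mapping.single is 1)) (Poly_Mapping.single (tl hs) 1)"
      using alternation_cyclic_word[OF hs(1) _ _ hs(2), of "is"]
      by (simp only: cyclic_chain_single[OF hs] gl_to_bar_tensor[OF cyclic_unit_word[OF hs]] distinct_lists_def
          mem_Collect_eq mass_single pm.scale_one)
  qed
qed

text \<open>Of the alternation only the identity contributes, once for each index list, with total weight
  \<open>mass c = 1\<close>.\<close>

lemma gl_to_bar_section:
  assumes c: "Poly_Mapping.keys c \<subseteq> distinct_lists (Suc n)" "mass c = 1" and z: "z \<in> carrier (bar G n)"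
  shows "gl_to_bar G n (bar_to_gl c n z) = z"
proof -
  have id: "(\<lambda>x. x) \<in> linear_maps (bar G n) (bar G n)" by (rule linear_mapsI) auto
  show ?thesis
  proof (rule bar_linear_eqI[OF vect_bar linear_maps_comp[OF bar_to_gl_linear gl_to_bar_linear] id _ z])
    fix gs assume gs: "length gs = n" "set gs \<subseteq> carrier G"
    show "gl_to_bar G n (bar_to_gl c n (Poly_Mapping.single gs 1)) = Poly_Mapping.single gs 1"
      by (simp only: bar_to_gl_single[OF gs] gl_to_bar_cyclic_chain[OF cyclic_lift_props(1,2)[OF gs] c(1)]
          c(2) pm.scale_one cyclic_lift_props(3)[OF gs])
  qed
qed

lemma leibniz_diff_cyclic_chain:
  assumes n: "1 \<le> n" and hs: "length hs = Suc n" "set hs \<subseteq> carrier G"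
    and c: "Poly_Mapping.keys c \<subseteq> distinct_lists (Suc n)"
  shows "leibniz_diff R (Suc n) (cyclic_chain (Suc n) c hs) = (\<Oplus>\<^bsub>CL R n\<^esub>k\<in>{..n}. (- 1) ^ k \<odot>\<^bsub>CL R n\<^esub>
      cyclic_chain n (push (remove_nth k) c) (hochschild_face (monoid.mult G) k hs))"
proof -
  interpret C: vect "CL R n" by (rule vect_CL)
  have face: "length (hochschild_face (monoid.mult G) k hs) = n" "set (hochschild_face (monoid.mult G) k hs) \<subseteq> carrier G"
    if k: "k \<in> {..n}" for k
  proof -
    show len: "length (hochschild_face (monoid.mult G) k hs) = n" using k n hs by simp
    have "hs ! p \<in> carrier G" if "p < Suc n" for p using that hs nth_mem[of p hs] by auto
    then have "hochschild_face (monoid.mult G) k hs ! q \<in> carrier G" if "q < n" for q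
      using that k n hs by (subst nth_hochschild_face) auto
    then show "set (hochschild_face (monoid.mult G) k hs) \<subseteq> carrier G"
      using len by (metis in_set_conv_nth subsetI)
  qed
  let ?r = "\<lambda>c. \<Oplus>\<^bsub>CL R n\<^esub>k\<in>{..n}. (- 1) ^ k \<odot>\<^bsub>CL R n\<^esub>
      cyclic_chain n (push (remove_nth k) c) (hochschild_face (monoid.mult G) k hs)"
  have lin_k: "(\<lambda>c. (- 1) ^ k \<odot>\<^bsub>CL R n\<^esub> cyclic_chain n (push (remove_nth k) c) (hochschild_face (monoid.mult G) k hs))
      \<in> linear_maps (free_module (distinct_lists (Suc n))) (CL R n)" if "k \<in> {..n}" for k
  proof -
    have l: "(\<lambda>c. cyclic_chain n (push (remove_nth k) c) (hochschild_face (monoid.mult G) k hs))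
        \<in> linear_maps (free_module (distinct_lists (Suc n))) (CL R n)"
      by (rule linear_maps_free_subset[OF linear_maps_comp[OF push_linear cyclic_chain_linear[OF face[OF that]]]])
    show ?thesis by (rule linear_maps_combination(2)[OF vect_CL l l])
  qed
  have r: "?r \<in> linear_maps (free_module (distinct_lists (Suc n))) (CL R n)"
    by (rule linear_maps_sum[OF vect_CL lin_k])
  have l: "(\<lambda>c. leibniz_diff R (Suc n) (cyclic_chain (Suc n) c hs)) \<in> linear_maps (free_module (distinct_lists (Suc n))) (CL R n)"
    using linear_maps_comp[OF cyclic_chain_linear[OF hs] leibniz_diff_linear[of "Suc n"]] by simp
  show ?thesis
  proof (rule free_module_linear_eqI[OF vect_CL l r _ c])
    fix "is" assume "is \<in> distinct_lists (Suc n)"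
    then have i: "length is = Suc n" "distinct is" by (auto simp: distinct_lists_def)
    have "cyclic_chain n (push (remove_nth k) (Poly_Mapping.single is 1)) (hochschild_face (monoid.mult G) k hs)
        = tensor R (map E (cyclic_word (remove_nth k is) (hochschild_face (monoid.mult G) k hs)))" if "k \<in> {..n}" for k
      unfolding push_single by (rule cyclic_chain_single[OF face[OF that]])
    then show "leibniz_diff R (Suc n) (cyclic_chain (Suc n) (Poly_Mapping.single is 1) hs) = ?r (Poly_Mapping.single is 1)"
      unfolding cyclic_chain_single[OF hs] leibniz_diff_cyclic_word_faces[OF n hs(1) i hs(2)]
      using C.smult_mem[OF cyclic_tensor_mem[OF face]] by (intro C.finsum_cong') auto
  qed
qed

text \<open>Face \<open>k\<close> acts on the labels and on the index lists separately.  On the index lists its effect does not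
  depend on \<open>k\<close>, so what remains is the alternating sum of the faces of the labels.\<close>

lemma bar_to_gl_chain_map:
  assumes c: "Poly_Mapping.keys c \<subseteq> distinct_lists (Suc (Suc m))"
    and faces: "\<And>k. k \<le> Suc m \<Longrightarrow> push (remove_nth k) c = c'"
    and z: "z \<in> carrier (bar G (Suc m))"
  shows "leibniz_diff R (Suc (Suc m)) (bar_to_gl c (Suc m) z) = bar_to_gl c' m (bar_diff G (Suc m) z)"
proof -
  let ?n = "Suc m" and ?N = "Suc (Suc m)"
  have lin: "(\<lambda>z. leibniz_diff R ?N (bar_to_gl c ?n z)) \<in> linear_maps (bar G ?n) (CL R ?n)"
    using linear_maps_comp[OF bar_to_gl_linear[of c ?n] leibniz_diff_linear[of ?N]] by simp
  have lin': "(\<lambda>z. bar_to_gl c' m (bar_diff G ?n z)) \<in> linear_maps (bar G ?n) (CL R ?n)"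
    by (rule linear_maps_comp[OF bar_diff_linear[OF is_group] bar_to_gl_linear])
  show ?thesis
  proof (rule bar_linear_eqI[OF vect_CL lin lin' _ z])
    fix gs assume gs: "length gs = ?n" "set gs \<subseteq> carrier G"
    interpret C: vect "CL R ?n" by (rule vect_CL)
    interpret B: vect "bar G m" by (rule vect_bar)
    let ?f = "\<lambda>k. bar_face G ?n k gs"
    have face: "length (?f k) = m" "set (?f k) \<subseteq> carrier G" if "k \<in> {..?n}" for k
      using bar_face_closed[OF is_group gs, of k] that by auto
    have single: "Poly_Mapping.single (?f k) (1::'k) \<in> carrier (bar G m)" if "k \<in> {..?n}" for k
      using face[OF that] by simp
    have "leibniz_diff R ?N (bar_to_gl c ?n (Poly_Mapping.single gs 1))
        = (\<Oplus>\<^bsub>CL R ?n\<^esub>k\<in>{..?n}. (- 1) ^ k \<odot>\<^bsub>CL R ?n\<^esub>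
            cyclic_chain ?n (push (remove_nth k) c) (hochschild_face (monoid.mult G) k (cyclic_lift gs)))"
      unfolding bar_to_gl_single[OF gs]
      by (rule leibniz_diff_cyclic_chain[OF _ cyclic_lift_props(1,2)[OF gs] c]) simp
    also have "\<dots> = (\<Oplus>\<^bsub>CL R ?n\<^esub>k\<in>{..?n}. bar_to_gl c' m ((- 1) ^ k \<odot>\<^bsub>bar G m\<^esub> Poly_Mapping.single (?f k) 1))"
    proof (intro C.finsum_cong' refl Pi_I)
      fix k assume k: "k \<in> {..?n}"
      then have "hochschild_face (monoid.mult G) k (cyclic_lift gs) = cyclic_lift (?f k)" "push (remove_nth k) c = c'"
        using cyclic_lift_face[OF gs, of k] faces[of k] by auto
      then show "(- 1) ^ k \<odot>\<^bsub>CL R ?n\<^esub> cyclic_chain ?n (push (remove_nth k) c) (hochschild_face (monoid.mult G) k (cyclic_lift gs))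
          = bar_to_gl c' m ((- 1) ^ k \<odot>\<^bsub>bar G m\<^esub> Poly_Mapping.single (?f k) 1)"
        by (simp only: linear_maps_smult[OF bar_to_gl_linear single[OF k]] bar_to_gl_single[OF face[OF k]])
    next
      fix k assume k: "k \<in> {..?n}"
      show "bar_to_gl c' m ((- 1) ^ k \<odot>\<^bsub>bar G m\<^esub> Poly_Mapping.single (?f k) 1) \<in> carrier (CL R ?n)"
        by (rule linear_maps_closed[OF bar_to_gl_linear B.smult_mem[OF single[OF k]]])
    qed
    also have "\<dots> = bar_to_gl c' m (\<Oplus>\<^bsub>bar G m\<^esub>k\<in>{..?n}. (- 1) ^ k \<odot>\<^bsub>bar G m\<^esub> Poly_Mapping.single (?f k) 1)"
      using B.smult_mem[OF single] by (intro linear_maps_finsum[OF vect_bar vect_CL bar_to_gl_linear, symmetric]) (rule Pi_I)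
    also have "(\<Oplus>\<^bsub>bar G m\<^esub>k\<in>{..?n}. (- 1) ^ k \<odot>\<^bsub>bar G m\<^esub> Poly_Mapping.single (?f k) 1) = bar_diff G ?n (Poly_Mapping.single gs (1::'k))"
      by (simp only: bar_diff_single[OF is_group gs] bar_diff_inner(1)[OF is_group gs, unfolded atLeast0AtMost])
    finally show "leibniz_diff R ?N (bar_to_gl c ?n (Poly_Mapping.single gs 1))
        = bar_to_gl c' m (bar_diff G ?n (Poly_Mapping.single gs 1))" .
  qed
qed

lemma leibniz_diff_one:
  assumes "X \<in> carrier (CL R 1)"
  shows "leibniz_diff R 1 X = \<zero>\<^bsub>CL R 0\<^esub>"
proof -
  interpret C: vect "CL R 0" by (rule vect_CL)
  have P: "leibniz_diff R 1 \<in> linear_maps (tensor_power R 1) (CL R 0)"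
    using leibniz_diff_linear[of 1] by (simp add: CL_def)
  have Q: "(\<lambda>_. \<zero>\<^bsub>CL R 0\<^esub>) \<in> linear_maps (tensor_power R 1) (CL R 0)"
    by (rule linear_mapsI) auto
  have "leibniz_diff R 1 (tensor R xs) = \<zero>\<^bsub>CL R 0\<^esub>" if "xs \<in> words R 1" for xs
    unfolding leibniz_diff_tensor[OF that]
    by (simp add: C.finsum_single[of "\<lambda>_. \<zero>\<^bsub>CL R 0\<^esub>"])
  from tensor_power_linear_eqI[OF vect_R vect_CL P Q this] show ?thesis
    using assms by (simp add: CL_def)
qed

theorem gl_to_bar_split:
  "\<exists>s t. split_chain_map (CL R) (leibniz_diff R) (bar G) (bar_diff G) (gl_to_bar G) n s t"
proof -
  obtain c c' :: "nat list \<Rightarrow>\<^sub>0 'k" where c: "Poly_Mapping.keys c \<subseteq> distinct_lists (Suc n)" "mass c = 1"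
    and faces: "\<And>k. k \<le> n \<Longrightarrow> push (remove_nth k) c = c'"
    using equal_faces_exist[of n] by blast
  have "split_chain_map (CL R) (leibniz_diff R) (bar G) (bar_diff G) (gl_to_bar G) n
      (bar_to_gl c n) (bar_to_gl c' (n - 1))"
  proof (rule split_chain_map.intro)
    show "vect (CL R m)" "vect (bar G m :: ('k, 'g list \<Rightarrow>\<^sub>0 'k) module)" for m
      by (rule vect_CL vect_bar)+
    show "leibniz_diff R (Suc m) \<in> linear_maps (CL R (Suc m)) (CL R m)" for m
      using leibniz_diff_linear[of "Suc m"] by simp
    show "bar_diff G (Suc m) \<in> linear_maps (bar G (Suc m)) (bar G m :: ('k, 'g list \<Rightarrow>\<^sub>0 'k) module)" for m
      by (rule bar_diff_linear[OF is_group])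
    show "gl_to_bar G m \<in> linear_maps (CL R (Suc m)) (bar G m)" for m
      by (rule gl_to_bar_linear)
    show "gl_to_bar G m (leibniz_diff R (Suc (Suc m)) x) = bar_diff G (Suc m) (gl_to_bar G (Suc m) x)"
      if "x \<in> carrier (CL R (Suc (Suc m)))" for x m
      by (rule gl_to_bar_chain_map[OF that])
    show "leibniz_diff R 1 x = \<zero>\<^bsub>CL R 0\<^esub>" if "x \<in> carrier (CL R 1)" for x
      by (rule leibniz_diff_one[OF that])
    show "bar_to_gl c n z \<in> carrier (CL R (Suc n))" if "z \<in> carrier (bar G n)" for z
      by (rule linear_maps_closed[OF bar_to_gl_linear that])
    show "gl_to_bar G n (bar_to_gl c n z) = z" if "z \<in> carrier (bar G n)" for z
      by (rule gl_to_bar_section[OF c that])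
    show "bar_to_gl c' (n - 1) \<in> linear_maps (bar G (n - 1)) (CL R n)" if "n \<noteq> 0"
      using bar_to_gl_linear[of c' "n - 1"] that by simp
    show "leibniz_diff R (Suc n) (bar_to_gl c n z) = bar_to_gl c' (n - 1) (bar_diff G n z)"
      if n: "n \<noteq> 0" and z: "z \<in> carrier (bar G n)" for z
    proof -
      obtain m where m: "n = Suc m" using n by (cases n) auto
      show ?thesis
        using bar_to_gl_chain_map[of c m c' z] c(1) faces z unfolding m by simp
    qed
  qed
  then show ?thesis by blast
qed

end

theorem gl_to_bar_homology_cohomology:
  fixes G :: "('g, 'm) monoid_scheme" and A :: "('k::field, 'g \<Rightarrow>\<^sub>0 'k) module"
  assumes "group G" and A: "A = group_ring G"
  shows "gl_to_bar_homology G n \<in> linear_maps (HL (gl A) (Suc n)) (BG_homology G n)"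
    and "gl_to_bar_homology G n ` carrier (HL (gl A) (Suc n)) = carrier (BG_homology G n)"
    and "gl_to_bar_cohomology G n \<in> linear_maps (BG_cohomology G n) (HL_cohomology (gl A) (Suc n))"
    and "inj_on (gl_to_bar_cohomology G n) (carrier (BG_cohomology G n :: ('k, (('g list \<Rightarrow>\<^sub>0 'k) \<Rightarrow> 'k) set) module))"
proof -
  interpret group_algebra G A
    using assms by (simp add: group_algebra_def group_algebra_axioms_def)
  obtain s t where "split_chain_map (CL R) (leibniz_diff R) (bar G) (bar_diff G) (gl_to_bar G) n s t"
    using gl_to_bar_split by blast
  then interpret split_chain_map "CL R" "leibniz_diff R" "bar G" "bar_diff G" "gl_to_bar G" n s t .
  note defs = gl_to_bar_homology_def gl_to_bar_cohomology_def HL_def BG_homology_def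
    HL_cohomology_def BG_cohomology_def A[symmetric]
  show "gl_to_bar_homology G n \<in> linear_maps (HL (gl A) (Suc n)) (BG_homology G n)"
    "gl_to_bar_homology G n ` carrier (HL (gl A) (Suc n)) = carrier (BG_homology G n)"
    unfolding defs by (rule homology_map_surjective)+
  show "gl_to_bar_cohomology G n \<in> linear_maps (BG_cohomology G n) (HL_cohomology (gl A) (Suc n))"
    "inj_on (gl_to_bar_cohomology G n) (carrier (BG_cohomology G n :: ('k, (('g list \<Rightarrow>\<^sub>0 'k) \<Rightarrow> 'k) set) module))"
    unfolding defs by (rule cohomology_map_injective)+
qed

theorem theorem3p3:
  fixes G :: "('g, 'm) monoid_scheme"
    and A :: "('k::field_char_0, 'g \<Rightarrow>\<^sub>0 'k) module"
    and n :: nat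
  assumes "group G"
    and "A = group_ring G"
  shows "gl_to_bar_homology G n \<in> linear_maps (HL (gl A) (Suc n)) (BG_homology G n) \<and>
         gl_to_bar_homology G n ` carrier (HL (gl A) (Suc n)) = carrier (BG_homology G n) \<and>
         gl_to_bar_cohomology G n \<in> linear_maps (BG_cohomology G n) (HL_cohomology (gl A) (Suc n)) \<and>
         inj_on (gl_to_bar_cohomology G n) (carrier (BG_cohomology G n))"
  \<comment> \<open>The coefficient field of the last conjunct is a type of its own, for which the statement is
    instantiated separately.\<close>
  using gl_to_bar_homology_cohomology(1-3)[OF assms] gl_to_bar_homology_cohomology(4)[OF assms(1) refl]
  by (intro conjI)

end
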